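(* Let $\phi$ be a Drinfeld $A$-module over $\mathbb{C}_\infty$ with period lattice $\Lambda_\phi$. The functor $\mathrm{Sf}_{\phi^*}:A\text{-}\mathbf{Mod}\to A\text{-}\mathbf{Mod}$ of dual Anderson eigenvectors is represented by the $A$-module $\Lambda_\phi$ (i.e. it is naturally isomorphic to $\mathrm{Hom}_A(\Lambda_\phi,-)$), and the universal object is $$\zeta_\phi:=-\sum_{\lambda\in\Lambda_\phi\setminus\{0\}}\lambda^{-1}\otimes\lambda\in\mathbb{C}_\infty\overline\otimes\Lambda_\phi .$$
   Context: $X$ is a projective, geometrically irreducible, smooth curve over $\mathbb{F}_q$, $\infty\in X$ a closed point, $A$ the ring of rational functions on $X$ with no poles outside $\infty$, $K_\infty$ the completion of $\mathrm{Frac}(A)$ at $\infty$, $\mathbb{C}_\infty$ the completion of an algebraic closure of $K_\infty$. Tensor products are over $\mathbb{F}_q$. A Drinfeld $A$-module $(\mathbb{G}_a,\phi)$ is an $\mathbb{F}_q$-algebra homomorphism $\phi:A\to\mathbb{C}_\infty[\tau]$ (where $\tau c=c^q\tau$), $a\mapsto\phi_a=\sum_i(\phi_a)_i\tau^i$, with $(\phi_a)_0=a$ and $\phi_a\neq a$ for some $a$. Its exponential $\exp_\phi\in\mathbb{C}_\infty[\![\tau]\!]$ is the unique series with leading term $1$ such that $\exp_\phi a=\phi_a\exp_\phi$ for all $a\in A$; it is entire, and the period lattice is the $A$-module $\Lambda_\phi=\ker(\exp_\phi)\subseteq\mathbb{C}_\infty$ (discrete, finitely generated, projective). The adjoint of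 $\phi$ is $\phi^*_a=\sum_i\tau^{-i}(\phi_a)_i\in\mathbb{C}_\infty[\tau^{-1}]$, acting on $\mathbb{C}_\infty$ by $\phi^*_a(c)=\sum_i((\phi_a)_ic)^{q^{-i}}$. For a discrete $A$-module $M$ with $\mathbb{F}_q$-basis $(m_i)_i$, $\mathbb{C}_\infty\overline\otimes M$ is the completion of $\mathbb{C}_\infty\otimes M$ for the sup norm; its elements are uniquely $\sum_ic_i\otimes m_i$ with $c_i\to0$; $\phi_a^*\otimes1$ sends this element to $\sum_i\phi^*_a(c_i)\otimes m_i$ and $1\otimes a$ sends it to $\sum_ic_i\otimes am_i$. The functor of dual Anderson eigenvectors is $$\mathrm{Sf}_{\phi^*}(M)=\{\zeta\in\mathbb{C}_\infty\overline\otimes M\mid(\phi^*_a\otimes1)(\zeta)=(1\otimes a)\zeta\text{ for all }a\in A\},$$ with the obvious action on morphisms. *)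

theory Defs
  imports "HOL-Analysis.Analysis" "HOL-Algebra.Algebraic_Closure_Type" "HOL-Algebra.Module" "HOL-Algebra.Generated_Fields"
begin

section \<open>Function fields and places\<close>

text \<open>
  The metric of a valued field is the one of its absolute value, so that the absolute value
  of \<open>x\<close> is \<open>dist x 0\<close> and limits, closures and completeness are those of the library.
\<close>

class nonarch_field = field + metric_space +
  assumes dist_diff_zero: "dist x y = dist (x - y) 0"
    and dist_mult_zero: "dist (x * y) 0 = dist x 0 * dist y 0"
    and dist_add_zero_le: "dist (x + y) 0 \<le> max (dist x 0) (dist y 0)"

class complete_alg_closed_nonarch_field = nonarch_field + alg_closed_field + complete_space

abbreviation CC :: "'c::field ring"
  where "CC \<equiv> ring_of_type_algebra"

text \<open>
  A smooth projective geometrically irreducible curve over the finite field \<open>Fq\<close> is given by its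
  function field \<open>K\<close>.  Since \<open>Fq\<close> is perfect, geometric irreducibility amounts to \<open>Fq\<close> being
  algebraically closed in \<open>K\<close>.
\<close>

definition function_field :: "'c::field set \<Rightarrow> 'c set \<Rightarrow> bool" where
  "function_field Fq K \<longleftrightarrow>
     subfield Fq CC \<and> finite Fq \<and> subfield K CC \<and> Fq \<subseteq> K \<and>
     (\<exists>x\<in>K. ring.transcendental CC Fq x \<and>
            ring.finite_dimension CC (generate_field CC (insert x Fq)) K) \<and>
     (\<forall>x\<in>K. ring.algebraic CC Fq x \<longrightarrow> x \<in> Fq)"

text \<open>
  Closed points of the curve correspond to the valuation rings of \<open>K\<close> over \<open>Fq\<close>, a point being
  sent to its local ring.
\<close>

definition valuation_ring :: "'c::field set \<Rightarrow> 'c set \<Rightarrow> 'c set \<Rightarrow> bool" where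
  "valuation_ring Fq K V \<longleftrightarrow>
     subring V CC \<and> Fq \<subseteq> V \<and> V \<subset> K \<and> (\<forall>z\<in>K. z \<in> V \<or> inverse z \<in> V)"

definition regular_away :: "'c::field set \<Rightarrow> 'c set \<Rightarrow> 'c set \<Rightarrow> 'c set" where
  "regular_away Fq K Oinf = {f \<in> K. \<forall>V. valuation_ring Fq K V \<and> V \<noteq> Oinf \<longrightarrow> f \<in> V}"

text \<open>
  The ambient field \<open>'c\<close> is the completion of an algebraic closure of the completion of \<open>K\<close> at the
  point with local ring \<open>Oinf\<close>: its absolute value induces on \<open>K\<close> the topology of that point (so
  that \<open>closure K\<close> is the completion of \<open>K\<close>), and it is complete, algebraically closed and has the
  algebraic elements over \<open>closure K\<close> as a dense subset.
\<close>

locale curve_at_infinity =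
  fixes Fq K Oinf :: "'c::complete_alg_closed_nonarch_field set"
  assumes function_field: "function_field Fq K"
    and place_at_infinity: "valuation_ring Fq K Oinf"
    and abs_at_infinity: "{x \<in> K. dist x 0 \<le> 1} = Oinf"
    and algebraic_dense: "closure {x. ring.algebraic CC (closure K) x} = UNIV"

definition coord_ring :: "'c::field set \<Rightarrow> 'c set \<Rightarrow> 'c set \<Rightarrow> 'c ring" where
  "coord_ring Fq K Oinf = CC\<lparr>carrier := regular_away Fq K Oinf\<rparr>"


section \<open>Drinfeld modules\<close>

text \<open>
  A skew power series \<open>\<Sum>\<^sub>i f\<^sub>i \<tau>\<^sup>i\<close> is its sequence of coefficients; skew polynomials are those with
  finitely many nonzero coefficients.  The product is determined by \<open>\<tau> c = c\<^sup>q \<tau>\<close>.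
\<close>

definition skew_mult :: "nat \<Rightarrow> (nat \<Rightarrow> 'c::field) \<Rightarrow> (nat \<Rightarrow> 'c) \<Rightarrow> nat \<Rightarrow> 'c" where
  "skew_mult q f g = (\<lambda>n. \<Sum>i\<le>n. f i * g (n - i) ^ (q ^ i))"

definition skew_const :: "'c::field \<Rightarrow> nat \<Rightarrow> 'c" where
  "skew_const c = (\<lambda>i. if i = 0 then c else 0)"

definition drinfeld_module :: "'c::field set \<Rightarrow> 'c set \<Rightarrow> ('c \<Rightarrow> nat \<Rightarrow> 'c) \<Rightarrow> bool" where
  "drinfeld_module Fq A \<phi> \<longleftrightarrow>
     (\<forall>a\<in>A. finite {i. \<phi> a i \<noteq> 0}) \<and>
     (\<forall>a\<in>A. \<forall>b\<in>A. \<phi> (a + b) = (\<lambda>i. \<phi> a i + \<phi> b i)) \<and>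
     (\<forall>a\<in>A. \<forall>b\<in>A. \<phi> (a * b) = skew_mult (card Fq) (\<phi> a) (\<phi> b)) \<and>
     (\<forall>c\<in>Fq. \<phi> c = skew_const c) \<and>
     (\<forall>a\<in>A. \<phi> a 0 = a) \<and>
     (\<exists>a\<in>A. \<phi> a \<noteq> skew_const a)"

definition drinfeld_exp :: "nat \<Rightarrow> 'c::field set \<Rightarrow> ('c \<Rightarrow> nat \<Rightarrow> 'c) \<Rightarrow> nat \<Rightarrow> 'c" where
  "drinfeld_exp q A \<phi> =
     (THE e. e 0 = 1 \<and> (\<forall>a\<in>A. skew_mult q e (skew_const a) = skew_mult q (\<phi> a) e))"

definition period_lattice ::
  "nat \<Rightarrow> 'c::nonarch_field set \<Rightarrow> ('c \<Rightarrow> nat \<Rightarrow> 'c) \<Rightarrow> 'c set" where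
  "period_lattice q A \<phi> = {z. (\<lambda>n. drinfeld_exp q A \<phi> n * z ^ (q ^ n)) sums 0}"

definition frob_root :: "nat \<Rightarrow> nat \<Rightarrow> 'c::field \<Rightarrow> 'c" where
  "frob_root q i x = (THE y. y ^ (q ^ i) = x)"

definition adjoint_act :: "nat \<Rightarrow> (nat \<Rightarrow> 'c::field) \<Rightarrow> 'c \<Rightarrow> 'c" where
  "adjoint_act q f c = (\<Sum>i | f i \<noteq> 0. frob_root q i (f i * c))"


section \<open>Modules\<close>

text \<open>
  The locale \<^locale>\<open>module\<close> ignores the fields \<open>mult\<close> and \<open>one\<close> of a module record.
\<close>

definition mk_module ::
  "'m set \<Rightarrow> 'm \<Rightarrow> ('m \<Rightarrow> 'm \<Rightarrow> 'm) \<Rightarrow> ('r \<Rightarrow> 'm \<Rightarrow> 'm) \<Rightarrow> ('r, 'm) module" where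
  "mk_module S z p s =
     \<lparr>carrier = S, mult = undefined, one = undefined, zero = z, add = p, smult = s\<rparr>"

definition mod_hom ::
  "'r ring \<Rightarrow> ('r, 'm) module \<Rightarrow> ('r, 'n) module \<Rightarrow> ('m \<Rightarrow> 'n) set" where
  "mod_hom R M N =
     {f \<in> carrier M \<rightarrow>\<^sub>E carrier N.
        (\<forall>x\<in>carrier M. \<forall>y\<in>carrier M. f (x \<oplus>\<^bsub>M\<^esub> y) = f x \<oplus>\<^bsub>N\<^esub> f y) \<and>
        (\<forall>a\<in>carrier R. \<forall>x\<in>carrier M. f (a \<odot>\<^bsub>M\<^esub> x) = a \<odot>\<^bsub>N\<^esub> f x)}"

definition mod_iso ::
  "'r ring \<Rightarrow> ('r, 'm) module \<Rightarrow> ('r, 'n) module \<Rightarrow> ('m \<Rightarrow> 'n) set" where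
  "mod_iso R M N = {f \<in> mod_hom R M N. bij_betw f (carrier M) (carrier N)}"

definition Hom_module ::
  "'r ring \<Rightarrow> ('r, 'm) module \<Rightarrow> ('r, 'n) module \<Rightarrow> ('r, 'm \<Rightarrow> 'n) module" where
  "Hom_module R M N =
     mk_module (mod_hom R M N)
       (\<lambda>x\<in>carrier M. \<zero>\<^bsub>N\<^esub>)
       (\<lambda>f g. \<lambda>x\<in>carrier M. f x \<oplus>\<^bsub>N\<^esub> g x)
       (\<lambda>a f. \<lambda>x\<in>carrier M. a \<odot>\<^bsub>N\<^esub> f x)"

definition lattice_module :: "'c::field set \<Rightarrow> ('c, 'c) module" where
  "lattice_module L = mk_module L 0 (+) (*)"


section \<open>Completed tensor products\<close>

definition is_coord ::
  "'c::field set \<Rightarrow> ('c, 'm) module \<Rightarrow> 'm set \<Rightarrow> 'm \<Rightarrow> ('m \<Rightarrow> 'c) \<Rightarrow> bool" where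
  "is_coord Fq M B m \<alpha> \<longleftrightarrow>
     range \<alpha> \<subseteq> Fq \<and> {b. \<alpha> b \<noteq> 0} \<subseteq> B \<and> finite {b. \<alpha> b \<noteq> 0} \<and>
     m = finsum M (\<lambda>b. \<alpha> b \<odot>\<^bsub>M\<^esub> b) {b. \<alpha> b \<noteq> 0}"

definition is_basis :: "'c::field set \<Rightarrow> ('c, 'm) module \<Rightarrow> 'm set \<Rightarrow> bool" where
  "is_basis Fq M B \<longleftrightarrow>
     B \<subseteq> carrier M \<and> (\<forall>m\<in>carrier M. \<exists>!\<alpha>. is_coord Fq M B m \<alpha>)"

definition coord :: "'c::field set \<Rightarrow> ('c, 'm) module \<Rightarrow> 'm set \<Rightarrow> 'm \<Rightarrow> 'm \<Rightarrow> 'c" where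
  "coord Fq M B m = (THE \<alpha>. is_coord Fq M B m \<alpha>)"

text \<open>
  Given an \<open>Fq\<close>-basis \<open>B\<close> of \<open>M\<close>, the element \<open>\<Sum> c\<^sub>b \<otimes> b\<close> of the completion of \<open>'c \<otimes> M\<close> is
  represented by the family \<open>c\<close> of its coefficients, which tends to \<open>0\<close>; families are extended by
  \<open>0\<close> outside \<open>B\<close>.  Convergence for the sup norm is uniform convergence on \<open>B\<close>.
\<close>

definition ctens :: "'m set \<Rightarrow> ('m \<Rightarrow> 'c::nonarch_field) set" where
  "ctens B = {c. (\<forall>b. b \<notin> B \<longrightarrow> c b = 0) \<and> (c \<longlongrightarrow> 0) cofinite}"

definition ctens_has_sum ::
  "'m set \<Rightarrow> 'i set \<Rightarrow> ('i \<Rightarrow> 'm \<Rightarrow> 'c::nonarch_field) \<Rightarrow> ('m \<Rightarrow> 'c) \<Rightarrow> bool" where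
  "ctens_has_sum B I x s \<longleftrightarrow>
     s \<in> ctens B \<and> uniform_limit B (\<lambda>F b. \<Sum>i\<in>F. x i b) s (finite_subsets_at_top I)"

definition ctens_sum ::
  "'m set \<Rightarrow> 'i set \<Rightarrow> ('i \<Rightarrow> 'm \<Rightarrow> 'c::nonarch_field) \<Rightarrow> 'm \<Rightarrow> 'c" where
  "ctens_sum B I x = (THE s. ctens_has_sum B I x s)"

definition pure_tensor ::
  "'c::field set \<Rightarrow> ('c, 'm) module \<Rightarrow> 'm set \<Rightarrow> 'c \<Rightarrow> 'm \<Rightarrow> 'm \<Rightarrow> 'c" where
  "pure_tensor Fq M B c m = (\<lambda>b. c * coord Fq M B m b)"

text \<open>
  For \<open>f : M \<rightarrow> N\<close>, the map \<open>1 \<otimes> f\<close> sends \<open>\<Sum> c\<^sub>b \<otimes> b\<close> to \<open>\<Sum> c\<^sub>b \<otimes> f b\<close>; here \<open>B\<close> and \<open>B'\<close> are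
  bases of \<open>M\<close> and \<open>N\<close>.
\<close>

definition one_tensor ::
  "'c::nonarch_field set \<Rightarrow> 'm set \<Rightarrow> ('c, 'n) module \<Rightarrow> 'n set \<Rightarrow> ('m \<Rightarrow> 'n) \<Rightarrow>
     ('m \<Rightarrow> 'c) \<Rightarrow> 'n \<Rightarrow> 'c" where
  "one_tensor Fq B N B' f c = ctens_sum B' B (\<lambda>b. pure_tensor Fq N B' (c b) (f b))"


section \<open>Dual Anderson eigenvectors\<close>

definition Sf ::
  "'c::nonarch_field set \<Rightarrow> 'c set \<Rightarrow> ('c \<Rightarrow> nat \<Rightarrow> 'c) \<Rightarrow> ('c, 'm) module \<Rightarrow> 'm set \<Rightarrow>
     ('m \<Rightarrow> 'c) set" where
  "Sf Fq A \<phi> M B =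
     {\<zeta> \<in> ctens B. \<forall>a\<in>A.
        (\<lambda>b. adjoint_act (card Fq) (\<phi> a) (\<zeta> b)) = one_tensor Fq B M B (\<lambda>m. a \<odot>\<^bsub>M\<^esub> m) \<zeta>}"

definition Sf_module ::
  "'c::nonarch_field set \<Rightarrow> 'c set \<Rightarrow> ('c \<Rightarrow> nat \<Rightarrow> 'c) \<Rightarrow> ('c, 'm) module \<Rightarrow> 'm set \<Rightarrow>
     ('c, 'm \<Rightarrow> 'c) module" where
  "Sf_module Fq A \<phi> M B =
     mk_module (Sf Fq A \<phi> M B) (\<lambda>b. 0) (\<lambda>x y b. x b + y b)
       (\<lambda>a. one_tensor Fq B M B (\<lambda>m. a \<odot>\<^bsub>M\<^esub> m))"

definition Sf_map ::
  "'c::nonarch_field set \<Rightarrow> 'c set \<Rightarrow> ('c \<Rightarrow> nat \<Rightarrow> 'c) \<Rightarrow> ('c, 'm) module \<Rightarrow> 'm set \<Rightarrow>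
     ('c, 'n) module \<Rightarrow> 'n set \<Rightarrow> ('m \<Rightarrow> 'n) \<Rightarrow> ('m \<Rightarrow> 'c) \<Rightarrow> 'n \<Rightarrow> 'c" where
  "Sf_map Fq A \<phi> M B N B' f = (\<lambda>\<zeta>\<in>Sf Fq A \<phi> M B. one_tensor Fq B N B' f \<zeta>)"

text \<open>The terms \<open>\<lambda>\<^sup>-\<^sup>1 \<otimes> \<lambda>\<close> of the series, and the opposite of its sum.\<close>

definition inverse_tensor :: "'c::nonarch_field set \<Rightarrow> 'c set \<Rightarrow> 'c set \<Rightarrow> 'c \<Rightarrow> 'c \<Rightarrow> 'c" where
  "inverse_tensor Fq L B l = pure_tensor Fq (lattice_module L) B (inverse l) l"

definition zeta :: "'c::nonarch_field set \<Rightarrow> 'c set \<Rightarrow> 'c set \<Rightarrow> 'c \<Rightarrow> 'c" where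
  "zeta Fq L B = (\<lambda>b. - ctens_sum B (L - {0}) (inverse_tensor Fq L B) b)"

end

theory Submission
  imports Defs
begin

text \<open>
  Fix a nonconstant \<open>t\<close> in \<open>A\<close> with \<open>\<phi>\<^sub>t \<noteq> t\<close>; it has a pole at infinity, so \<open>nv t > 1\<close>.  In coordinates with
  respect to a basis of \<open>M\<close>, the theorem becomes a duality between elements \<open>c\<close> of the big field and
  \<open>Fq\<close>-linear functionals \<open>\<alpha>\<close> on the period lattice: the map \<open>\<alpha> \<mapsto> S \<alpha> = - \<Sum> \<lambda>\<^sup>-\<^sup>1 \<alpha>(\<lambda>)\<close> is a bijection onto
  the set of all \<open>c\<close> with a bounded orbit under \<open>\<phi>\<^sub>t\<^sup>*\<close>, and it intertwines \<open>\<alpha> \<mapsto> \<alpha>(a \<cdot>)\<close> with \<open>\<phi>\<^sub>a\<^sup>*\<close>.  The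
  coefficients of a dual Anderson eigenvector do have bounded orbits, because \<open>1 \<otimes> t\<close> does not increase
  the sup norm.

  The inverse of \<open>S\<close> comes from the division with remainder \<open>c \<phi>\<^sub>a = \<phi>\<^sub>a\<^sup>*(c) + (1 - \<tau>) k\<close>: iterated along the
  orbit of \<open>c\<close>, it gives additive polynomials \<open>h\<^sub>n\<close> with \<open>(1 - \<tau>) h\<^sub>n = c \<phi>\<^bsub>t^n\<^esub>\<close> up to a small error, and
  \<open>h\<^sub>n(exp\<^sub>\<phi>(\<lambda> / t^n))\<close> converges to an element \<open>\<alpha>(\<lambda>)\<close> of \<open>Fq\<close>.  Lagrange interpolation of \<open>h\<^sub>n\<close> at the roots of
  \<open>\<phi>\<^bsub>t^n\<^esub>\<close>, compared in degree one, tends to \<open>c = S \<alpha>\<close>.  Conversely, a functional on a ball of the lattice is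
  a functional on a space of \<open>t^n\<close>-torsion points, where its additive interpolation polynomial produces a
  torsion point of \<open>\<phi>\<^sup>*\<close>; these approximate \<open>S \<alpha>\<close>.  Only the behaviour of \<open>exp\<^sub>\<phi>\<close> near \<open>0\<close> is used.
\<close>

section \<open>Nonarchimedean fields\<close>

text \<open>For a skew polynomial f, dividing c f by 1 - \<tau> pairs ker f with ker f^*, with
  values in \<open>Fq\<close>. The map \<open>alpha\<close> carries this duality to the limit over
  the t^n-torsion: the points E(l / t^n) form a coherent system of torsion points, while c need not
  be torsion, only of bounded orbit. Two facts make the limit work. The division is unique
  (\<open>frobenius_equation_trivial\<close>), because 1 - \<tau> multiplies positive degrees by q;
  the commutation laws and the torsion criterion follow by comparing two quotients. And
  \<open>Fq\<close> is discrete, so \<open>alpha c l\<close> vanishes for all c in \<open>KK\<close>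
  near 0. Hence approximations become exact at each l, and the coefficients of an eigenvector, which
  tend to 0, give only finitely many nonzero coordinates at l, that is, an element of M. A basis of
  M respects only \<open>Fq\<close>, so the correspondence is built for \<open>Fq\<close>-linear
  maps; A-linearity is recovered at the end from the intertwining rule and injectivity.\<close>

definition nv :: "'c::nonarch_field \<Rightarrow> real" where "nv x = dist x 0"

lemma nv_nonneg [simp]: "0 \<le> nv x"
  and nv_eq_0_iff [simp]: "nv x = 0 \<longleftrightarrow> x = 0"
  and nv_zero [simp]: "nv 0 = 0"
  and nv_pos_iff [simp]: "0 < nv x \<longleftrightarrow> x \<noteq> 0"
  and nv_le_0_iff [simp]: "nv x \<le> 0 \<longleftrightarrow> x = 0"
  by (simp_all add: nv_def)

lemma nv_diff: "dist x y = nv (x - y)"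
  unfolding nv_def by (rule dist_diff_zero)

lemma nv_minus [simp]: "nv (- x) = nv x"
  using nv_diff[of 0 x] by (simp add: dist_commute nv_def)

lemma nv_minus_commute: "nv (x - y) = nv (y - x)"
  using nv_minus[of "x - y"] by simp

lemma nv_mult: "nv (x * y) = nv x * nv y"
  unfolding nv_def by (rule dist_mult_zero)

lemma nv_one [simp]: "nv (1 :: 'c::nonarch_field) = 1"
proof -
  have "nv (1 :: 'c) * nv (1 :: 'c) = nv (1 :: 'c)"
    using nv_mult[of "1 :: 'c" 1] by simp
  moreover have "nv (1 :: 'c) \<noteq> 0" by simp
  ultimately show ?thesis by simp
qed

lemma nv_power: "nv (x ^ n) = nv (x :: 'c::nonarch_field) ^ n"
  by (induction n) (auto simp: nv_mult)

lemma nv_inverse: "nv (inverse x) = inverse (nv (x :: 'c::nonarch_field))"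
proof (cases "x = 0")
  case False
  then have "nv x * nv (inverse x) = 1"
    using nv_mult[of x "inverse x"] by simp
  then show ?thesis
    by (metis inverse_unique)
qed simp

lemma nv_divide: "nv (x / y) = nv x / nv (y :: 'c::nonarch_field)"
  by (simp add: divide_inverse nv_mult nv_inverse)

lemma nv_add_max: "nv (x + y) \<le> max (nv x) (nv y)"
  unfolding nv_def by (rule dist_add_zero_le)

lemma nv_add_le: "nv x \<le> r \<Longrightarrow> nv y \<le> r \<Longrightarrow> nv (x + y :: 'c::nonarch_field) \<le> r"
  using nv_add_max[of x y] by linarith

lemma nv_diff_le: "nv x \<le> r \<Longrightarrow> nv y \<le> r \<Longrightarrow> nv (x - y :: 'c::nonarch_field) \<le> r"
  using nv_add_le[of x r "- y"] by simp

lemma nv_add_less: "nv x < r \<Longrightarrow> nv y < r \<Longrightarrow> nv (x + y :: 'c::nonarch_field) < r"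
  using nv_add_max[of x y] by linarith

lemma nv_sum_le:
  assumes "\<And>i. i \<in> I \<Longrightarrow> nv (f i :: 'c::nonarch_field) \<le> r" and "0 \<le> r"
  shows "nv (sum f I) \<le> r"
  using assms by (induction I rule: infinite_finite_induct) (auto intro: nv_add_le)

lemma nv_sum_less:
  assumes "\<And>i. i \<in> I \<Longrightarrow> nv (f i :: 'c::nonarch_field) < r" and "0 < r"
  shows "nv (sum f I) < r"
  using assms by (induction I rule: infinite_finite_induct) (auto intro: nv_add_less)

lemma nv_add_eq: "nv y < nv x \<Longrightarrow> nv (x + y) = nv (x :: 'c::nonarch_field)"
  using nv_add_max[of x y] nv_add_max[of "x + y" "- y"] by auto

lemma ultra_dist: "dist x z \<le> max (dist x y) (dist y (z :: 'c::nonarch_field))"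
  using nv_add_max[of "x - y" "y - z"] by (simp add: nv_diff)

section \<open>Continuity of the field operations\<close>

instance nonarch_field \<subseteq> topological_ab_group_add
proof
  fix a b :: 'a
  show "LIM x nhds a \<times>\<^sub>F nhds b. fst x + snd x :> nhds (a + b)"
    unfolding tendsto_iff
  proof (intro allI impI)
    fix e :: real assume "e > 0"
    then have "\<forall>\<^sub>F x in nhds a \<times>\<^sub>F nhds b. dist (fst x) a < e \<and> dist (snd x) b < e"
      unfolding eventually_prod_filter
      by (intro exI[of _ "\<lambda>x. dist x a < e"] exI[of _ "\<lambda>x. dist x b < e"])
        (auto simp: eventually_nhds_metric)
    then show "\<forall>\<^sub>F x in nhds a \<times>\<^sub>F nhds b. dist (fst x + snd x) (a + b) < e"
    proof (rule eventually_mono)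
      fix x assume "dist (fst x) a < e \<and> dist (snd x) b < e"
      then show "dist (fst x + snd x) (a + b) < e"
        using nv_add_less[of "fst x - a" e "snd x - b"] by (simp add: nv_diff algebra_simps)
    qed
  qed
next
  fix a :: 'a
  have "dist (- x) (- a) = dist x a" for x
    using nv_minus[of "x - a"] by (simp add: nv_diff)
  then show "(uminus \<longlongrightarrow> - a) (nhds a)"
    unfolding tendsto_iff by (auto simp: eventually_nhds_metric)
qed

instance nonarch_field \<subseteq> topological_comm_monoid_mult
proof
  fix a b :: 'a
  show "LIM x nhds a \<times>\<^sub>F nhds b. fst x * snd x :> nhds (a * b)"
    unfolding tendsto_iff
  proof (intro allI impI)
    fix e :: real assume "e > 0"
    define M where "M = max 1 (max (nv a) (nv b))"
    \<comment> \<open>\<open>d \<le> 1\<close> keeps \<open>nv (snd x)\<close> below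
      \<open>M\<close>, and \<open>d * M \<le> e\<close> bounds both halves of xy - ab = (x - a) y +
      a (y - b).\<close>
    define d where "d = min 1 (e / M)"
    have M: "M \<ge> 1" "nv a \<le> M" "nv b \<le> M" by (auto simp: M_def)
    have d: "d > 0" "d \<le> 1" "d * M \<le> e"
      using \<open>e > 0\<close> M by (auto simp: d_def min_def field_simps)
    have "\<forall>\<^sub>F x in nhds a \<times>\<^sub>F nhds b. dist (fst x) a < d \<and> dist (snd x) b < d"
      using d unfolding eventually_prod_filter
      by (intro exI[of _ "\<lambda>x. dist x a < d"] exI[of _ "\<lambda>x. dist x b < d"])
        (auto simp: eventually_nhds_metric)
    then show "\<forall>\<^sub>F x in nhds a \<times>\<^sub>F nhds b. dist (fst x * snd x) (a * b) < e"
    proof (rule eventually_mono)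
      fix x assume x: "dist (fst x) a < d \<and> dist (snd x) b < d"
      have "nv (snd x) \<le> M"
        using nv_add_le[of "snd x - b" M b] x d M by (simp add: nv_diff)
      then have "nv ((fst x - a) * snd x) < d * M"
        unfolding nv_mult using x M d
        by (intro le_less_trans[OF mult_left_mono[of "nv (snd x)" M] mult_strict_right_mono])
          (auto simp: nv_diff)
      moreover have "nv (a * (snd x - b)) < d * M"
        unfolding nv_mult using x M d
        by (subst mult.commute, intro le_less_trans[OF mult_left_mono[of "nv a" M] mult_strict_right_mono])
          (auto simp: nv_diff)
      ultimately have "nv ((fst x - a) * snd x + a * (snd x - b)) < d * M"
        by (rule nv_add_less)
      then show "dist (fst x * snd x) (a * b) < e"
        using d by (simp add: nv_diff algebra_simps)
    qed
  qed
qed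

text \<open>The condition on addition that \<open>infsum_swap\<close> asks for.\<close>

lemma uniformly_continuous_plus_nonarch:
  "uniformly_continuous_on UNIV (\<lambda>(x :: 'c::nonarch_field, y). x + y)"
  unfolding uniformly_continuous_on_def
proof (intro allI impI)
  fix e :: real assume "e > 0"
  have "dist (fst x' + snd x') (fst x + snd x) < e" if "dist x' x < e" for x x' :: "'c \<times> 'c"
    using nv_add_less[of "fst x' - fst x" e "snd x' - snd x"] that
      dist_fst_le[of x' x] dist_snd_le[of x' x]
    by (simp add: nv_diff algebra_simps)
  then show "\<exists>d>0. \<forall>x\<in>UNIV. \<forall>x'\<in>UNIV. dist x' x < d \<longrightarrow>
      dist (case x' of (x :: 'c, y) \<Rightarrow> x + y) (case x of (x, y) \<Rightarrow> x + y) < e"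
    using \<open>e > 0\<close> by (auto simp: case_prod_unfold)
qed

section \<open>Limits under the ultrametric inequality\<close>

lemma tendsto_nv_le:
  assumes "(f \<longlongrightarrow> (l :: 'c::nonarch_field)) F" "\<forall>\<^sub>F x in F. nv (f x) \<le> r" "F \<noteq> bot"
  shows "nv l \<le> r"
  using tendsto_upperbound[OF tendsto_dist[OF assms(1) tendsto_const[of 0]]] assms(2,3)
  unfolding nv_def by blast

text \<open>A sum of steps is no larger than the largest step, so vanishing increments already give
  the Cauchy property.\<close>

lemma Cauchy_nonarch:
  fixes f :: "nat \<Rightarrow> 'c::nonarch_field"
  assumes "(\<lambda>n. f (Suc n) - f n) \<longlonglongrightarrow> 0"
  shows "Cauchy f"
proof (rule metric_CauchyI)
  fix e :: real assume "e > 0"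
  then obtain N where N: "\<And>n. n \<ge> N \<Longrightarrow> dist (f (Suc n)) (f n) < e"
    using assms unfolding lim_sequentially by (auto simp: nv_diff)
  have *: "dist (f (N + n)) (f N) < e" for n
  proof (induction n)
    case (Suc n)
    then show ?case
      using N[of "N + n"] ultra_dist[of "f (N + Suc n)" "f N" "f (N + n)"] by simp
  qed (use \<open>e > 0\<close> in simp)
  have **: "dist (f n) (f N) < e" if "n \<ge> N" for n
    using *[of "n - N"] that by simp
  have "dist (f m) (f n) < e" if "m \<ge> N" "n \<ge> N" for m n
    using **[OF that(1)] **[OF that(2)] ultra_dist[of "f m" "f n" "f N"] by (simp add: dist_commute)
  then show "\<exists>M. \<forall>m\<ge>M. \<forall>n\<ge>M. dist (f m) (f n) < e" by blast
qed

lemma convergent_nonarch: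
  fixes f :: "nat \<Rightarrow> 'c::{nonarch_field, complete_space}"
  assumes "(\<lambda>n. f (Suc n) - f n) \<longlonglongrightarrow> 0"
  shows "convergent f"
  using Cauchy_nonarch[OF assms] by (rule Cauchy_convergent)

lemma summable_nonarch:
  fixes f :: "nat \<Rightarrow> 'c::{nonarch_field, complete_space}"
  assumes "f \<longlonglongrightarrow> 0"
  shows "summable f"
  unfolding summable_iff_convergent by (rule convergent_nonarch) (use assms in simp)

lemma sums_nv_le:
  assumes "f sums (s :: 'c::nonarch_field)" "\<And>n. nv (f n) \<le> r" "0 \<le> r"
  shows "nv s \<le> r"
  using assms(1) unfolding sums_def
  by (rule tendsto_nv_le) (use assms in \<open>auto intro!: always_eventually nv_sum_le\<close>)

lemma sums_terms_tendsto_0: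
  assumes "f sums (s :: 'c::nonarch_field)"
  shows "f \<longlonglongrightarrow> 0"
proof -
  have "(\<lambda>n. sum f {..<n}) \<longlonglongrightarrow> s" using assms by (simp add: sums_def)
  then have "(\<lambda>n. sum f {..<Suc n} - sum f {..<n}) \<longlonglongrightarrow> s - s"
    by (intro tendsto_diff LIMSEQ_Suc)
  then show ?thesis by simp
qed

lemma nv_tendsto_0_iff: "((\<lambda>x. nv (f x :: 'c::nonarch_field)) \<longlongrightarrow> 0) F \<longleftrightarrow> (f \<longlongrightarrow> 0) F"
  unfolding nv_def using tendsto_dist_iff by metis

lemma tendsto_inverse_nonarch:
  fixes f :: "'i \<Rightarrow> 'c::nonarch_field"
  assumes "(f \<longlongrightarrow> l) F" "l \<noteq> 0"
  shows "((\<lambda>x. inverse (f x)) \<longlongrightarrow> inverse l) F"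
  unfolding tendsto_iff
proof (intro allI impI)
  fix e :: real assume e: "e > 0"
  \<comment> \<open>Within distance \<open>nv l\<close> of \<open>l\<close> the absolute value of
    \<open>f x\<close> is frozen at \<open>nv l\<close>; the second entry makes |f x - l| / |l|^2
    less than \<open>e\<close>.\<close>
  define d where "d = min (nv l) (e * (nv l * nv l))"
  have d: "d > 0" using e assms(2) by (simp add: d_def)
  have "\<forall>\<^sub>F x in F. dist (f x) l < d" using assms(1) d by (simp add: tendsto_iff)
  then show "\<forall>\<^sub>F x in F. dist (inverse (f x)) (inverse l) < e"
  proof (rule eventually_mono)
    fix x assume x: "dist (f x) l < d"
    then have "nv (f x) = nv l" using nv_add_eq[of "f x - l" l] by (simp add: d_def nv_diff)
    moreover from this have "f x \<noteq> 0" using assms(2) by auto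
    then have "inverse (f x) - inverse l = (l - f x) * (inverse (f x) * inverse l)"
      using assms(2) by (simp add: field_simps)
    ultimately have "nv (inverse (f x) - inverse l) = nv (f x - l) / (nv l * nv l)"
      by (simp add: nv_mult nv_inverse nv_minus_commute[of l] divide_inverse)
    also have "\<dots> < e" using x assms(2) by (simp add: d_def nv_diff divide_simps)
    finally show "dist (inverse (f x)) (inverse l) < e" by (simp add: nv_diff)
  qed
qed

section \<open>Null families\<close>

text \<open>Convergence to 0 along the cofinite filter, but relative to an index set, so that it
  restricts to subsets and applies to products.\<close>

definition null_family :: "'i set \<Rightarrow> ('i \<Rightarrow> 'c::nonarch_field) \<Rightarrow> bool" where
  "null_family I f \<longleftrightarrow> (\<forall>e>0. finite {i\<in>I. nv (f i) \<ge> e})"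

lemma null_familyD: "null_family I f \<Longrightarrow> e > 0 \<Longrightarrow> finite {i\<in>I. nv (f i) \<ge> e}"
  by (simp add: null_family_def)

lemma null_family_le:
  assumes "null_family I f" "\<And>i. i \<in> I \<Longrightarrow> nv (g i) \<le> nv (f i)"
  shows "null_family I g"
  unfolding null_family_def
proof (intro allI impI)
  fix e :: real assume "e > 0"
  show "finite {i\<in>I. e \<le> nv (g i)}"
    by (rule finite_subset[OF _ null_familyD[OF assms(1) \<open>e > 0\<close>]])
      (use assms(2) in \<open>fastforce intro: order_trans\<close>)
qed

lemma null_family_subset: "null_family I f \<Longrightarrow> J \<subseteq> I \<Longrightarrow> null_family J f"
  unfolding null_family_def by (fast elim: rev_finite_subset)

lemma null_family_iff_cofinite:
  assumes "\<And>b. b \<notin> B \<Longrightarrow> c b = 0"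
  shows "null_family B c \<longleftrightarrow> (c \<longlongrightarrow> 0) cofinite"
proof -
  have "{b\<in>B. e \<le> nv (c b)} = {b. \<not> nv (c b) < e}" if "e > 0" for e
    using assms that by force
  then show ?thesis
    unfolding null_family_def tendsto_iff eventually_cofinite by (simp add: nv_def[symmetric])
qed

text \<open>Adding indices outside the superlevel set \<open>F n\<close> changes a partial sum by at
  most 1/(n+1), so completeness yields the unordered sum.\<close>

lemma null_family_summable:
  fixes f :: "'i \<Rightarrow> 'c::{nonarch_field, complete_space}"
  assumes "null_family I f"
  shows "f summable_on I"
proof -
  define F where "F n = {i\<in>I. nv (f i) \<ge> 1 / Suc n}" for n :: nat
  have fin: "finite (F n)" for n
    unfolding F_def by (rule null_familyD[OF assms]) simp
  have sub: "F n \<subseteq> F (Suc n)" for n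
    unfolding F_def by (auto intro: order_trans[rotated] simp: frac_le)
  define s where "s n = sum f (F n)" for n
  have diff: "nv (sum f G - s n) \<le> 1 / Suc n" if "finite G" "F n \<subseteq> G" "G \<subseteq> I" for G n
  proof -
    have "sum f G - s n = sum f (G - F n)"
      unfolding s_def using that by (simp add: sum_diff)
    also have "nv \<dots> \<le> 1 / Suc n"
      by (rule nv_sum_le) (use that in \<open>auto simp: F_def\<close>)
    finally show ?thesis .
  qed
  have "(\<lambda>n. s (Suc n) - s n) \<longlonglongrightarrow> 0"
  proof (rule nv_tendsto_0_iff[THEN iffD1], rule tendsto_sandwich[of "\<lambda>_. 0"])
    show "\<forall>\<^sub>F n in sequentially. nv (s (Suc n) - s n) \<le> 1 / Suc n"
      using diff[OF fin sub] by (auto simp: s_def[of "Suc _"] F_def)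
    show "(\<lambda>n. 1 / real (Suc n)) \<longlonglongrightarrow> 0" by (rule LIMSEQ_Suc[OF lim_1_over_n])
  qed auto
  then obtain l where l: "s \<longlonglongrightarrow> l"
    using convergent_nonarch unfolding convergent_def by blast
  have "(f has_sum l) I"
    unfolding has_sum_def tendsto_iff
  proof (intro allI impI)
    fix e :: real assume "e > 0"
    then obtain N where N: "\<And>n. n \<ge> N \<Longrightarrow> dist (s n) l < e"
      using l unfolding lim_sequentially by blast
    obtain M :: nat where M: "1 / Suc M < e" using \<open>e > 0\<close> nat_approx_posE by blast
    define n where "n = max N M"
    have n: "dist (s n) l < e" "1 / Suc n < e"
      using N[of n] M by (auto simp: n_def intro: le_less_trans[rotated] simp: frac_le)
    show "\<forall>\<^sub>F G in finite_subsets_at_top I. dist (sum f G) l < e"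
      unfolding eventually_finite_subsets_at_top
    proof (intro exI[of _ "F n"] conjI allI impI)
      fix G assume G: "finite G \<and> F n \<subseteq> G \<and> G \<subseteq> I"
      then have "dist (sum f G) (s n) < e"
        using diff[of G n] n by (simp add: nv_diff)
      then show "dist (sum f G) l < e"
        using n ultra_dist[of "sum f G" l "s n"] by simp
    qed (use fin in \<open>auto simp: F_def\<close>)
  qed
  then show ?thesis by (auto simp: summable_on_def)
qed

lemma nv_infsum_le:
  fixes f :: "'i \<Rightarrow> 'c::nonarch_field"
  assumes "\<And>i. i \<in> I \<Longrightarrow> nv (f i) \<le> r" "0 \<le> r"
  shows "nv (infsum f I) \<le> r"
proof (cases "f summable_on I")
  case True
  then have "(sum f \<longlongrightarrow> infsum f I) (finite_subsets_at_top I)"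
    by (rule infsum_tendsto)
  then show ?thesis
    by (rule tendsto_nv_le)
      (use assms in \<open>auto intro!: eventually_finite_subsets_at_top_weakI nv_sum_le\<close>)
qed (use assms in \<open>auto simp: infsum_not_exists\<close>)

lemma nv_infsum_diff_le:
  fixes f :: "'i \<Rightarrow> 'c::{nonarch_field, complete_space}"
  assumes "null_family I f" "finite F" "F \<subseteq> I" "\<And>i. i \<in> I - F \<Longrightarrow> nv (f i) \<le> r" "0 \<le> r"
  shows "nv (infsum f I - sum f F) \<le> r"
proof -
  have "infsum f I = infsum f F + infsum f (I - F)"
    using infsum_Un_disjoint[of f F "I - F"] null_family_summable[OF null_family_subset[OF assms(1)]]
      assms(2,3) by (auto simp: Un_absorb1)
  then have "infsum f I - sum f F = infsum f (I - F)"
    using assms(2) by simp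
  then show ?thesis using nv_infsum_le[of "I - F" f r] assms by simp
qed

lemma infsum_swap_nonarch:
  fixes f :: "'a \<Rightarrow> 'b \<Rightarrow> 'c::{nonarch_field, complete_space}"
  assumes "null_family (A \<times> B) (\<lambda>(x, y). f x y)"
  shows "infsum (\<lambda>x. infsum (f x) B) A = infsum (\<lambda>y. infsum (\<lambda>x. f x y) A) B"
proof (rule infsum_swap[OF uniformly_continuous_plus_nonarch null_family_summable[OF assms]])
  show "f a summable_on B" if "a \<in> A" for a
  proof (rule null_family_summable)
    show "null_family B (f a)"
      unfolding null_family_def
    proof (intro allI impI)
      fix e :: real assume "e > 0"
      from finite_imageI[OF null_familyD[OF assms this], of snd]
      show "finite {i\<in>B. e \<le> nv (f a i)}"
        by (rule rev_finite_subset) (use that in \<open>force simp: image_iff\<close>)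
    qed
  qed
  show "(\<lambda>a. f a b) summable_on A" if "b \<in> B" for b
  proof (rule null_family_summable)
    show "null_family A (\<lambda>a. f a b)"
      unfolding null_family_def
    proof (intro allI impI)
      fix e :: real assume "e > 0"
      from finite_imageI[OF null_familyD[OF assms this], of fst]
      show "finite {i\<in>A. e \<le> nv (f i b)}"
        by (rule rev_finite_subset) (use that in \<open>force simp: image_iff\<close>)
    qed
  qed
qed

text \<open>Additivity moves \<open>T\<close> inside finite sums, continuity at the total passes to
  the limit. Meant for \<phi>_a^*, which is additive but not linear over the big field.\<close>

lemma infsum_additive_nonarch:
  fixes f :: "'i \<Rightarrow> 'c::{nonarch_field, complete_space}" and T :: "'c \<Rightarrow> 'c"
  assumes "null_family I f" "\<And>x y. T (x + y) = T x + T y" "T 0 = 0" "isCont T (infsum f I)"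
  shows "((\<lambda>i. T (f i)) has_sum T (infsum f I)) I"
proof -
  have "T (sum f F) = sum (T \<circ> f) F" for F
    by (induction F rule: infinite_finite_induct) (auto simp: assms(2,3))
  moreover have "((\<lambda>F. T (sum f F)) \<longlongrightarrow> T (infsum f I)) (finite_subsets_at_top I)"
    by (rule isCont_tendsto_compose[OF assms(4) infsum_tendsto[OF null_family_summable[OF assms(1)]]])
  ultimately show ?thesis
    unfolding has_sum_def by (simp add: o_def)
qed

hide_const (open) up_ring.coeff up_ring.monom Polynomials.degree

section \<open>Valuation rings\<close>

lemma CC_simps [simp]:
  "carrier (CC :: 'c::field ring) = UNIV" "\<zero>\<^bsub>(CC :: 'c ring)\<^esub> = 0" "\<one>\<^bsub>(CC :: 'c ring)\<^esub> = 1"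
  "x \<oplus>\<^bsub>(CC :: 'c ring)\<^esub> y = x + y" "x \<otimes>\<^bsub>(CC :: 'c ring)\<^esub> y = x * y"
  by (simp_all add: ring_of_type_algebra_def)

lemma CC_field: "Ring.field (CC :: 'c::field ring)"
  by (rule field_from_type_algebra)

lemma CC_ring: "Ring.ring (CC :: 'c::field ring)"
  by (rule ring_from_type_algebra)

lemma CC_uminus [simp]: "\<ominus>\<^bsub>(CC :: 'c::field ring)\<^esub> x = - x"
proof -
  interpret Ring.ring "CC :: 'c ring" by (rule CC_ring)
  show ?thesis using minus_equality[of "- x" x] by simp
qed

lemma CC_pow [simp]: "x [^]\<^bsub>(CC :: 'c::field ring)\<^esub> (n :: nat) = x ^ n"
proof -
  interpret Ring.ring "CC :: 'c ring" by (rule CC_ring)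
  show ?thesis by (induction n) (simp_all add: mult.commute)
qed

lemma CC_inv: "x \<noteq> 0 \<Longrightarrow> inv\<^bsub>(CC :: 'c::field ring)\<^esub> x = inverse x"
proof -
  interpret Ring.field "CC :: 'c ring" by (rule CC_field)
  show "x \<noteq> 0 \<Longrightarrow> inv\<^bsub>(CC :: 'c ring)\<^esub> x = inverse x"
    using inv_unique'[of x "inverse x"] by simp
qed

lemma subring_CC_iff:
  "subring V (CC :: 'c::field ring) \<longleftrightarrow>
     1 \<in> V \<and> (\<forall>x\<in>V. - x \<in> V \<and> (\<forall>y\<in>V. x + y \<in> V \<and> x * y \<in> V))"
proof -
  interpret Ring.ring "CC :: 'c ring" by (rule CC_ring)
  show ?thesis
  proof
    assume "subring V CC"
    from subringE(3,5,6,7)[OF this] show "1 \<in> V \<and> (\<forall>x\<in>V. - x \<in> V \<and> (\<forall>y\<in>V. x + y \<in> V \<and> x * y \<in> V))"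
      by simp
  qed (rule subringI; simp)
qed

lemma subring_CC:
  assumes "subring V (CC :: 'c::field ring)"
  shows "1 \<in> V" "0 \<in> V" "x \<in> V \<Longrightarrow> - x \<in> V" "x \<in> V \<Longrightarrow> y \<in> V \<Longrightarrow> x + y \<in> V"
    "x \<in> V \<Longrightarrow> y \<in> V \<Longrightarrow> x * y \<in> V" "x \<in> V \<Longrightarrow> y \<in> V \<Longrightarrow> x - y \<in> V"
proof -
  show *: "1 \<in> V" "0 \<in> V" "x \<in> V \<Longrightarrow> - x \<in> V" "x \<in> V \<Longrightarrow> y \<in> V \<Longrightarrow> x + y \<in> V"
    "x \<in> V \<Longrightarrow> y \<in> V \<Longrightarrow> x * y \<in> V" for x y
    using assms subringE(2)[OF assms] unfolding subring_CC_iff by simp_all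
  show "x \<in> V \<Longrightarrow> y \<in> V \<Longrightarrow> x - y \<in> V"
    using *(3)[of y] *(4)[of x "- y"] by simp
qed

lemma subring_CC_sum:
  "subring V (CC :: 'c::field ring) \<Longrightarrow> (\<And>i. i \<in> I \<Longrightarrow> f i \<in> V) \<Longrightarrow> sum f I \<in> V"
  by (induction I rule: infinite_finite_induct) (auto simp: subring_CC)

lemma subring_CC_power: "subring V (CC :: 'c::field ring) \<Longrightarrow> x \<in> V \<Longrightarrow> x ^ n \<in> V"
  by (induction n) (auto simp: subring_CC)

lemma subfield_CC_inverse:
  assumes "subfield K (CC :: 'c::field ring)" "x \<in> K"
  shows "inverse x \<in> K"
proof (cases "x = 0")
  case False
  interpret Ring.field "CC :: 'c ring" by (rule CC_field)
  show ?thesis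
    using subfield_m_inv(1)[OF assms(1), of x] assms(2) False by (simp add: CC_inv)
qed (use assms in simp)

section \<open>Subrings V[z] and valuation rings avoiding an element\<close>

definition adjoin :: "'c::field set \<Rightarrow> 'c \<Rightarrow> 'c set" where
  "adjoin V z = {poly p z | p. \<forall>i. coeff p i \<in> V}"

lemma adjoinE:
  assumes "x \<in> adjoin V z"
  obtains n f where "\<And>i. f i \<in> V" "x = (\<Sum>i\<le>n. f i * z ^ i)"
  using assms unfolding adjoin_def by (auto simp: poly_altdef)

lemma subring_adjoin:
  assumes V: "subring V (CC :: 'c::field ring)"
  shows "subring (adjoin V z) CC" "V \<subseteq> adjoin V z" "z \<in> adjoin V z"
proof -
  note [simp] = subring_CC[OF V]
  have "\<exists>p'. - poly p z = poly p' z \<and> (\<forall>i. coeff p' i \<in> V)" if "\<forall>i. coeff p i \<in> V" for p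
    by (rule exI[of _ "- p"]) (use that in simp)
  moreover have "\<exists>p'. poly p z + poly r z = poly p' z \<and> (\<forall>i. coeff p' i \<in> V)"
    if "\<forall>i. coeff p i \<in> V" "\<forall>i. coeff r i \<in> V" for p r
    by (rule exI[of _ "p + r"]) (use that in simp)
  moreover have "\<exists>p'. poly p z * poly r z = poly p' z \<and> (\<forall>i. coeff p' i \<in> V)"
    if "\<forall>i. coeff p i \<in> V" "\<forall>i. coeff r i \<in> V" for p r
    by (rule exI[of _ "p * r"]) (use that in \<open>auto simp: coeff_mult intro!: subring_CC_sum[OF V]\<close>)
  moreover have c: "c \<in> adjoin V z" if "c \<in> V" for c
    unfolding adjoin_def using that
    by (auto intro!: exI[of _ "[:c:]"] simp: coeff_pCons split: nat.split)
  ultimately show "subring (adjoin V z) CC"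
    unfolding subring_CC_iff using c[of 1] by (auto simp: adjoin_def)
  show "V \<subseteq> adjoin V z" using c by blast
  show "z \<in> adjoin V z"
    unfolding adjoin_def by (auto intro!: exI[of _ "[:0, 1:]"] simp: coeff_pCons split: nat.split)
qed

lemma adjoin_subset:
  assumes "subring K (CC :: 'c::field ring)" "V \<subseteq> K" "z \<in> K"
  shows "adjoin V z \<subseteq> K"
  using assms by (auto elim!: adjoinE intro!: subring_CC_sum[OF assms(1)]
      subring_CC(5)[OF assms(1)] subring_CC_power[OF assms(1)])

text \<open>Chevalley: a subring of \<open>K\<close> maximal among those containing \<open>1/a\<close> but not \<open>a\<close> is a valuation ring.\<close>

locale maximal_avoiding =
  fixes K V :: "'c::field set" and a :: 'c
  assumes subV: "subring V CC" and subK: "subring K CC" and VK: "V \<subseteq> K"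
    and inv_a: "inverse a \<in> V" and a_notin: "a \<notin> V"
    and maxV: "\<And>z. z \<in> K \<Longrightarrow> z \<notin> V \<Longrightarrow> a \<in> adjoin V z"
    and invK: "\<And>x. x \<in> K \<Longrightarrow> inverse x \<in> K"
begin

lemmas V_simps [simp] = subring_CC[OF subV] subring_CC_power[OF subV]

lemma a_nonzero: "a \<noteq> 0"
  using a_notin by auto

text \<open>If s = 1 - x/a were not invertible in \<open>V\<close>, maximality would write
  \<open>a\<close> as a polynomial in 1/s. Clearing denominators puts a s^n in \<open>V\<close>,
  while s^n = 1 - y/a with y in \<open>V\<close>, so a = a s^n + y would lie in
  \<open>V\<close>.\<close>

lemma one_minus_unit:
  assumes "x \<in> V"
  shows "1 - inverse a * x \<noteq> 0" "inverse (1 - inverse a * x) \<in> V"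
proof -
  define s where "s = 1 - inverse a * x"
  have sV: "s \<in> V" using assms inv_a by (simp add: s_def)
  show "1 - inverse a * x \<noteq> 0"
  proof
    assume "1 - inverse a * x = 0"
    then have "a = x" using a_nonzero by (simp add: field_simps)
    then show False using assms a_notin by simp
  qed
  then have s0: "s \<noteq> 0" by (simp add: s_def)
  have "inverse s \<in> V"
  proof (rule ccontr)
    assume ns: "inverse s \<notin> V"
    have "inverse s \<in> K" using sV VK by (auto intro: invK)
    from maxV[OF this ns] obtain n f where f: "\<And>i. f i \<in> V" "a = (\<Sum>i\<le>n. f i * inverse s ^ i)"
      by (rule adjoinE) blast
    have "a * s ^ n = (\<Sum>i\<le>n. f i * (inverse s ^ i * s ^ n))"
      by (subst f(2)) (simp only: sum_distrib_right mult.assoc)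
    also have "\<dots> = (\<Sum>i\<le>n. f i * s ^ (n - i))"
    proof (intro sum.cong refl)
      fix i assume "i \<in> {..n}"
      then have "s ^ n = s ^ i * s ^ (n - i)" by (simp flip: power_add)
      then show "f i * (inverse s ^ i * s ^ n) = f i * s ^ (n - i)"
        using s0 by (simp add: power_inverse)
    qed
    also have "\<dots> \<in> V" using f(1) sV by (auto intro!: subring_CC_sum[OF subV])
    finally have 1: "a * s ^ n \<in> V" .
    have "\<exists>y\<in>V. s ^ n = 1 - inverse a * y"
    proof (induction n)
      case (Suc n)
      then obtain y where "y \<in> V" "s ^ n = 1 - inverse a * y" by blast
      then have "s ^ Suc n = 1 - inverse a * (x + y - inverse a * x * y)"
        by (simp only: power_Suc) (simp add: s_def algebra_simps)
      moreover have "x + y - inverse a * x * y \<in> V" using assms \<open>y \<in> V\<close> inv_a by simp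
      ultimately show ?case by blast
    qed (auto intro!: bexI[of _ 0])
    then obtain y where y: "y \<in> V" "s ^ n = 1 - inverse a * y" by blast
    have "a = a * s ^ n + y" using a_nonzero by (simp add: y(2) algebra_simps)
    then have "a \<in> V" using 1 y(1) subring_CC(4)[OF subV 1 y(1)] by simp
    then show False using a_notin by contradiction
  qed
  then show "inverse (1 - inverse a * x) \<in> V" by (simp add: s_def)
qed

text \<open>Dividing the relation in 1/z by \<open>a\<close> and moving its constant term to the
  left gives the unit 1 - g 0 / a. After division by it, z^(n+1) is a combination of lower powers
  and can be eliminated from the relation in z.\<close>

lemma lower_degree:
  assumes f: "\<And>i. f i \<in> V" "a = (\<Sum>i\<le>Suc n. f i * z ^ i)"
    and g: "\<And>i. g i \<in> V" "a = (\<Sum>i\<le>m. g i * inverse z ^ i)"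
    and "m \<le> Suc n" "z \<noteq> 0"
  shows "\<exists>h. (\<forall>i. h i \<in> V) \<and> a = (\<Sum>i\<le>n. h i * z ^ i)"
proof -
  define u where "u = inverse a"
  define s where "s = 1 - u * g 0"
  \<comment> \<open>Zero coefficients beyond \<open>m\<close> stretch the relation to length
    \<open>Suc n\<close>.\<close>
  define r where "r j = (if j \<le> m then u * g j * inverse s else 0)" for j
  have s: "s \<noteq> 0" "inverse s \<in> V"
    unfolding s_def u_def using one_minus_unit g(1) by blast+
  have r: "r j \<in> V" for j
    unfolding r_def u_def using inv_a s g(1) by simp
  have "{..m} - {0} = {1..m}" by auto
  then have "(\<Sum>i\<le>m. g i * inverse z ^ i) = g 0 + (\<Sum>i\<in>{1..m}. g i * inverse z ^ i)"
    by (subst sum.remove[of "{..m}" 0]) auto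
  then have "1 = u * g 0 + (\<Sum>i\<in>{1..m}. u * g i * inverse z ^ i)"
    using g(2) a_nonzero unfolding u_def
    by (metis (no_types, lifting) distrib_left left_inverse mult.assoc sum.cong sum_distrib_left)
  then have "s = (\<Sum>i\<in>{1..m}. u * g i * inverse z ^ i)"
    unfolding s_def by (metis add_diff_cancel_left')
  then have "1 = (\<Sum>i\<in>{1..m}. u * g i * inverse z ^ i) * inverse s"
    using s by simp
  also have "\<dots> = (\<Sum>i\<in>{1..m}. r i * inverse z ^ i)"
    unfolding sum_distrib_right by (rule sum.cong) (auto simp: r_def)
  also have "\<dots> = (\<Sum>i\<in>{1..Suc n}. r i * inverse z ^ i)"
    by (rule sum.mono_neutral_left) (use \<open>m \<le> Suc n\<close> in \<open>auto simp: r_def\<close>)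
  finally have "z ^ Suc n = (\<Sum>i\<in>{1..Suc n}. r i * inverse z ^ i) * z ^ Suc n"
    by simp
  also have "\<dots> = (\<Sum>i\<in>{1..Suc n}. r i * z ^ (Suc n - i))"
    unfolding sum_distrib_right
  proof (rule sum.cong)
    fix i assume "i \<in> {1..Suc n}"
    then have "z ^ Suc n = z ^ i * z ^ (Suc n - i)" by (simp flip: power_add)
    then show "r i * inverse z ^ i * z ^ Suc n = r i * z ^ (Suc n - i)"
      using \<open>z \<noteq> 0\<close> by (simp add: power_inverse)
  qed simp
  also have "\<dots> = (\<Sum>j\<le>n. r (Suc n - j) * z ^ j)"
    by (rule sum.reindex_bij_witness[of _ "\<lambda>j. Suc n - j" "\<lambda>i. Suc n - i"]) auto
  finally have zn: "z ^ Suc n = (\<Sum>j\<le>n. r (Suc n - j) * z ^ j)" .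
  have "a = (\<Sum>i\<le>n. f i * z ^ i) + f (Suc n) * z ^ Suc n" using f(2) by simp
  also have "\<dots> = (\<Sum>i\<le>n. (f i + f (Suc n) * r (Suc n - i)) * z ^ i)"
    unfolding zn by (simp add: sum_distrib_left algebra_simps sum.distrib)
  finally show ?thesis
    using f(1) r by (intro exI[of _ "\<lambda>i. f i + f (Suc n) * r (Suc n - i)"]) simp
qed

text \<open>Otherwise both z and 1/z give relations for \<open>a\<close>; take each of least length,
  and \<open>lower_degree\<close> shortens the longer one.\<close>

lemma valuative:
  assumes "z \<in> K"
  shows "z \<in> V \<or> inverse z \<in> V"
proof (rule ccontr)
  assume *: "\<not> (z \<in> V \<or> inverse z \<in> V)"
  then have z0: "z \<noteq> 0" by auto
  define Rep where "Rep w n \<longleftrightarrow> (\<exists>h. (\<forall>i. h i \<in> V) \<and> a = (\<Sum>i\<le>n. h i * w ^ i))" for w n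
  have ex: "\<exists>n. Rep w n" if "w \<in> K" "w \<notin> V" for w
    using maxV[OF that] unfolding Rep_def by (elim adjoinE) blast
  have low: False
    if "Rep w n" "\<And>k. k < n \<Longrightarrow> \<not> Rep w k" "Rep (inverse w) m" "m \<le> n" "w \<noteq> 0" for w n m
  proof (cases n)
    case 0
    then show False using that(1) a_notin unfolding Rep_def by auto
  next
    case (Suc k)
    then have "Rep w k"
      using that lower_degree[of _ w k _ m] unfolding Rep_def by blast
    then show False using that(2) Suc by blast
  qed
  define n where "n = (LEAST n. Rep z n)"
  define m where "m = (LEAST m. Rep (inverse z) m)"
  have n: "Rep z n" "\<And>k. k < n \<Longrightarrow> \<not> Rep z k"
    unfolding n_def using ex[of z] assms * by (auto intro: LeastI_ex dest: not_less_Least)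
  have m: "Rep (inverse z) m" "\<And>k. k < m \<Longrightarrow> \<not> Rep (inverse z) k"
    unfolding m_def using ex[of "inverse z"] invK[OF assms] *
    by (auto intro: LeastI_ex dest: not_less_Least)
  show False
  proof (cases "m \<le> n")
    case True
    then show ?thesis using low[OF n m(1)] z0 by blast
  next
    case False
    then show ?thesis using low[OF m, of n] n(1) z0 by simp
  qed
qed

end

text \<open>Zorn's lemma, with F[1/a] as starting point, provides the maximal ring of the
  locale.\<close>

theorem exists_valuation_ring_avoiding:
  assumes K: "subfield K (CC :: 'c::field ring)" and F: "subring F CC" "F \<subseteq> K"
    and a: "a \<in> K" "a \<notin> adjoin F (inverse a)"
  shows "\<exists>V. valuation_ring F K V \<and> a \<notin> V"
proof -
  have sK: "subring K CC" using K by (simp add: subfieldE(1))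
  define S where "S = {V. subring V (CC :: 'c ring) \<and> F \<subseteq> V \<and> inverse a \<in> V \<and> V \<subseteq> K \<and> a \<notin> V}"
  have S0: "adjoin F (inverse a) \<in> S"
    unfolding S_def using subring_adjoin[OF F(1)] a adjoin_subset[OF sK F(2)]
      subfield_CC_inverse[OF K] by auto
  have "\<exists>M\<in>S. \<forall>Y\<in>S. M \<subseteq> Y \<longrightarrow> Y = M"
  proof (rule subset_Zorn_nonempty)
    show "S \<noteq> {}" using S0 by blast
    fix C assume C: "C \<noteq> {}" "subset.chain S C"
    have CS: "V \<in> S" if "V \<in> C" for V
      using C(2) that by (auto simp: subset_chain_def)
    have two: "\<exists>V\<in>C. x \<in> V \<and> y \<in> V" if "x \<in> \<Union>C" "y \<in> \<Union>C" for x y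
    proof -
      obtain U W where UW: "U \<in> C" "W \<in> C" "x \<in> U" "y \<in> W" using \<open>x \<in> \<Union>C\<close> \<open>y \<in> \<Union>C\<close> by blast
      then have "U \<subseteq> W \<or> W \<subseteq> U" using C(2) by (simp add: subset_chain_def)
      then show ?thesis using UW by blast
    qed
    have CR: "subring V CC" if "V \<in> C" for V
      using CS[OF that] by (simp add: S_def)
    have "subring (\<Union>C) CC"
      unfolding subring_CC_iff
    proof (intro conjI ballI)
      show "1 \<in> \<Union>C" using C(1) subring_CC(1)[OF CR] by blast
      fix x assume x: "x \<in> \<Union>C"
      then show "- x \<in> \<Union>C" using subring_CC(3)[OF CR] by blast
      fix y assume y: "y \<in> \<Union>C"
      from two[OF x y] obtain V where "V \<in> C" "x \<in> V" "y \<in> V" by blast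
      then show "x + y \<in> \<Union>C" "x * y \<in> \<Union>C"
        using subring_CC(4,5)[OF CR] by blast+
    qed
    moreover have "F \<subseteq> \<Union>C" "inverse a \<in> \<Union>C" "\<Union>C \<subseteq> K" "a \<notin> \<Union>C"
      using C(1) CS by (auto simp: S_def)
    ultimately show "\<Union>C \<in> S" by (simp add: S_def)
  qed
  then obtain V where V: "V \<in> S" "\<And>Y. Y \<in> S \<Longrightarrow> V \<subseteq> Y \<Longrightarrow> Y = V" by blast
  have sV: "subring V CC" using V(1) by (simp add: S_def)
  interpret maximal_avoiding K V a
  proof (rule maximal_avoiding.intro)
    fix z assume z: "z \<in> K" "z \<notin> V"
    show "a \<in> adjoin V z"
    proof (rule ccontr)
      assume "a \<notin> adjoin V z"
      then have "adjoin V z \<in> S"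
        using V(1) subring_adjoin[OF sV, of z] adjoin_subset[OF sK, of V z] z unfolding S_def by blast
      from V(2)[OF this] show False using subring_adjoin[OF sV, of z] z by blast
    qed
  qed (use V(1) sK in \<open>auto simp: S_def intro: subfield_CC_inverse[OF K]\<close>)
  have "valuation_ring F K V"
    unfolding valuation_ring_def using V(1) a(1) valuative by (auto simp: S_def)
  then show ?thesis using a_notin by blast
qed

section \<open>Algebraic elements and poles of regular functions\<close>

lemma eval_CC_snoc: "ring.eval CC (xs @ [c]) x = ring.eval CC xs x * x + (c :: 'c::field)"
proof -
  interpret Ring.ring "CC :: 'c ring" by (rule CC_ring)
  show ?thesis by (induction xs) (simp_all add: algebra_simps)
qed

text \<open>Algebraicity is phrased with coefficient lists, leading coefficient first; hence
  \<open>rev\<close>.\<close>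

lemma eval_CC_rev_coeffs: "ring.eval CC (rev (coeffs p)) x = poly p (x :: 'c::field)"
proof -
  interpret Ring.ring "CC :: 'c ring" by (rule CC_ring)
  show ?thesis
    by (induction p rule: pCons_induct) (auto simp: cCons_def eval_CC_snoc algebra_simps)
qed

lemma algebraic_CC_I:
  assumes "\<And>i. coeff p i \<in> F" "p \<noteq> 0" "poly p x = (0 :: 'c::field)"
  shows "ring.algebraic CC F x"
proof -
  interpret Ring.ring "CC :: 'c ring" by (rule CC_ring)
  show ?thesis
  proof (rule algebraicI[unfolded over_def, where p = "rev (coeffs p)"])
    have "set (coeffs p) \<subseteq> F" using assms(1) by (auto simp: coeffs_def)
    moreover have "hd (rev (coeffs p)) \<noteq> 0"
      using assms(2) by (simp add: hd_rev last_coeffs_eq_coeff_degree)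
    ultimately show "rev (coeffs p) \<in> carrier (univ_poly CC F)"
      by (simp add: univ_poly_def polynomial_def)
  qed (use assms in \<open>auto simp: eval_CC_rev_coeffs\<close>)
qed

text \<open>Multiplying a = f_0 + ... + f_n a^(-n) by a^n gives a monic equation of degree n +
  1.\<close>

lemma in_adjoin_inverse_imp_algebraic:
  assumes F: "subring F (CC :: 'c::field ring)" and a: "a \<in> adjoin F (inverse a)"
  shows "ring.algebraic CC F a"
proof (cases "a = 0")
  case True
  then show ?thesis
    using subring_CC[OF F]
    by (intro algebraic_CC_I[of "[:0, 1:]"]) (auto simp: coeff_pCons split: nat.split)
next
  case False
  obtain n f where f: "\<And>i. f i \<in> F" "a = (\<Sum>i\<le>n. f i * inverse a ^ i)"
    using a by (rule adjoinE) blast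
  define p where "p = monom 1 (Suc n) - (\<Sum>i\<le>n. monom (f i) (n - i))"
  have "a ^ Suc n = (\<Sum>i\<le>n. f i * inverse a ^ i) * a ^ n" using f(2) by simp
  also have "\<dots> = (\<Sum>i\<le>n. f i * a ^ (n - i))"
    unfolding sum_distrib_right
  proof (rule sum.cong)
    fix i assume "i \<in> {..n}"
    then have "a ^ n = a ^ i * a ^ (n - i)" by (simp flip: power_add)
    then show "f i * inverse a ^ i * a ^ n = f i * a ^ (n - i)"
      using False by (simp add: power_inverse)
  qed simp
  finally have root: "poly p a = 0"
    by (simp add: p_def poly_sum poly_monom)
  have "coeff p (Suc n) = 1"
    by (auto simp: p_def coeff_sum intro!: sum.neutral)
  then have "p \<noteq> 0" by auto
  moreover have "coeff p i \<in> F" for i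
  proof -
    have "coeff p i = (if Suc n = i then 1 else 0) - (\<Sum>k\<le>n. if n - k = i then f k else 0)"
      by (simp add: p_def coeff_sum)
    also have "\<dots> \<in> F"
      by (intro subring_CC(6)[OF F] subring_CC_sum[OF F]) (simp_all add: f(1) subring_CC(1,2)[OF F])
    finally show ?thesis .
  qed
  ultimately show ?thesis using root by (intro algebraic_CC_I[of p])
qed

context curve_at_infinity
begin

abbreviation "A \<equiv> regular_away Fq K Oinf"

lemma subring_Fq: "subring Fq CC" and finite_Fq: "finite Fq"
  and subfield_K: "subfield K CC" and subring_K: "subring K CC" and Fq_subset_K: "Fq \<subseteq> K"
  using function_field by (auto simp: function_field_def subfieldE(1))

lemma subring_A: "subring A CC"
proof -
  have "subring V CC" if "valuation_ring Fq K V" for V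
    using that by (simp add: valuation_ring_def)
  then show ?thesis
    using subring_K unfolding regular_away_def subring_CC_iff by blast
qed

lemma Fq_subset_A: "Fq \<subseteq> A"
  using Fq_subset_K by (auto simp: regular_away_def valuation_ring_def)

text \<open>As \<open>Fq\<close> is algebraically closed in \<open>K\<close>, the element a is
  transcendental and some valuation ring misses it; since a is regular at every other point, that
  ring is \<open>Oinf\<close>.\<close>

lemma nv_gt_1_if_nonconstant:
  assumes "a \<in> A" "a \<notin> Fq"
  shows "nv a > 1"
proof -
  have aK: "a \<in> K" using assms by (simp add: regular_away_def)
  have "\<not> ring.algebraic CC Fq a"
    using function_field assms aK by (auto simp: function_field_def)
  then have "a \<notin> adjoin Fq (inverse a)"
    using in_adjoin_inverse_imp_algebraic[OF subring_Fq] by blast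
  then obtain V where V: "valuation_ring Fq K V" "a \<notin> V"
    using exists_valuation_ring_avoiding[OF subfield_K subring_Fq Fq_subset_K aK] by blast
  then have "V = Oinf" using assms by (auto simp: regular_away_def)
  then show ?thesis using V abs_at_infinity aK by (auto simp: nv_def)
qed

end

section \<open>Additive polynomials over a finite field of constants\<close>

text \<open>In the form used below: polynomials of degree at most \<open>n\<close> with equal
  coefficient in degree \<open>n\<close> that agree at \<open>n\<close> points coincide.\<close>

lemma poly_eq_0_if_roots:
  fixes p :: "'c::idom poly"
  assumes "degree p \<le> n" "coeff p n = 0" "0 < n"
    and "finite R" "card R \<ge> n" "\<And>r. r \<in> R \<Longrightarrow> poly p r = 0"
  shows "p = 0"
proof (rule ccontr)
  assume "p \<noteq> 0"
  then have "card {x. poly p x = 0} \<le> degree p" by (rule card_poly_roots_bound)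
  moreover have "card R \<le> card {x. poly p x = 0}"
    by (rule card_mono) (use \<open>p \<noteq> 0\<close> assms(6) in \<open>auto simp: poly_roots_finite\<close>)
  ultimately have "degree p = n" using assms by simp
  then show False using \<open>p \<noteq> 0\<close> assms(2) by auto
qed

text \<open>Additive polynomials are mostly handled as functions; a representing polynomial is
  produced only when degrees or coefficients are compared.\<close>

definition polyfun :: "('c::comm_ring_1 \<Rightarrow> 'c) \<Rightarrow> bool" where
  "polyfun g \<longleftrightarrow> (\<exists>p. \<forall>y. g y = poly p y)"

lemma polyfun_const [intro]: "polyfun (\<lambda>y. c)"
  unfolding polyfun_def by (rule exI[of _ "[:c:]"]) simp

lemma polyfun_id [intro]: "polyfun (\<lambda>y. y)"
  unfolding polyfun_def by (rule exI[of _ "[:0, 1:]"]) simp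

lemma polyfun_add [intro]: "polyfun g \<Longrightarrow> polyfun h \<Longrightarrow> polyfun (\<lambda>y. g y + h y)"
  unfolding polyfun_def by (metis poly_add)

lemma polyfun_diff [intro]: "polyfun g \<Longrightarrow> polyfun h \<Longrightarrow> polyfun (\<lambda>y. g y - h y)"
  unfolding polyfun_def by (metis poly_diff)

lemma polyfun_minus [intro]: "polyfun g \<Longrightarrow> polyfun (\<lambda>y. - g y)"
  unfolding polyfun_def by (metis poly_minus)

lemma polyfun_mult [intro]: "polyfun g \<Longrightarrow> polyfun h \<Longrightarrow> polyfun (\<lambda>y. g y * h y)"
  unfolding polyfun_def by (metis poly_mult)

lemma polyfun_power [intro]: "polyfun g \<Longrightarrow> polyfun (\<lambda>y. g y ^ n)"
  unfolding polyfun_def by (metis poly_power)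

lemma polyfun_sum [intro]: "(\<And>i. i \<in> I \<Longrightarrow> polyfun (g i)) \<Longrightarrow> polyfun (\<lambda>y. \<Sum>i\<in>I. g i y)"
  by (induction I rule: infinite_finite_induct) auto

lemma polyfun_compose: "polyfun g \<Longrightarrow> polyfun h \<Longrightarrow> polyfun (\<lambda>y. g (h y))"
  unfolding polyfun_def by (metis poly_pcompose)

section \<open>The Frobenius over a finite field of constants\<close>

locale finite_constants =
  fixes Fq :: "'c::field set"
  assumes Fq_subring: "subring Fq CC" and Fq_finite: "finite Fq"
begin

abbreviation "q \<equiv> card Fq"

lemmas Fq_simps [simp] = subring_CC[OF Fq_subring] subring_CC_power[OF Fq_subring] Fq_finite

lemma q_ge_2: "2 \<le> q"
  using card_mono[OF Fq_finite, of "{0, 1}"] by simp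

lemma Fq_nonempty [simp]: "Fq \<noteq> {}"
  using Fq_simps(1) by blast

lemma q_pos [simp]: "0 < q" "0 < q ^ i" "q ^ i \<noteq> 0"
  using q_ge_2 by (simp_all add: card_gt_0_iff)

lemma Fq_pow_card:
  assumes "c \<in> Fq"
  shows "c ^ q = c"
proof (cases "c = 0")
  case False
  have "inj_on ((*) c) (Fq - {0})" using False by (auto intro: inj_onI)
  moreover have "(*) c ` (Fq - {0}) \<subseteq> Fq - {0}" using assms False by auto
  ultimately have im: "(*) c ` (Fq - {0}) = Fq - {0}"
    by (intro card_subset_eq) (auto simp: card_image)
  have "(\<Prod>x\<in>Fq - {0}. x) = (\<Prod>x\<in>Fq - {0}. c * x)"
    using prod.reindex[OF \<open>inj_on ((*) c) (Fq - {0})\<close>, of "\<lambda>x. x"] im by simp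
  also have "\<dots> = c ^ card (Fq - {0}) * (\<Prod>x\<in>Fq - {0}. x)"
    by (simp add: prod.distrib)
  finally have "c ^ card (Fq - {0}) = 1"
    by (simp add: prod_zero_iff)
  then have "c ^ (q - 1) = 1" by (simp add: card_Diff_singleton)
  moreover have "c ^ q = c * c ^ (q - 1)" using q_pos(1) by (metis power_Suc Suc_diff_1)
  ultimately show ?thesis by simp
qed simp

text \<open>(X + y)^q - X^q - y^q has degree below q, so q zeros in \<open>Fq\<close> kill it. Used
  first for y in \<open>Fq\<close> and then for all y, this gives additivity of the Frobenius
  without naming the characteristic.\<close>

lemma frob_add_if:
  assumes "\<And>c. c \<in> Fq \<Longrightarrow> (c + y) ^ q = c ^ q + y ^ q"
  shows "(x + y) ^ q = x ^ q + (y :: 'c) ^ q"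
proof -
  define p where "p = [:y, 1:] ^ q - monom 1 q - [:y ^ q:]"
  have lin: "degree ([:y, 1:] ^ q) = q" "coeff ([:y, 1:] ^ q) q = 1"
    using lead_coeff_power[of "[:y, 1:]" q] by (simp_all add: degree_power_eq)
  have "p = 0"
  proof (rule poly_eq_0_if_roots[of _ q Fq])
    show "degree p \<le> q"
      unfolding p_def by (intro degree_diff_le) (auto simp: lin degree_monom_le)
    show "coeff p q = 0"
      unfolding p_def using q_ge_2 by (simp add: lin coeff_pCons split: nat.split)
    show "poly p r = 0" if "r \<in> Fq" for r
      using assms[OF that] by (simp add: p_def poly_monom add.commute)
  qed auto
  then have "poly p x = 0" by simp
  then show ?thesis by (simp add: p_def poly_monom add.commute diff_eq_eq)
qed

lemma frob_add1: "((x :: 'c) + y) ^ q = x ^ q + y ^ q"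
proof (rule frob_add_if)
  fix c assume c: "c \<in> Fq"
  have "(y + c) ^ q = y ^ q + c ^ q"
    by (rule frob_add_if) (simp add: Fq_pow_card c)
  then show "(c + y) ^ q = c ^ q + y ^ q" by (simp add: add.commute)
qed

lemma frob_add: "((x :: 'c) + y) ^ (q ^ i) = x ^ (q ^ i) + y ^ (q ^ i)"
proof (induction i)
  case (Suc i)
  have "(x + y) ^ (q ^ Suc i) = ((x + y) ^ (q ^ i)) ^ q"
    by (simp add: mult.commute flip: power_mult)
  also have "\<dots> = (x ^ (q ^ i)) ^ q + (y ^ (q ^ i)) ^ q" by (simp only: Suc frob_add1)
  also have "\<dots> = x ^ (q ^ Suc i) + y ^ (q ^ Suc i)" by (simp add: mult.commute flip: power_mult)
  finally show ?case .
qed simp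

lemma frob_minus: "(- (x :: 'c)) ^ (q ^ i) = - (x ^ (q ^ i))"
  using frob_add[of x "- x" i] by (simp add: add_eq_0_iff power_0_left)

lemma frob_diff: "((x :: 'c) - y) ^ (q ^ i) = x ^ (q ^ i) - y ^ (q ^ i)"
  using frob_add[of x "- y" i] by (simp add: frob_minus)

lemma frob_sum: "(sum (f :: _ \<Rightarrow> 'c) I) ^ (q ^ i) = (\<Sum>x\<in>I. f x ^ (q ^ i))"
  by (induction I rule: infinite_finite_induct) (auto simp: frob_add power_0_left)

lemma frob_sum1: "(sum (f :: _ \<Rightarrow> 'c) I) ^ q = (\<Sum>x\<in>I. f x ^ q)"
  using frob_sum[of f I 1] by simp

lemma frob1: "(x :: 'c) ^ q = x ^ (q ^ 1)"
  by simp

lemma Fq_pow [simp]: "c \<in> Fq \<Longrightarrow> c ^ (q ^ i) = c"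
proof (induction i)
  case (Suc i)
  have "c ^ (q ^ Suc i) = (c ^ (q ^ i)) ^ q" by (simp add: mult.commute flip: power_mult)
  then show ?case using Suc by (simp add: Fq_pow_card)
qed simp

lemma frob_inj: "(x :: 'c) ^ (q ^ i) = y ^ (q ^ i) \<longleftrightarrow> x = y"
proof
  assume "x ^ (q ^ i) = y ^ (q ^ i)"
  then have "(x - y) ^ (q ^ i) = 0" by (simp add: frob_diff)
  then show "x = y" by simp
qed simp

lemma frob_fixed_iff: "(x :: 'c) ^ q = x \<longleftrightarrow> x \<in> Fq"
proof
  assume x: "x ^ q = x"
  define p :: "'c poly" where "p = monom 1 q - monom 1 1"
  have cq: "coeff p q = 1" using q_ge_2 by (simp add: p_def)
  then have p0: "p \<noteq> 0" by auto
  have "degree p \<le> q"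
    unfolding p_def using q_ge_2 by (intro degree_diff_le) (auto simp: degree_monom_le degree_monom_eq)
  then have *: "card {x. poly p x = 0} \<le> q"
    using card_poly_roots_bound[OF p0] by simp
  have "Fq = {x. poly p x = 0}"
    by (rule card_seteq) (use poly_roots_finite[OF p0] * in \<open>auto simp: p_def poly_monom Fq_pow_card\<close>)
  then show "x \<in> Fq" using x by (auto simp: p_def poly_monom)
qed (rule Fq_pow_card)

text \<open>Infinite support gives the default value 0, so additivity and
  \<open>Fq\<close>-linearity hold without a finiteness hypothesis.\<close>

definition ev :: "(nat \<Rightarrow> 'c) \<Rightarrow> 'c \<Rightarrow> 'c" where
  "ev f y = (\<Sum>i | f i \<noteq> 0. f i * y ^ (q ^ i))"

lemma ev_add: "ev f (x + y) = ev f x + ev f y"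
  by (simp add: ev_def frob_add algebra_simps sum.distrib)

lemma ev_zero [simp]: "ev f 0 = 0"
  by (simp add: ev_def power_0_left)

lemma ev_smult: "c \<in> Fq \<Longrightarrow> ev f (c * y) = c * ev f y"
  by (simp add: ev_def power_mult_distrib sum_distrib_left algebra_simps)

lemma polyfun_ev: "polyfun (ev f)"
  unfolding ev_def by (intro polyfun_sum polyfun_mult polyfun_const polyfun_power polyfun_id)

end

text \<open>On a field of q elements X^q - X + 1 takes only the value 1.\<close>

lemma infinite_UNIV_alg_closed: "infinite (UNIV :: 'c::alg_closed_field set)"
proof
  assume fin: "finite (UNIV :: 'c set)"
  interpret finite_constants "UNIV :: 'c set"
    by standard (simp_all add: fin subring_CC_iff)
  define p :: "'c poly" where "p = monom 1 q - monom 1 1 + 1"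
  have "coeff p q = 1" using q_ge_2 by (simp add: p_def)
  then have "degree p > 0" using q_ge_2 le_degree[of p q] by simp
  then obtain x where "poly p x = 0" using alg_closed_imp_poly_has_root by blast
  then show False using Fq_pow_card[of x] by (simp add: p_def poly_monom)
qed

lemma poly_eqI_alg_closed:
  fixes p r :: "'c::alg_closed_field poly"
  assumes "\<And>y. poly p y = poly r y"
  shows "p = r"
proof (rule ccontr)
  assume "p \<noteq> r"
  then have "finite {y. poly (p - r) y = 0}" by (intro poly_roots_finite) simp
  then show False using assms infinite_UNIV_alg_closed[where 'c = 'c] by simp
qed

section \<open>Frobenius roots, the adjoint, and division by 1 - \<tau>\<close>

locale finite_constants_closed = finite_constants Fq for Fq :: "'c::alg_closed_field set"
begin

lemma frob_root_ex1: "\<exists>!y. y ^ (q ^ i) = (x :: 'c)"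
proof -
  have "coeff (monom 1 (q ^ i) - [:x:]) (q ^ i) = 1"
    by (simp add: coeff_eq_0)
  then have "q ^ i \<le> degree (monom 1 (q ^ i) - [:x:])"
    by (intro le_degree) simp
  then have "degree (monom 1 (q ^ i) - [:x:]) > 0"
    using q_pos(2)[of i] by linarith
  then obtain y where "poly (monom 1 (q ^ i) - [:x:]) y = 0"
    using alg_closed_imp_poly_has_root by blast
  then have "y ^ (q ^ i) = x" by (simp add: poly_monom)
  then show ?thesis by (intro ex1I[of _ y]) (auto simp: frob_inj)
qed

lemma frob_root_pow [simp]: "frob_root q i x ^ (q ^ i) = (x :: 'c)"
  unfolding frob_root_def by (rule theI'[OF frob_root_ex1])

lemma frob_root_eqI: "y ^ (q ^ i) = (x :: 'c) \<Longrightarrow> frob_root q i x = y"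
  using frob_inj[of "frob_root q i x" i y] by simp

lemma frob_root_0 [simp]: "frob_root q i 0 = (0 :: 'c)"
  by (rule frob_root_eqI) (simp add: power_0_left)

lemma frob_root_add: "frob_root q i ((x :: 'c) + y) = frob_root q i x + frob_root q i y"
  by (rule frob_root_eqI) (simp add: frob_add)

lemma frob_root_smult: "c \<in> Fq \<Longrightarrow> frob_root q i (c * (x :: 'c)) = c * frob_root q i x"
  by (rule frob_root_eqI) (simp add: power_mult_distrib)

lemma adjoint_add: "adjoint_act q f ((x :: 'c) + y) = adjoint_act q f x + adjoint_act q f y"
  by (simp add: adjoint_act_def distrib_left frob_root_add sum.distrib)

lemma adjoint_0 [simp]: "adjoint_act q f (0 :: 'c) = 0"
  by (simp add: adjoint_act_def)

lemma adjoint_minus: "adjoint_act q f (- (x :: 'c)) = - adjoint_act q f x"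
  using adjoint_add[of f x "- x"] by (simp add: add_eq_0_iff)

lemma adjoint_diff: "adjoint_act q f ((x :: 'c) - y) = adjoint_act q f x - adjoint_act q f y"
  using adjoint_add[of f x "- y"] by (simp add: adjoint_minus)

lemma adjoint_smult: "c \<in> Fq \<Longrightarrow> adjoint_act q f (c * x) = c * adjoint_act q f x"
  by (simp add: adjoint_act_def mult.left_commute[of _ c] frob_root_smult sum_distrib_left)

text \<open>
  The quotient of the skew polynomial \<open>c f - f\<^sup>*(c)\<close> by \<open>1 - \<tau>\<close> on the left, evaluated at \<open>y\<close>.
\<close>

definition pair :: "(nat \<Rightarrow> 'c) \<Rightarrow> 'c \<Rightarrow> 'c \<Rightarrow> 'c" where
  "pair f c y = - (\<Sum>i | f i \<noteq> 0. \<Sum>j<i. (frob_root q i (f i * c) * y) ^ (q ^ j))"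

text \<open>With z_i = (f_i c)^(1/q^i) y the inner sum telescopes to z_i^(q^i) - z_i, and z_i^(q^i)
  = f_i c y^(q^i).\<close>

lemma pair_identity: "pair f c y - pair f c y ^ q = c * ev f y - adjoint_act q f c * y"
proof -
  define z where "z i = frob_root q i (f i * c) * y" for i
  have "pair f c y ^ q = - (\<Sum>i | f i \<noteq> 0. \<Sum>j<i. z i ^ (q ^ Suc j))"
    unfolding pair_def z_def
    by (subst frob1, simp only: frob_minus frob_sum, simp add: mult.commute flip: power_mult)
  then have "pair f c y - pair f c y ^ q =
      (\<Sum>i | f i \<noteq> 0. (\<Sum>j<i. z i ^ (q ^ Suc j) - z i ^ (q ^ j)))"
    by (simp add: pair_def z_def sum_subtractf)
  also have "\<dots> = (\<Sum>i | f i \<noteq> 0. z i ^ (q ^ i) - z i)"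
    by (subst sum_lessThan_telescope) simp
  also have "\<dots> = c * ev f y - adjoint_act q f c * y"
    by (simp add: z_def power_mult_distrib ev_def adjoint_act_def sum_subtractf sum_distrib_left
        sum_distrib_right algebra_simps)
  finally show ?thesis .
qed

lemma pair_add_left: "pair f (c + c') y = pair f c y + pair f c' y"
  by (simp add: pair_def distrib_left frob_root_add distrib_right frob_add sum.distrib)

lemma pair_add_right: "pair f c (y + y') = pair f c y + pair f c y'"
  by (simp add: pair_def distrib_left frob_add sum.distrib)

lemma pair_0 [simp]: "pair f 0 y = 0" "pair f c 0 = 0"
  by (simp_all add: pair_def power_0_left)

lemma pair_smult_right: "a \<in> Fq \<Longrightarrow> pair f c (a * y) = a * pair f c y"
  by (simp add: pair_def mult.left_commute[of _ a] power_mult_distrib sum_distrib_left)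

lemma polyfun_pair: "polyfun (pair f c)"
  unfolding pair_def
  by (intro polyfun_sum polyfun_mult polyfun_const polyfun_power polyfun_id polyfun_minus)

text \<open>For nonconstant g the degree of g^q is q deg g, above both deg g and 1. This is the
  uniqueness of quotient and remainder in left division by 1 - \<tau>.\<close>

lemma frobenius_equation_trivial:
  assumes "polyfun g" "g 0 = 0" "\<And>y. g y - g y ^ q = d * y"
  shows "d = 0" "g y = (0 :: 'c)"
proof -
  obtain p where p: "\<And>y. g y = poly p y" using assms(1) by (auto simp: polyfun_def)
  have eq: "p - p ^ q = [:0, d:]"
    by (rule poly_eqI_alg_closed) (use assms(3) in \<open>simp add: p mult.commute\<close>)
  have "degree p = 0"
  proof (rule ccontr)
    assume nz: "degree p \<noteq> 0"
    have "p \<noteq> 0" using nz by auto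
    then have dq: "degree (p ^ q) = q * degree p"
      by (simp add: degree_power_eq)
    have lt: "1 < q * degree p" "degree p < q * degree p"
      using nz mult_le_mono1[OF q_ge_2, of "degree p"] by linarith+
    have "degree (p ^ q) \<le> max (degree p) (degree [:0, d:])"
      using degree_diff_le_max[of p "[:0, d:]"] by (simp only: eq[symmetric] diff_diff_eq2 add_diff_cancel_left')
    then show False using lt dq by (auto split: if_splits)
  qed
  then obtain c where "p = [:c:]" by (auto elim: degree_eq_zeroE)
  then show *: "g y = 0" for y using p[of 0] p assms(2) by simp
  show "d = 0" using assms(3)[of 1] by (simp add: * power_0_left)
qed

end

section \<open>Separable polynomials and interpolation\<close>

text \<open>Splitting off a simple root leaves a cofactor that does not vanish there, so each step
  counts a new root.\<close>

lemma card_roots_separable: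
  fixes p :: "'c::alg_closed_field poly"
  assumes "p \<noteq> 0" "\<And>a. poly p a = 0 \<Longrightarrow> poly (pderiv p) a \<noteq> 0"
  shows "card {x. poly p x = 0} = degree p"
  using assms
proof (induction "degree p" arbitrary: p)
  case 0
  then obtain c where "p = [:c:]" "c \<noteq> 0" by (metis degree_eq_zeroE pCons_0_0)
  then show ?case by simp
next
  case (Suc n)
  then obtain a where a: "poly p a = 0" using alg_closed_imp_poly_has_root[of p] by auto
  then obtain r where r: "p = [:- a, 1:] * r" by (metis poly_eq_0_iff_dvd dvdE)
  have r0: "r \<noteq> 0" using Suc.prems r by auto
  have n: "n = degree r"
    using Suc.hyps(2) r0 by (simp add: r degree_mult_eq del: mult_pCons_left)
  have der: "poly (pderiv p) x = poly r x + (x - a) * poly (pderiv r) x" for x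
    unfolding r by (subst pderiv_mult) (simp add: pderiv_pCons algebra_simps)
  have "poly r a \<noteq> 0" using Suc.prems(2)[OF a] der[of a] by simp
  moreover have "card {x. poly r x = 0} = n"
    unfolding n
  proof (rule Suc.hyps(1)[OF n r0])
    fix b assume "poly r b = 0"
    then show "poly (pderiv r) b \<noteq> 0"
      using Suc.prems(2)[of b] der[of b] by (auto simp: r)
  qed
  moreover have "{x. poly p x = 0} = insert a {x. poly r x = 0}" by (auto simp: r)
  ultimately show ?case
    using poly_roots_finite[OF r0] Suc.hyps(2) by simp
qed

text \<open>Lagrange interpolation at all the roots of \<open>p\<close>, read off at the coefficient of degree one.\<close>

lemma linear_coeff_lagrange:
  fixes p h :: "'c::field poly"
  assumes W: "W = {x. poly p x = 0}" "card W = degree p" "0 < degree p"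
    and h: "degree h < degree p" "poly h 0 = 0"
    and d: "pderiv p = [:d:]" "d \<noteq> 0" and p0: "poly p 0 = 0"
  shows "coeff h 1 = - (\<Sum>w\<in>W - {0}. inverse w * poly h w)"
proof -
  have "p \<noteq> 0" using W by auto
  then have fin: "finite W" by (simp add: W(1) poly_roots_finite)
  define Q where "Q w = synthetic_div p w" for w
  have Q: "p = [:- w, 1:] * Q w" if "w \<in> W" for w
    using synthetic_div_correct'[of w p] that W(1) by (simp add: Q_def)
  \<comment> \<open>At w the cofactor takes the value p'(w), the same constant \<open>d\<close> for
    every root; this is the common denominator in \<open>S\<close>.\<close>
  have Qw: "poly (Q w) w = d" if "w \<in> W" for w
  proof -
    have "poly (pderiv p) w = poly (Q w) w"
      by (subst Q[OF that]) (simp add: pderiv_mult pderiv_pCons del: mult_pCons_left)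
    then show ?thesis by (simp add: d)
  qed
  have Qw': "poly (Q w) w' = 0" if "w \<in> W" "w' \<in> W" "w \<noteq> w'" for w w'
  proof -
    have "0 = poly ([:- w, 1:] * Q w) w'" using Q[OF that(1)] that(2) W(1) by simp
    then show ?thesis using that(3) by simp
  qed
  define S where "S = (\<Sum>w\<in>W. Polynomial.smult (poly h w / d) (Q w))"
  define r where "r = h - S"
  have Qdeg: "degree (Q w) = degree p - 1" for w
    by (simp add: Q_def degree_synthetic_div)
  have "r = 0"
  proof (rule poly_eq_0_if_roots[of _ "degree p" W])
    show "degree r \<le> degree p"
      unfolding r_def S_def using h(1) Qdeg
      by (intro degree_diff_le degree_sum_le) (auto intro!: order_trans[OF degree_smult_le] simp: fin)
    have "coeff (Q w) (degree p) = 0" for w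
      using Qdeg W(3) by (intro coeff_eq_0) simp
    then show "coeff r (degree p) = 0"
      using h(1) by (simp add: r_def S_def coeff_sum coeff_eq_0)
    fix w' assume w': "w' \<in> W"
    have "(\<Sum>w\<in>W. poly h w / d * poly (Q w) w') = (\<Sum>w\<in>W. if w = w' then poly h w else 0)"
      by (rule sum.cong) (use w' d Qw Qw' in auto)
    then show "poly r w' = 0"
      using w' fin by (simp add: r_def S_def poly_sum)
  qed (use W fin in auto)
  then have "h = S" by (simp add: r_def)
  then have "coeff h 1 = coeff S 1" by simp
  also have "\<dots> = (\<Sum>w\<in>W. poly h w / d * coeff (Q w) 1)"
    by (simp add: S_def coeff_sum)
  also have "\<dots> = (\<Sum>w\<in>W - {0}. poly h w / d * coeff (Q w) 1)"
    by (rule sum.mono_neutral_right) (use fin h(2) in auto)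
  also have "\<dots> = (\<Sum>w\<in>W - {0}. - (inverse w * poly h w))"
  proof (rule sum.cong)
    fix w assume w: "w \<in> W - {0}"
    \<comment> \<open>Comparing the coefficients of degree 0 and 1 in p = (X - w) Q w shows coeff (Q
      w) 1 = - d / w.\<close>
    have "coeff p 0 = - w * coeff (Q w) 0"
      by (subst Q[of w]) (use w in auto)
    then have Q0: "coeff (Q w) 0 = 0" using p0 w by (simp add: poly_0_coeff_0)
    have "d = coeff (pderiv p) 0" by (simp add: d)
    also have "\<dots> = coeff p 1" by (simp add: coeff_pderiv)
    also have "\<dots> = - w * coeff (Q w) 1 + coeff (Q w) 0"
      by (subst Q[of w]) (use w in auto)
    finally have Q1: "coeff (Q w) 1 = - d / w" using w Q0 by (simp add: field_simps)
    show "poly h w / d * coeff (Q w) 1 = - (inverse w * poly h w)"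
      unfolding Q1 using d(2) w by (simp add: field_simps)
  qed simp
  finally show ?thesis by (simp add: sum_negf)
qed

section \<open>Interpolation by additive polynomials\<close>

context finite_constants
begin

definition Fq_subspace :: "'c set \<Rightarrow> bool" where
  "Fq_subspace U \<longleftrightarrow> 0 \<in> U \<and> (\<forall>x\<in>U. \<forall>y\<in>U. x + y \<in> U) \<and> (\<forall>c\<in>Fq. \<forall>x\<in>U. c * x \<in> U)"

definition Fq_linear_on :: "'c set \<Rightarrow> ('c \<Rightarrow> 'c) \<Rightarrow> bool" where
  "Fq_linear_on U f \<longleftrightarrow>
     (\<forall>x\<in>U. \<forall>y\<in>U. f (x + y) = f x + f y) \<and> (\<forall>c\<in>Fq. \<forall>x\<in>U. f (c * x) = c * f x)"

lemma Fq_linear_on_0: "Fq_linear_on U f \<Longrightarrow> 0 \<in> U \<Longrightarrow> f 0 = 0"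
  unfolding Fq_linear_on_def by (metis add_0 add_cancel_right_left)

text \<open>\<open>e\<close> is an additive polynomial with zero set \<open>U\<close>. The bound on
  \<open>q * degree g\<close> keeps the degree of g^q at most that of \<open>e\<close>, as
  \<open>frobenius_defect_multiple\<close> requires.\<close>

definition interpolant :: "'c set \<Rightarrow> 'c poly \<Rightarrow> 'c poly \<Rightarrow> bool" where
  "interpolant U e g \<longleftrightarrow>
     Fq_subspace U \<and> finite U \<and>
     degree e = card U \<and> (\<forall>y. poly e y = 0 \<longleftrightarrow> y \<in> U) \<and> Fq_linear_on UNIV (poly e) \<and>
     q * degree g \<le> card U \<and> Fq_linear_on UNIV (poly g) \<and> (\<forall>u\<in>U. poly g u \<in> Fq)"

definition extend :: "'c set \<Rightarrow> 'c \<Rightarrow> 'c set" where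
  "extend U v = {u + c * v | u c. u \<in> U \<and> c \<in> Fq}"

lemma interpolant_extend:
  assumes D: "interpolant U e g" and v: "v \<notin> U" and b: "b \<in> Fq"
  shows "\<exists>e' g'. interpolant (extend U v) e' g' \<and> (\<forall>u\<in>U. \<forall>c\<in>Fq. poly g' (u + c * v) = poly g u + c * b)"
proof -
  have sub: "Fq_subspace U" and fin: "finite U" and e: "degree e = card U"
    "\<And>y. poly e y = 0 \<longleftrightarrow> y \<in> U" "Fq_linear_on UNIV (poly e)"
    and g: "q * degree g \<le> card U" "Fq_linear_on UNIV (poly g)" "\<And>u. u \<in> U \<Longrightarrow> poly g u \<in> Fq"
    using D by (auto simp: interpolant_def)
  have lin: "poly e (x + y) = poly e x + poly e y" "poly g (x + y) = poly g x + poly g y"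
    "c \<in> Fq \<Longrightarrow> poly e (c * x) = c * poly e x" "c \<in> Fq \<Longrightarrow> poly g (c * x) = c * poly g x" for x y c
    using e(3) g(2) by (simp_all add: Fq_linear_on_def)
  define k where "k = poly e v"
  have k: "k \<noteq> 0" using v e(2) by (simp add: k_def)
  have ext: "poly e (u + c * v) = c * k" if "u \<in> U" "c \<in> Fq" for u c
    using that e(2)[of u] by (simp add: lin k_def)
  have inj: "inj_on (\<lambda>(u, c). u + c * v) (U \<times> Fq)"
  proof (rule inj_onI, clarsimp)
    fix u c u' c' assume *: "u \<in> U" "c \<in> Fq" "u' \<in> U" "c' \<in> Fq" "u + c * v = u' + c' * v"
    then have "c * k = c' * k" using ext[of u c] ext[of u' c'] * by metis
    then show "u = u' \<and> c = c'" using k * by auto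
  qed
  have im: "extend U v = (\<lambda>(u, c). u + c * v) ` (U \<times> Fq)" by (auto simp: extend_def image_iff)
  have card: "card (extend U v) = q * card U"
    unfolding im by (simp add: card_image[OF inj] card_cartesian_product mult.commute)
  have finE: "finite (extend U v)" unfolding im using fin by simp
  have subE: "Fq_subspace (extend U v)"
    unfolding Fq_subspace_def
  proof (intro conjI ballI)
    show "0 \<in> extend U v"
      unfolding extend_def using sub by (auto intro!: exI[of _ 0] simp: Fq_subspace_def)
    fix x assume "x \<in> extend U v"
    then obtain u c where x: "x = u + c * v" "u \<in> U" "c \<in> Fq" by (auto simp: extend_def)
    { fix y assume "y \<in> extend U v"
      then obtain u' c' where y: "y = u' + c' * v" "u' \<in> U" "c' \<in> Fq" by (auto simp: extend_def)
      have "x + y = (u + u') + (c + c') * v" by (simp add: x y algebra_simps)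
      moreover have "u + u' \<in> U" "c + c' \<in> Fq" using x y sub by (auto simp: Fq_subspace_def)
      ultimately show "x + y \<in> extend U v" unfolding extend_def by blast }
    fix a assume a: "a \<in> Fq"
    have "a * x = a * u + (a * c) * v" by (simp add: x algebra_simps)
    moreover have "a * u \<in> U" "a * c \<in> Fq" using x a sub by (auto simp: Fq_subspace_def)
    ultimately show "a * x \<in> extend U v" unfolding extend_def by blast
  qed
  \<comment> \<open>\<open>e\<close> maps \<open>extend U v\<close> onto k \<open>Fq\<close>, whose
    elements are the roots of Y^q - k^(q-1) Y. Adding a multiple of \<open>e\<close> to
    \<open>g\<close> corrects the value at \<open>v\<close> and leaves the values on
    \<open>U\<close> alone.\<close>
  define e' where "e' = e ^ q - Polynomial.smult (k ^ (q - 1)) e"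
  define g' where "g' = g + Polynomial.smult ((b - poly g v) / k) e"
  have pe': "poly e' y = poly e y ^ q - k ^ (q - 1) * poly e y" for y
    by (simp add: e'_def)
  have kq: "k ^ q = k ^ (q - 1) * k"
    using q_pos(1) by (metis power_Suc2 Suc_diff_1)
  have zeros: "poly e' y = 0 \<longleftrightarrow> y \<in> extend U v" for y
  proof -
    have "poly e' y = 0 \<longleftrightarrow> (poly e y / k) ^ q = poly e y / k"
      using k by (simp add: pe' power_divide kq field_simps)
    also have "\<dots> \<longleftrightarrow> poly e y / k \<in> Fq" by (rule frob_fixed_iff)
    also have "\<dots> \<longleftrightarrow> y \<in> extend U v"
    proof
      assume c: "poly e y / k \<in> Fq"
      define c where "c = poly e y / k"
      have "poly e (y + (- c) * v) = 0"
        using c k unfolding c_def[symmetric] by (subst lin, subst lin) (auto simp: k_def c_def)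
      then have "y + (- c) * v \<in> U" using e(2) by blast
      moreover have "y = (y + (- c) * v) + c * v" by simp
      ultimately show "y \<in> extend U v"
        unfolding extend_def using c unfolding c_def[symmetric] by blast
    next
      assume "y \<in> extend U v"
      then show "poly e y / k \<in> Fq" using ext k by (auto simp: extend_def)
    qed
    finally show ?thesis .
  qed
  have "card U > 0" using fin sub by (auto simp: card_gt_0_iff Fq_subspace_def)
  then have lt: "card U < q * card U" using mult_le_mono1[OF q_ge_2, of "card U"] by linarith
  have "e \<noteq> 0" using \<open>card U > 0\<close> e(1) by auto
  then have de: "degree (e ^ q) = q * card U" by (simp add: degree_power_eq e(1))
  have "degree (Polynomial.smult (k ^ (q - 1)) e) < degree (e ^ q)"
    using lt by (simp add: de e(1) k)
  then have de': "degree e' = q * card U"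
    unfolding e'_def diff_conv_add_uminus by (subst degree_add_eq_left) (simp_all add: de)
  have "degree g' \<le> card U"
  proof -
    have "1 * degree g \<le> q * degree g" by (rule mult_le_mono1) (use q_pos(1) in linarith)
    then have "degree g \<le> card U" using g(1) by linarith
    then show ?thesis
      unfolding g'_def by (intro degree_add_le) (simp_all add: e(1) order_trans[OF degree_smult_le])
  qed
  then have dg': "q * degree g' \<le> q * card U" by simp
  have linE: "Fq_linear_on UNIV (poly e')"
    unfolding Fq_linear_on_def pe'
    by (simp add: lin frob_add1 Fq_pow_card algebra_simps power_mult_distrib)
  have pg': "poly g' (u + c * v) = poly g u + c * b" if "u \<in> U" "c \<in> Fq" for u c
    using that ext[OF that] k by (simp add: g'_def lin field_simps)
  have "Fq_linear_on UNIV (\<lambda>y. poly g y + r * poly e y)" for r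
    unfolding Fq_linear_on_def by (simp add: lin algebra_simps)
  moreover have "poly g' = (\<lambda>y. poly g y + (b - poly g v) / k * poly e y)"
    by (auto simp: g'_def)
  ultimately have linG: "Fq_linear_on UNIV (poly g')" by metis
  have valG: "poly g' x \<in> Fq" if "x \<in> extend U v" for x
    using that b g(3) by (auto simp: extend_def pg')
  have "interpolant (extend U v) e' g'"
    unfolding interpolant_def using subE finE card de' zeros linE dg' linG valG by auto
  then show ?thesis using pg' by blast
qed

text \<open>\<open>U\<close> grows from {0} to \<open>W\<close> one vector at a time; the degree
  bound survives because each step multiplies \<open>card U\<close> by q.\<close>

lemma exists_interpolant:
  assumes W: "finite W" "Fq_subspace W" and W': "W' \<subseteq> W" "Fq_subspace W'"
    and a: "Fq_linear_on W' a" "a ` W' \<subseteq> Fq"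
  shows "\<exists>g. q * degree g \<le> card W \<and> poly g 0 = 0 \<and> poly g ` W \<subseteq> Fq \<and> (\<forall>w\<in>W'. poly g w = a w)"
proof -
  have "\<exists>e' g'. interpolant W e' g' \<and> (\<forall>w\<in>W'. poly g' w = a w)"
    if "interpolant U e g" "U \<subseteq> W" "\<forall>w\<in>U \<inter> W'. poly g w = a w" for U e g
    using that
  proof (induction "card (W - U)" arbitrary: U e g rule: less_induct)
    case less
    show ?case
    proof (cases "U = W")
      case True
      then show ?thesis using less.prems W' by blast
    next
      case False
      have subU: "Fq_subspace U" using less.prems(1) by (simp add: interpolant_def)
      \<comment> \<open>\<open>W'\<close> is exhausted first; afterwards new vectors receive the
        value 0 without disturbing the prescribed ones.\<close>
      obtain v where v: "v \<in> W - U" "v \<in> W' \<or> W' \<subseteq> U"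
        using False less.prems(2) W' by blast
      define b where "b = (if v \<in> W' then a v else 0)"
      have b: "b \<in> Fq" using a(2) by (auto simp: b_def)
      obtain e' g' where E: "interpolant (extend U v) e' g'"
        "\<And>u c. u \<in> U \<Longrightarrow> c \<in> Fq \<Longrightarrow> poly g' (u + c * v) = poly g u + c * b"
        using interpolant_extend[OF less.prems(1), of v b] v b by blast
      have U: "U \<subseteq> extend U v" "v \<in> extend U v"
        unfolding extend_def using subU
        by (auto intro: exI[of _ 0] exI[of _ 1] simp: Fq_subspace_def)
          (metis Fq_simps(2) add.right_neutral mult_zero_left,
           metis Fq_simps(1) add_0 mult_1)
      have sub: "extend U v \<subseteq> W"
        using W(2) less.prems(2) v by (auto simp: extend_def Fq_subspace_def)
      have "card (W - extend U v) < card (W - U)"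
        by (rule psubset_card_mono) (use W(1) U v in auto)
      moreover have "\<forall>w\<in>extend U v \<inter> W'. poly g' w = a w"
      proof
        fix w assume w: "w \<in> extend U v \<inter> W'"
        then obtain u c where u: "w = u + c * v" "u \<in> U" "c \<in> Fq" by (auto simp: extend_def)
        show "poly g' w = a w"
        proof (cases "v \<in> W'")
          case True
          then have "(- c) * v \<in> W'" using W'(2) u unfolding Fq_subspace_def by (metis Fq_simps(3))
          then have "w + (- c) * v \<in> W'" using W'(2) w unfolding Fq_subspace_def by blast
          then have "u \<in> W'" by (simp add: u)
          moreover have "c * v \<in> W'" using W'(2) u True by (simp add: Fq_subspace_def)
          ultimately have "a w = a u + c * a v"
            using a(1) True u unfolding Fq_linear_on_def by auto
          then show ?thesis
            using E(2)[OF u(2,3)] less.prems(3) u \<open>u \<in> W'\<close> True by (simp add: b_def)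
        next
          case False
          then have "w \<in> U" using v w by blast
          then have "poly g' w = poly g w" using E(2)[of w 0] by simp
          then show ?thesis using less.prems(3) w \<open>w \<in> U\<close> by simp
        qed
      qed
      ultimately show ?thesis using less.hyps[OF _ E(1) sub] by blast
    qed
  qed
  moreover have "interpolant {0} [:0, 1:] 0"
    unfolding interpolant_def Fq_subspace_def Fq_linear_on_def by (auto simp: algebra_simps)
  moreover have "{0} \<subseteq> W" "\<forall>w\<in>{0} \<inter> W'. poly 0 w = a w"
    using W(2) Fq_linear_on_0[OF a(1)] by (auto simp: Fq_subspace_def)
  ultimately obtain e g where "interpolant W e g" "\<forall>w\<in>W'. poly g w = a w" by metis
  then show ?thesis
    unfolding interpolant_def using Fq_linear_on_0[of UNIV "poly g"] by (intro exI[of _ g]) auto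
qed

text \<open>Values in \<open>Fq\<close> make g - g^q vanish on all of \<open>W\<close>, and its
  degree is at most \<open>card W\<close>; subtracting the multiple of \<open>p\<close> with the
  same top coefficient leaves 0.\<close>

lemma frobenius_defect_multiple:
  assumes p: "degree p = card W" "finite W" "W \<noteq> {}" "\<And>w. w \<in> W \<Longrightarrow> poly p w = 0"
    and g: "q * degree g \<le> card W" "poly g ` W \<subseteq> Fq"
  shows "\<exists>k. \<forall>y. poly g y - poly g y ^ q = k * poly p y"
proof -
  define n where "n = card W"
  have n: "n > 0" using p by (simp add: n_def card_gt_0_iff)
  have lc: "coeff p n \<noteq> 0" using n p(1) unfolding n_def by (metis leading_coeff_0_iff degree_0 not_less0)
  define k where "k = coeff (g - g ^ q) n / coeff p n"
  have "1 * degree g \<le> q * degree g" by (rule mult_le_mono1) (use q_pos(1) in linarith)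
  then have dg: "degree g \<le> n" using g(1) unfolding n_def by linarith
  have dgq: "degree (g ^ q) \<le> n"
    using order_trans[OF degree_power_le] g(1) by (simp add: n_def mult.commute)
  have "g - g ^ q - Polynomial.smult k p = 0"
  proof (rule poly_eq_0_if_roots[of _ n W])
    show "degree (g - g ^ q - Polynomial.smult k p) \<le> n"
      using dg dgq p(1) by (intro degree_diff_le order_trans[OF degree_smult_le]) (simp_all add: n_def)
    show "coeff (g - g ^ q - Polynomial.smult k p) n = 0"
      using lc by (simp add: k_def)
    show "poly (g - g ^ q - Polynomial.smult k p) w = 0" if "w \<in> W" for w
    proof -
      have "poly g w \<in> Fq" using g(2) that by blast
      then show ?thesis using p(4)[OF that] by (simp add: Fq_pow_card)
    qed
  qed (use n p in \<open>auto simp: n_def\<close>)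
  then have "poly (g - g ^ q - Polynomial.smult k p) y = 0" for y by simp
  then show ?thesis by (intro exI[of _ k]) simp
qed

end

section \<open>Estimates for the adjoint action\<close>

locale valued_constants = finite_constants_closed Fq
  for Fq :: "'c::complete_alg_closed_nonarch_field set"
begin

text \<open>Nonzero elements are (q-1)-st roots of unity. Hence \<open>Fq\<close> is discrete, which
  later turns approximate values into exact ones.\<close>

lemma nv_Fq:
  assumes "c \<in> Fq" "c \<noteq> 0"
  shows "nv c = 1"
proof -
  have "nv c ^ q = nv c" using Fq_pow_card[OF assms(1)] by (metis nv_power)
  moreover have "nv c ^ q = nv c * nv c ^ (q - 1)" using q_pos(1) by (metis power_Suc Suc_diff_1)
  ultimately have "nv c ^ (q - 1) = 1" using assms(2) by simp
  moreover have "0 < q - 1" using q_ge_2 by simp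
  ultimately show ?thesis using power_eq_iff_eq_base[of "q - 1" "nv c" 1] by simp
qed

lemma nv_Fq_le: "c \<in> Fq \<Longrightarrow> nv c \<le> 1"
  using nv_Fq by (cases "c = 0") auto

lemma Fq_eq_0_if_nv_less: "c \<in> Fq \<Longrightarrow> nv c < 1 \<Longrightarrow> c = 0"
  using nv_Fq by force

lemma nv_frob_root: "nv (frob_root q i x) ^ (q ^ i) = nv (x :: 'c)"
  by (metis frob_root_pow nv_power)

text \<open>The condition \<open>1 \<le> M\<close> is essential: taking roots enlarges absolute
  values strictly between 0 and 1.\<close>

lemma nv_frob_root_le:
  assumes "nv (x :: 'c) \<le> M" "1 \<le> M"
  shows "nv (frob_root q i x) \<le> M"
proof (rule ccontr)
  assume *: "\<not> nv (frob_root q i x) \<le> M"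
  then have "nv (frob_root q i x) ^ 1 \<le> nv (frob_root q i x) ^ (q ^ i)"
    using assms(2) q_pos(2)[of i] by (intro power_increasing) linarith+
  then show False using * assms(1) by (simp add: nv_frob_root)
qed

lemma nv_frob_root_less:
  assumes "nv (x :: 'c) < e ^ (q ^ i)" "0 < e"
  shows "nv (frob_root q i x) < e"
  by (rule power_less_imp_less_base[of _ "q ^ i"]) (use assms in \<open>simp_all add: nv_frob_root\<close>)

lemma adjoint_bounded:
  assumes "finite {i. f i \<noteq> 0}" "0 \<le> C"
  shows "\<exists>M\<ge>1. \<forall>c :: 'c. nv c \<le> C \<longrightarrow> nv (adjoint_act q f c) \<le> M"
proof -
  define M where "M = 1 + (\<Sum>i | f i \<noteq> 0. nv (f i) * C)"
  have M1: "M \<ge> 1" using assms(2) by (auto simp: M_def intro!: sum_nonneg)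
  have "nv (adjoint_act q f c) \<le> M" if "nv (c :: 'c) \<le> C" for c
    unfolding adjoint_act_def
  proof (rule nv_sum_le)
    fix i assume i: "i \<in> {i. f i \<noteq> 0}"
    have "nv (f i * c) \<le> nv (f i) * C" using that by (simp add: nv_mult mult_left_mono)
    also have "\<dots> \<le> (\<Sum>i | f i \<noteq> 0. nv (f i) * C)"
      by (rule member_le_sum[OF i]) (use assms in auto)
    finally show "nv (frob_root q i (f i * c)) \<le> M"
      by (intro nv_frob_root_le M1) (simp add: M_def)
  qed (use M1 in auto)
  then show ?thesis using M1 by blast
qed

lemma eventually_nv_mult_less:
  "0 < e \<Longrightarrow> \<forall>\<^sub>F c in nhds 0. nv (a * c :: 'c) < e"
proof -
  assume "0 < e"
  have "((\<lambda>c. a * c) \<longlongrightarrow> a * 0) (nhds 0)" by (intro tendsto_intros filterlim_ident)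
  then show ?thesis using \<open>0 < e\<close> unfolding tendsto_iff by (simp add: nv_def)
qed

lemma adjoint_tendsto_0:
  assumes "finite {i. f i \<noteq> 0}"
  shows "(adjoint_act q f \<longlongrightarrow> (0 :: 'c)) (nhds 0)"
  unfolding tendsto_iff
proof (intro allI impI)
  fix e :: real assume e: "e > 0"
  have "\<forall>\<^sub>F c in nhds 0. \<forall>i\<in>{i. f i \<noteq> 0}. nv (f i * c) < e ^ (q ^ i)"
    using assms e by (intro eventually_ball_finite ballI eventually_nv_mult_less) auto
  then show "\<forall>\<^sub>F c in nhds 0. dist (adjoint_act q f c) 0 < e"
  proof (rule eventually_mono)
    fix c assume "\<forall>i\<in>{i. f i \<noteq> 0}. nv (f i * c) < e ^ (q ^ i)"
    then have "nv (adjoint_act q f c) < e"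
      unfolding adjoint_act_def using e by (intro nv_sum_less nv_frob_root_less) auto
    then show "dist (adjoint_act q f c) 0 < e" by (simp add: nv_def)
  qed
qed

lemma tendsto_adjoint:
  assumes "finite {i. f i \<noteq> 0}" "(g \<longlongrightarrow> (l :: 'c)) F"
  shows "((\<lambda>x. adjoint_act q f (g x)) \<longlongrightarrow> adjoint_act q f l) F"
proof -
  have "((\<lambda>x. g x - l) \<longlongrightarrow> 0) F" using tendsto_diff[OF assms(2) tendsto_const[of l]] by simp
  then have "((\<lambda>x. adjoint_act q f (g x - l)) \<longlongrightarrow> 0) F"
    by (rule filterlim_compose[OF adjoint_tendsto_0[OF assms(1)]])
  then have "((\<lambda>x. adjoint_act q f (g x - l) + adjoint_act q f l) \<longlongrightarrow> 0 + adjoint_act q f l) F"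
    by (intro tendsto_intros)
  then show ?thesis by (simp add: adjoint_diff)
qed

lemma isCont_adjoint: "finite {i. f i \<noteq> 0} \<Longrightarrow> isCont (adjoint_act q f) (a :: 'c)"
  unfolding isCont_def by (intro tendsto_adjoint tendsto_intros)

text \<open>On the ball \<open>M * nv y \<le> 1\<close> the powers with exponent q^j do not exceed
  the first power, so the bound is linear in y and uniform in c.\<close>

lemma pair_bounded:
  assumes "finite {i. f i \<noteq> 0}" "0 \<le> C"
  shows "\<exists>M\<ge>1. \<forall>c y. nv c \<le> C \<longrightarrow> M * nv y \<le> 1 \<longrightarrow> nv (pair f c y) \<le> M * nv y"
proof -
  define M where "M = 1 + (\<Sum>i | f i \<noteq> 0. nv (f i) * C)"
  have M1: "M \<ge> 1" using assms(2) by (auto simp: M_def intro!: sum_nonneg)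
  have "nv (pair f c y) \<le> M * nv y" if "nv c \<le> C" "M * nv y \<le> 1" for c y
    unfolding pair_def nv_minus
  proof (intro nv_sum_le)
    fix i j assume i: "i \<in> {i. f i \<noteq> 0}" and j: "j \<in> {..<i}"
    have "nv (f i * c) \<le> nv (f i) * C" using that by (simp add: nv_mult mult_left_mono)
    also have "\<dots> \<le> (\<Sum>i | f i \<noteq> 0. nv (f i) * C)"
      by (rule member_le_sum[OF i]) (use assms in auto)
    finally have "nv (frob_root q i (f i * c)) \<le> M"
      by (intro nv_frob_root_le M1) (simp add: M_def)
    then have z: "nv (frob_root q i (f i * c) * y) \<le> M * nv y"
      by (simp add: nv_mult mult_right_mono)
    have "nv (frob_root q i (f i * c) * y) ^ (q ^ j) \<le> nv (frob_root q i (f i * c) * y) ^ 1"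
      using z that(2) q_pos(2)[of j] by (intro power_decreasing) (auto simp del: q_pos)
    then show "nv ((frob_root q i (f i * c) * y) ^ (q ^ j)) \<le> M * nv y"
      using z by (simp add: nv_power)
  qed (use M1 in auto)
  then show ?thesis using M1 by blast
qed

text \<open>Complements \<open>pair_bounded\<close>: here y is fixed and possibly large, while c
  tends to 0.\<close>

lemma pair_eventually_small:
  assumes "finite {i. f i \<noteq> 0}"
  shows "\<forall>\<^sub>F c in nhds 0. nv (pair f c y) < 1"
proof -
  define e where "e = inverse (1 + nv y)"
  have e: "e > 0" "e * nv y < 1"
    by (simp_all add: e_def field_simps add_pos_nonneg add_pos_nonneg[THEN order.strict_implies_not_eq])
  have "\<forall>\<^sub>F c in nhds 0. \<forall>i\<in>{i. f i \<noteq> 0}. nv (f i * c) < e ^ (q ^ i)"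
    using assms e by (intro eventually_ball_finite ballI eventually_nv_mult_less) auto
  then show ?thesis
  proof (rule eventually_mono)
    fix c assume c: "\<forall>i\<in>{i. f i \<noteq> 0}. nv (f i * c) < e ^ (q ^ i)"
    show "nv (pair f c y) < 1"
      unfolding pair_def nv_minus
    proof (intro nv_sum_less)
      fix i j assume "i \<in> {i. f i \<noteq> 0}" "j \<in> {..<i}"
      then have "nv (frob_root q i (f i * c)) < e" using c e by (intro nv_frob_root_less) auto
      then have "nv (frob_root q i (f i * c) * y) < 1"
        using e(2) by (simp add: nv_mult) (meson less_imp_le mult_right_mono nv_nonneg order_le_less_trans)
      then show "nv ((frob_root q i (f i * c) * y) ^ (q ^ j)) < 1"
        by (simp add: nv_power power_less_one_iff)
    qed auto
  qed
qed

lemma pair_tendsto_0: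
  assumes "finite {i. f i \<noteq> 0}" "\<And>n. nv (c n) \<le> C" "y \<longlonglongrightarrow> 0"
  shows "(\<lambda>n. pair f (c n) (y n)) \<longlonglongrightarrow> 0"
proof -
  have "0 \<le> C" using assms(2)[of 0] nv_nonneg order_trans by blast
  from pair_bounded[OF assms(1) this] obtain M where M: "M \<ge> 1"
    "\<And>c y. nv c \<le> C \<Longrightarrow> M * nv y \<le> 1 \<Longrightarrow> nv (pair f c y) \<le> M * nv y" by blast
  have "(\<lambda>n. M * nv (y n)) \<longlonglongrightarrow> M * 0"
    by (intro tendsto_mult tendsto_const) (use assms(3) in \<open>simp add: nv_tendsto_0_iff\<close>)
  then have lim: "(\<lambda>n. M * nv (y n)) \<longlonglongrightarrow> 0" by simp
  then have "\<forall>\<^sub>F n in sequentially. M * nv (y n) < 1" by (rule order_tendstoD) simp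
  then have "\<forall>\<^sub>F n in sequentially. nv (pair f (c n) (y n)) \<le> M * nv (y n)"
    by (rule eventually_mono) (use M(2) assms(2) in auto)
  then show ?thesis
    by (intro nv_tendsto_0_iff[THEN iffD1] tendsto_sandwich[OF _ _ tendsto_const lim]) auto
qed

section \<open>Evaluation of skew products\<close>

lemma skew_mult_sums:
  assumes f: "finite {i. f i \<noteq> 0}" and g: "(\<lambda>n. g n * x ^ (q ^ n)) sums s"
  shows "(\<lambda>n. skew_mult q f g n * x ^ (q ^ n)) sums (ev f s :: 'c)"
proof -
  define S where "S = {i. f i \<noteq> 0}"
  \<comment> \<open>Row i is the series of \<open>g\<close> raised to the power q^i, multiplied by
    \<open>f i\<close> and delayed by i places, so that column n collects the coefficient of
    \<tau>^n in the product.\<close>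
  define T where "T i n = (if i \<le> n then f i * (g (n - i) * x ^ (q ^ (n - i))) ^ (q ^ i) else 0)" for i n
  have T: "T i sums (f i * s ^ (q ^ i))" for i
  proof -
    have "(\<lambda>n. (\<Sum>k<n. g k * x ^ (q ^ k)) ^ (q ^ i)) \<longlonglongrightarrow> s ^ (q ^ i)"
      using g unfolding sums_def by (rule tendsto_power_strong[OF _ tendsto_const])
    then have "(\<lambda>n. (g n * x ^ (q ^ n)) ^ (q ^ i)) sums s ^ (q ^ i)"
      by (simp add: sums_def frob_sum)
    then have "(\<lambda>n. \<Sum>k<n. f i * (g k * x ^ (q ^ k)) ^ (q ^ i)) \<longlonglongrightarrow> f i * s ^ (q ^ i)"
      unfolding sums_def sum_distrib_left[symmetric] by (intro tendsto_intros)
    moreover have "(\<Sum>k<n. f i * (g k * x ^ (q ^ k)) ^ (q ^ i)) = (\<Sum>k<n + i. T i k)" for n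
    proof -
      have "(\<Sum>k<n + i. T i k) = (\<Sum>k\<in>{i..<n + i}. T i k)"
        by (rule sum.mono_neutral_right) (auto simp: T_def)
      also have "\<dots> = (\<Sum>k<n. f i * (g k * x ^ (q ^ k)) ^ (q ^ i))"
        by (rule sum.reindex_bij_witness[of _ "\<lambda>k. k + i" "\<lambda>k. k - i"]) (auto simp: T_def)
      finally show ?thesis by simp
    qed
    ultimately have "(\<lambda>n. \<Sum>k<n + i. T i k) \<longlonglongrightarrow> f i * s ^ (q ^ i)" by simp
    then show ?thesis unfolding sums_def by (rule LIMSEQ_offset)
  qed
  have "(\<lambda>n. \<Sum>i\<in>S. T i n) sums (\<Sum>i\<in>S. f i * s ^ (q ^ i))"
    using T by (intro sums_sum)
  moreover have "(\<Sum>i\<in>S. T i n) = skew_mult q f g n * x ^ (q ^ n)" for n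
  proof -
    have "(\<Sum>i\<in>S. T i n) = (\<Sum>i\<in>S \<inter> {..n}. T i n)"
      by (rule sum.mono_neutral_right) (use f in \<open>auto simp: S_def T_def\<close>)
    also have "\<dots> = (\<Sum>i\<le>n. T i n)"
      by (rule sum.mono_neutral_left) (auto simp: S_def T_def)
    also have "\<dots> = (\<Sum>i\<le>n. f i * g (n - i) ^ (q ^ i) * x ^ (q ^ n))"
    proof (rule sum.cong)
      fix i assume "i \<in> {..n}"
      then have "q ^ n = q ^ (n - i) * q ^ i" by (simp flip: power_add)
      then have "x ^ (q ^ n) = (x ^ (q ^ (n - i))) ^ (q ^ i)" by (simp flip: power_mult)
      then show "T i n = f i * g (n - i) ^ (q ^ i) * x ^ (q ^ n)"
        using \<open>i \<in> {..n}\<close> by (simp add: T_def power_mult_distrib)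
    qed simp
    finally show ?thesis by (simp add: skew_mult_def sum_distrib_right)
  qed
  ultimately show ?thesis by (simp add: ev_def S_def)
qed

lemma ev_sums: "finite {i. f i \<noteq> 0} \<Longrightarrow> (\<lambda>n. f n * x ^ (q ^ n)) sums (ev f x :: 'c)"
  unfolding ev_def using sums_finite[of "{i. f i \<noteq> 0}" "\<lambda>n. f n * x ^ (q ^ n)"] by simp

lemma ev_skew_mult:
  assumes "finite {i. f i \<noteq> 0}" "finite {i. g i \<noteq> 0}" "finite {i. skew_mult q f g i \<noteq> 0}"
  shows "ev (skew_mult q f g) x = ev f (ev g x :: 'c)"
  using sums_unique2[OF ev_sums[OF assms(3)] skew_mult_sums[OF assms(1) ev_sums[OF assms(2)]]] .

end

section \<open>Derivatives of additive polynomials and identities of skew series\<close>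

lemma pderiv_sum: "pderiv (sum f I) = (\<Sum>i\<in>I. pderiv (f i))"
  by (induction I rule: infinite_finite_induct) (simp_all add: pderiv_add)

context finite_constants
begin

text \<open>Shifting by 1 permutes \<open>Fq\<close> and adds q to the sum of its elements.\<close>

lemma of_nat_q: "of_nat q = (0 :: 'c)"
proof -
  have inj: "inj_on (\<lambda>c :: 'c. c + 1) Fq" by (auto intro: inj_onI)
  have "(\<lambda>c. c + 1) ` Fq = Fq"
    by (rule card_subset_eq) (auto simp: card_image[OF inj])
  then have "(\<Sum>c\<in>Fq. c) = (\<Sum>c\<in>Fq. c + 1)"
    using sum.reindex[OF inj, of "\<lambda>c. c"] by simp
  then show ?thesis by (simp add: sum.distrib)
qed

definition evpoly :: "(nat \<Rightarrow> 'c) \<Rightarrow> 'c poly" where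
  "evpoly f = (\<Sum>i | f i \<noteq> 0. monom (f i) (q ^ i))"

lemma poly_evpoly [simp]: "poly (evpoly f) y = ev f y"
  by (simp add: evpoly_def ev_def poly_sum poly_monom)

lemma pderiv_evpoly:
  assumes "finite {i. f i \<noteq> 0}"
  shows "pderiv (evpoly f) = [:f 0:]"
proof -
  have "pderiv (monom (f i) (q ^ i)) = (if i = 0 then [:f 0:] else 0)" for i
    by (cases i) (simp_all add: pderiv_monom of_nat_q monom_0)
  then have "pderiv (evpoly f) = (\<Sum>i | f i \<noteq> 0. if i = 0 then [:f 0:] else 0)"
    by (simp add: evpoly_def pderiv_sum)
  also have "\<dots> = [:f 0:]" using assms by (simp add: sum.delta)
  finally show ?thesis .
qed

lemma skew_mult_assoc: "skew_mult q f (skew_mult q g h) = skew_mult q (skew_mult q f g) (h :: nat \<Rightarrow> 'c)"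
proof
  fix n
  define u where "u i j = f i * g j ^ (q ^ i) * h (n - (i + j)) ^ (q ^ (i + j))" for i j
  have "f i * skew_mult q g h (n - i) ^ (q ^ i) = (\<Sum>j\<le>n - i. u i j)" for i
  proof -
    have "h (n - i - j) ^ (q ^ (i + j)) = (h (n - i - j) ^ (q ^ j)) ^ (q ^ i)" for j
      by (simp add: power_add mult.commute flip: power_mult)
    then show ?thesis
      by (simp add: skew_mult_def frob_sum sum_distrib_left power_mult_distrib mult.assoc u_def)
  qed
  then have "skew_mult q f (skew_mult q g h) n = (\<Sum>i\<le>n. \<Sum>j\<le>n - i. u i j)"
    by (simp add: skew_mult_def[of q f])
  also have "\<dots> = (\<Sum>(i, j)\<in>(SIGMA i:{..n}. {..n - i}). u i j)"
    by (simp add: sum.Sigma)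
  also have "(SIGMA i:{..n}. {..n - i}) = {(i, j). i + j \<le> n}" by auto
  also have "(\<Sum>(i, j)\<in>{(i, j). i + j \<le> n}. u i j) = (\<Sum>k\<le>n. \<Sum>i\<le>k. u i (k - i))"
    by (rule sum.triangle_reindex_eq)
  also have "\<dots> = (\<Sum>k\<le>n. \<Sum>i\<le>k. f i * g (k - i) ^ (q ^ i) * h (n - k) ^ (q ^ k))"
    by (intro sum.cong) (auto simp: u_def)
  also have "\<dots> = skew_mult q (skew_mult q f g) h n"
    by (simp add: skew_mult_def sum_distrib_right)
  finally show "skew_mult q f (skew_mult q g h) n = skew_mult q (skew_mult q f g) h n" .
qed

lemma skew_mult_diff: "skew_mult q f (\<lambda>n. g n - h n) n = skew_mult q f g n - skew_mult q f h (n :: nat)"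
  for g h :: "nat \<Rightarrow> 'c"
  by (simp add: skew_mult_def frob_diff right_diff_distrib sum_subtractf)

lemma skew_mult_const_right: "skew_mult q f (skew_const a) n = f n * (a :: 'c) ^ (q ^ n)"
proof -
  have "skew_mult q f (skew_const a) n = (\<Sum>i\<le>n. if i = n then f n * a ^ (q ^ n) else 0)"
    unfolding skew_mult_def by (rule sum.cong) (auto simp: skew_const_def power_0_left)
  then show ?thesis by simp
qed

text \<open>Associativity with a constant on the right, (f g) a = f (g a), written in
  coefficients.\<close>

lemma skew_mult_twist:
  "skew_mult q f (\<lambda>n. g n * (a :: 'c) ^ (q ^ n)) n = skew_mult q f g n * a ^ (q ^ n)"
proof -
  have "q ^ n = q ^ (n - i) * q ^ i" if "i \<le> n" for i using that by (simp flip: power_add)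
  then show ?thesis
    unfolding skew_mult_def sum_distrib_right
    by (intro sum.cong) (simp_all add: power_mult_distrib flip: power_mult)
qed

end

section \<open>The exponential of a Drinfeld module\<close>

locale drinfeld = curve_at_infinity Fq K Oinf
  for Fq K Oinf :: "'c::complete_alg_closed_nonarch_field set" +
  fixes \<phi> :: "'c \<Rightarrow> nat \<Rightarrow> 'c"
  assumes drinfeld: "drinfeld_module Fq (regular_away Fq K Oinf) \<phi>"

sublocale drinfeld \<subseteq> valued_constants Fq
  by (intro valued_constants.intro finite_constants_closed.intro finite_constants.intro subring_Fq finite_Fq)

context drinfeld
begin

lemmas A_simps [simp] = subring_CC[OF subring_A] subring_CC_power[OF subring_A]

lemma Fq_in_A [simp]: "c \<in> Fq \<Longrightarrow> c \<in> A"
  using Fq_subset_A by blast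

lemma phi_finite: "a \<in> A \<Longrightarrow> finite {i. \<phi> a i \<noteq> 0}"
  and phi_add: "a \<in> A \<Longrightarrow> b \<in> A \<Longrightarrow> \<phi> (a + b) = (\<lambda>i. \<phi> a i + \<phi> b i)"
  and phi_mult: "a \<in> A \<Longrightarrow> b \<in> A \<Longrightarrow> \<phi> (a * b) = skew_mult q (\<phi> a) (\<phi> b)"
  and phi_const: "c \<in> Fq \<Longrightarrow> \<phi> c = skew_const c"
  and phi_0: "a \<in> A \<Longrightarrow> \<phi> a 0 = a"
  using drinfeld by (auto simp: drinfeld_module_def)

definition t :: 'c where "t = (SOME a. a \<in> A \<and> \<phi> a \<noteq> skew_const a)"

lemma t_A [simp]: "t \<in> A" and nv_t: "nv t > 1"
proof -
  have *: "t \<in> A \<and> \<phi> t \<noteq> skew_const t"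
    unfolding t_def by (rule someI_ex) (use drinfeld in \<open>auto simp: drinfeld_module_def\<close>)
  then show "t \<in> A" by simp
  have "t \<notin> Fq" using * phi_const by blast
  then show "nv t > 1" using * nv_gt_1_if_nonconstant by blast
qed

lemma t_nonzero [simp]: "t \<noteq> 0"
  using nv_t by auto

lemma nv_t_pow_diff:
  assumes "0 < n"
  shows "nv (t ^ (q ^ n) - t) = nv t ^ (q ^ n)"
proof -
  have "1 < q ^ n" using assms q_ge_2 by (intro one_less_power) auto
  then have "nv t ^ 1 < nv t ^ (q ^ n)" using nv_t by (intro power_strict_increasing) auto
  then show ?thesis using nv_add_eq[of "- t" "t ^ (q ^ n)"] by (simp add: nv_power)
qed

lemma t_pow_ne: "0 < n \<Longrightarrow> t ^ (q ^ n) - t \<noteq> 0"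
  using nv_t_pow_diff[of n] nv_t by fastforce

abbreviation Phi :: "'c \<Rightarrow> 'c \<Rightarrow> 'c" where "Phi a \<equiv> ev (\<phi> a)"

lemma Phi_mult: "a \<in> A \<Longrightarrow> b \<in> A \<Longrightarrow> Phi (a * b) y = Phi a (Phi b y)"
  using ev_skew_mult[of "\<phi> a" "\<phi> b" y] phi_finite[of "a * b"] by (simp add: phi_mult phi_finite)

lemma Phi_1 [simp]: "Phi 1 y = y"
proof -
  have "\<phi> 1 = skew_const 1" by (rule phi_const) simp
  then show ?thesis by (simp add: ev_def skew_const_def)
qed

text \<open>At the first degree n > 0 where two solutions differ, the equation multiplies the
  difference by t^(q^n) - t, which is nonzero because |t| > 1.\<close>

lemma t_eigenseries_unique:
  assumes X: "\<And>n. skew_mult q (\<phi> t) x n = x n * t ^ (q ^ n)"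
    and Y: "\<And>n. skew_mult q (\<phi> t) y n = y n * t ^ (q ^ n)"
    and 0: "x 0 = y 0"
  shows "x = y"
proof
  fix n
  define d where "d n = x n - y n" for n
  have d: "skew_mult q (\<phi> t) d n = d n * t ^ (q ^ n)" for n
    unfolding d_def skew_mult_diff X Y by (simp add: algebra_simps)
  have "d n = 0"
  proof (induction n rule: less_induct)
    case (less n)
    show ?case
    proof (cases "n = 0")
      case False
      have "skew_mult q (\<phi> t) d n = (\<Sum>i\<le>n. if i = 0 then t * d n else 0)"
        unfolding skew_mult_def
        by (rule sum.cong) (use less in \<open>auto simp: phi_0 power_0_left\<close>)
      then have "d n * (t ^ (q ^ n) - t) = 0" using d[of n] by (simp add: algebra_simps)
      then show ?thesis using t_pow_ne False by simp
    qed (simp add: d_def 0)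
  qed
  then show "x n = y n" by (simp add: d_def)
qed

text \<open>The equation \<phi>_t e = e t in degree n + 1, solved for the newest
  coefficient.\<close>

fun ecoeff :: "nat \<Rightarrow> 'c" where
  "ecoeff 0 = 1"
| "ecoeff (Suc n) = (\<Sum>i\<le>n. \<phi> t (Suc i) * ecoeff (n - i) ^ (q ^ Suc i)) / (t ^ (q ^ Suc n) - t)"

lemma ecoeff_t: "skew_mult q (\<phi> t) ecoeff n = ecoeff n * t ^ (q ^ n)"
proof (cases n)
  case (Suc k)
  have "skew_mult q (\<phi> t) ecoeff n =
      t * ecoeff n + (\<Sum>i\<le>k. \<phi> t (Suc i) * ecoeff (k - i) ^ (q ^ Suc i))"
    unfolding skew_mult_def Suc sum.atMost_Suc_shift by (simp add: phi_0)
  also have "(\<Sum>i\<le>k. \<phi> t (Suc i) * ecoeff (k - i) ^ (q ^ Suc i)) = ecoeff n * (t ^ (q ^ n) - t)"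
    using t_pow_ne[of "Suc k"] unfolding Suc ecoeff.simps by (simp only: nonzero_eq_divide_eq[symmetric] zero_less_Suc) simp
  finally show ?thesis by (simp add: algebra_simps)
qed (simp add: skew_mult_def phi_0)

text \<open>Since \<phi>_t and \<phi>_a commute, \<phi>_a e and e a both solve the equation for t
  with leading coefficient a; uniqueness identifies them.\<close>

lemma ecoeff_A:
  assumes "a \<in> A"
  shows "skew_mult q (\<phi> a) ecoeff n = ecoeff n * a ^ (q ^ n)"
proof -
  have "skew_mult q (\<phi> a) ecoeff = (\<lambda>n. ecoeff n * a ^ (q ^ n))"
  proof (rule t_eigenseries_unique)
    fix n
    have "skew_mult q (\<phi> t) (skew_mult q (\<phi> a) ecoeff) = skew_mult q (\<phi> a) (skew_mult q (\<phi> t) ecoeff)"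
      using phi_mult[of t a] phi_mult[of a t] assms by (simp add: skew_mult_assoc mult.commute)
    also have "skew_mult q (\<phi> t) ecoeff = (\<lambda>n. ecoeff n * t ^ (q ^ n))" by (auto simp: ecoeff_t)
    finally show "skew_mult q (\<phi> t) (skew_mult q (\<phi> a) ecoeff) n = skew_mult q (\<phi> a) ecoeff n * t ^ (q ^ n)"
      by (simp add: skew_mult_twist)
    show "skew_mult q (\<phi> t) (\<lambda>n. ecoeff n * a ^ (q ^ n)) n = ecoeff n * a ^ (q ^ n) * t ^ (q ^ n)"
      by (simp add: skew_mult_twist ecoeff_t)
  qed (simp add: skew_mult_def phi_0 assms)
  then show ?thesis by simp
qed

lemma drinfeld_exp_eq: "drinfeld_exp q A \<phi> = ecoeff"
  unfolding drinfeld_exp_def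
proof (rule the_equality)
  show "ecoeff 0 = 1 \<and> (\<forall>a\<in>A. skew_mult q ecoeff (skew_const a) = skew_mult q (\<phi> a) ecoeff)"
    by (auto simp: fun_eq_iff skew_mult_const_right ecoeff_A)
next
  fix x assume x: "x 0 = 1 \<and> (\<forall>a\<in>A. skew_mult q x (skew_const a) = skew_mult q (\<phi> a) x)"
  show "x = ecoeff"
  proof (rule t_eigenseries_unique)
    have "skew_mult q (\<phi> t) x = skew_mult q x (skew_const t)" using x by simp
    then show "skew_mult q (\<phi> t) x n = x n * t ^ (q ^ n)" for n
      by (simp add: skew_mult_const_right)
  qed (use x in \<open>auto simp: ecoeff_t\<close>)
qed

text \<open>One constant for three purposes: it bounds the coefficients of \<phi>_t, the exponential
  is an isometry on the open ball of radius 1/C, and \<phi>_t^* expands outside the ball of radius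
  C.\<close>

definition C :: real where "C = 1 + (\<Sum>i | \<phi> t i \<noteq> 0. nv (\<phi> t i))"

lemma C_ge_1: "1 \<le> C"
  by (auto simp: C_def intro!: sum_nonneg)

lemma nv_phi_t_le: "nv (\<phi> t i) \<le> C"
proof (cases "\<phi> t i = 0")
  case False
  then have "nv (\<phi> t i) \<le> (\<Sum>i | \<phi> t i \<noteq> 0. nv (\<phi> t i))"
    by (intro member_le_sum) (use phi_finite[OF t_A] in auto)
  then show ?thesis by (simp add: C_def)
qed (use C_ge_1 in simp)

text \<open>The exponent reproduces itself in the recursion: C * C^(q^n - q^(i+1)) \<le> C^(q^n - 1)
  since q^(i+1) \<ge> 2, and the denominator t^(q^n) - t has absolute value at least 1.\<close>

lemma nv_ecoeff_le: "nv (ecoeff n) \<le> C ^ (q ^ n - 1)"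
proof (induction n rule: less_induct)
  case (less n)
  show ?case
  proof (cases n)
    case (Suc k)
    have "nv (\<phi> t (Suc i) * ecoeff (k - i) ^ (q ^ Suc i)) \<le> C ^ (q ^ n - 1)" if "i \<le> k" for i
    proof -
      have "nv (ecoeff (k - i)) ^ (q ^ Suc i) \<le> (C ^ (q ^ (k - i) - 1)) ^ (q ^ Suc i)"
        using less[of "k - i"] Suc by (intro power_mono) auto
      also have "\<dots> = C ^ ((q ^ (k - i) - 1) * q ^ Suc i)" by (simp flip: power_mult)
      also have "(q ^ (k - i) - 1) * q ^ Suc i = q ^ n - q ^ Suc i"
        using that Suc by (simp add: diff_mult_distrib flip: power_add power_Suc)
      finally have "nv (\<phi> t (Suc i)) * nv (ecoeff (k - i)) ^ (q ^ Suc i) \<le> C * C ^ (q ^ n - q ^ Suc i)"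
        using nv_phi_t_le[of "Suc i"] C_ge_1 by (intro mult_mono) auto
      also have "\<dots> = C ^ Suc (q ^ n - q ^ Suc i)" by simp
      also have "\<dots> \<le> C ^ (q ^ n - 1)"
      proof (rule power_increasing)
        have "2 \<le> q ^ Suc i" using q_ge_2 self_le_power[of q "Suc i"] by linarith
        moreover have "q ^ Suc i \<le> q ^ n" using that Suc q_ge_2 by (intro power_increasing) auto
        ultimately show "Suc (q ^ n - q ^ Suc i) \<le> q ^ n - 1" by linarith
      qed (rule C_ge_1)
      finally show ?thesis by (simp add: nv_mult nv_power)
    qed
    then have "nv (\<Sum>i\<le>k. \<phi> t (Suc i) * ecoeff (k - i) ^ (q ^ Suc i)) \<le> C ^ (q ^ n - 1)"
      using C_ge_1 by (intro nv_sum_le) auto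
    moreover have "1 \<le> nv (t ^ (q ^ n) - t)"
      using nv_t_pow_diff[of n] nv_t Suc by (simp add: one_le_power del: power_Suc)
    ultimately have "nv (\<Sum>i\<le>k. \<phi> t (Suc i) * ecoeff (k - i) ^ (q ^ Suc i)) / nv (t ^ (q ^ n) - t)
        \<le> C ^ (q ^ n - 1) / 1"
      using C_ge_1 by (intro frac_le) auto
    then show ?thesis unfolding Suc ecoeff.simps nv_divide by simp
  qed (use C_ge_1 in simp)
qed

section \<open>Convergence and local inversion of the exponential\<close>

definition conv :: "'c \<Rightarrow> bool" where "conv x \<longleftrightarrow> summable (\<lambda>n. ecoeff n * x ^ (q ^ n))"

definition E :: "'c \<Rightarrow> 'c" where "E x = (\<Sum>n. ecoeff n * x ^ (q ^ n))"

lemma conv_sums: "conv x \<Longrightarrow> (\<lambda>n. ecoeff n * x ^ (q ^ n)) sums E x"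
  unfolding conv_def E_def by (rule summable_sums)

lemma E_eqI: "(\<lambda>n. ecoeff n * x ^ (q ^ n)) sums s \<Longrightarrow> conv x \<and> E x = s"
  unfolding conv_def E_def by (auto simp: sums_iff)

lemma E_add: "conv x \<Longrightarrow> conv y \<Longrightarrow> conv (x + y) \<and> E (x + y) = E x + E y"
  using sums_add[OF conv_sums conv_sums, of x y] by (intro E_eqI) (simp add: frob_add algebra_simps)

lemma E_A:
  assumes "conv x" "a \<in> A"
  shows "conv (a * x) \<and> E (a * x) = Phi a (E x)"
  using skew_mult_sums[OF phi_finite[OF assms(2)] conv_sums[OF assms(1)]]
  by (intro E_eqI) (simp add: ecoeff_A[OF assms(2)] power_mult_distrib mult.assoc)

lemma conv_0 [simp]: "conv 0" "E 0 = 0"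
  using E_eqI[of 0 0] by (simp_all add: power_0_left)

lemma E_minus:
  assumes "conv x"
  shows "conv (- x)" "E (- x) = - E x"
proof -
  have "(\<lambda>n. - (ecoeff n * x ^ (q ^ n))) sums (- E x)"
    using tendsto_minus[OF conv_sums[OF assms, unfolded sums_def]] by (simp add: sums_def sum_negf)
  then have "conv (- x) \<and> E (- x) = - E x"
    by (intro E_eqI) (simp add: frob_minus)
  then show "conv (- x)" "E (- x) = - E x" by auto
qed

lemma E_diff: "conv x \<Longrightarrow> conv y \<Longrightarrow> conv (x - y) \<and> E (x - y) = E x - E y"
  using E_add[of x "- y"] E_minus[of y] by simp

text \<open>A period converges by definition; through this lemma all its quotients by t^n do as
  well.\<close>

lemma conv_le:
  assumes "conv x" "nv y \<le> nv x"
  shows "conv y"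
  unfolding conv_def
proof (rule summable_nonarch)
  have lim: "(\<lambda>n. nv (ecoeff n * x ^ (q ^ n))) \<longlonglongrightarrow> 0"
    using sums_terms_tendsto_0[OF conv_sums[OF assms(1)]] by (simp add: nv_tendsto_0_iff)
  have "nv (ecoeff n * y ^ (q ^ n)) \<le> nv (ecoeff n * x ^ (q ^ n))" for n
    using assms(2) by (simp add: nv_mult nv_power mult_left_mono power_mono)
  then show "(\<lambda>n. ecoeff n * y ^ (q ^ n)) \<longlonglongrightarrow> 0"
    by (intro nv_tendsto_0_iff[THEN iffD1] tendsto_sandwich[OF _ _ tendsto_const lim]) auto
qed

lemma nv_term_le: "nv (ecoeff n * x ^ (q ^ n)) \<le> nv x * (C * nv x) ^ (q ^ n - 1)"
proof -
  have "nv x ^ (q ^ n) = nv x * nv x ^ (q ^ n - 1)" by (metis q_pos(2) power_Suc Suc_diff_1)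
  moreover have "nv (ecoeff n) * nv x ^ (q ^ n - 1) \<le> C ^ (q ^ n - 1) * nv x ^ (q ^ n - 1)"
    by (intro mult_right_mono nv_ecoeff_le) simp
  ultimately show ?thesis
    using mult_left_mono[of "nv (ecoeff n) * nv x ^ (q ^ n - 1)" "C ^ (q ^ n - 1) * nv x ^ (q ^ n - 1)" "nv x"]
    by (simp add: nv_mult nv_power power_mult_distrib mult_ac)
qed

lemma conv_small:
  assumes "C * nv x < 1"
  shows "conv x"
  unfolding conv_def
proof (rule summable_nonarch)
  define r where "r = C * nv x"
  have r: "0 \<le> r" "r < 1" using assms C_ge_1 by (auto simp: r_def)
  have qn: "n \<le> q ^ n - 1" for n
  proof -
    have "n < 2 ^ n" by (rule less_exp)
    also have "(2 :: nat) ^ n \<le> q ^ n" using q_ge_2 by (rule power_mono) simp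
    finally show ?thesis by simp
  qed
  have le: "nv (ecoeff n * x ^ (q ^ n)) \<le> nv x * r ^ n" for n
  proof -
    have "r ^ (q ^ n - 1) \<le> r ^ n" using qn r by (intro power_decreasing) auto
    then have "nv x * r ^ (q ^ n - 1) \<le> nv x * r ^ n" by (rule mult_left_mono) simp
    then show ?thesis using nv_term_le[of n x] unfolding r_def by linarith
  qed
  have "(\<lambda>n. nv x * r ^ n) \<longlonglongrightarrow> nv x * 0"
    by (intro tendsto_mult tendsto_const LIMSEQ_power_zero) (use r in simp)
  then have lim: "(\<lambda>n. nv x * r ^ n) \<longlonglongrightarrow> 0" by simp
  show "(\<lambda>n. ecoeff n * x ^ (q ^ n)) \<longlonglongrightarrow> 0"
    by (intro nv_tendsto_0_iff[THEN iffD1] tendsto_sandwich[OF _ _ tendsto_const lim]) (auto simp: le)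
qed

text \<open>Every term beyond x carries the factor C |x| with exponent q^n - 1 \<ge> 1.\<close>

lemma nv_E_diff_le:
  assumes "C * nv x < 1"
  shows "nv (E x - x) \<le> C * nv x * nv x"
proof (rule sums_nv_le)
  have "(\<lambda>n. \<Sum>k<Suc n. ecoeff k * x ^ (q ^ k)) \<longlonglongrightarrow> E x"
    using conv_sums[OF conv_small[OF assms]] unfolding sums_def by (rule LIMSEQ_Suc)
  from tendsto_diff[OF this tendsto_const[of x]]
  show "(\<lambda>n. ecoeff (Suc n) * x ^ (q ^ Suc n)) sums (E x - x)"
    unfolding sums_def sum.lessThan_Suc_shift by (simp add: algebra_simps)
  show "0 \<le> C * nv x * nv x" using C_ge_1 by simp
  fix n
  have "1 \<le> q ^ Suc n - 1" using q_ge_2 self_le_power[of q "Suc n"] by linarith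
  then have "(C * nv x) ^ (q ^ Suc n - 1) \<le> (C * nv x) ^ 1"
    using assms C_ge_1 by (intro power_decreasing) auto
  then have "nv x * (C * nv x) ^ (q ^ Suc n - 1) \<le> nv x * (C * nv x)"
    by (intro mult_left_mono) auto
  then show "nv (ecoeff (Suc n) * x ^ (q ^ Suc n)) \<le> C * nv x * nv x"
    using nv_term_le[of "Suc n" x] by (simp add: mult_ac)
qed

lemma nv_E_small:
  assumes "C * nv x < 1"
  shows "nv (E x) = nv x"
proof (cases "x = 0")
  case False
  then have "C * nv x * nv x < 1 * nv x" using assms by (intro mult_strict_right_mono) auto
  then have "nv (E x - x) < nv x" using nv_E_diff_le[OF assms] by simp
  then show ?thesis using nv_add_eq[of "E x - x" x] by simp
qed simp

text \<open>Banach's fixed point theorem for the map taking x to w - (E x - x) on the closed ball of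
  radius |w|; by additivity of \<open>E\<close> and \<open>nv_E_diff_le\<close> its contraction
  constant is C |w|.\<close>

lemma E_surj_small:
  assumes w: "C * nv w < 1"
  shows "\<exists>x. nv x = nv w \<and> E x = w"
proof -
  define S where "S = cball (0 :: 'c) (nv w)"
  have S: "x \<in> S \<longleftrightarrow> nv x \<le> nv w" for x by (simp add: S_def nv_def dist_commute)
  have small: "C * nv x < 1" if "x \<in> S" for x
  proof -
    have "C * nv x \<le> C * nv w" using that C_ge_1 by (intro mult_left_mono) (auto simp: S)
    then show ?thesis using w by linarith
  qed
  have le: "nv (E x - x) \<le> C * nv w * nv x" if "x \<in> S" for x
  proof -
    have "C * nv x * nv x \<le> C * nv w * nv x"
      using that C_ge_1 by (intro mult_right_mono mult_left_mono) (auto simp: S)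
    then show ?thesis using nv_E_diff_le[OF small[OF that]] by linarith
  qed
  have "\<exists>!x\<in>S. w - (E x - x) = x"
  proof (rule Banach_fix)
    show "complete S" by (simp add: S_def complete_eq_closed)
    show "S \<noteq> {}" by (auto simp: S intro: exI[of _ 0])
    show "0 \<le> C * nv w" "C * nv w < 1" using w C_ge_1 by auto
    show "(\<lambda>x. w - (E x - x)) ` S \<subseteq> S"
    proof (rule image_subsetI)
      fix x assume x: "x \<in> S"
      have "C * nv w * nv x \<le> 1 * nv w"
        using x w by (intro mult_mono) (auto simp: S)
      then have "nv (E x - x) \<le> nv w" using le[OF x] by linarith
      then show "w - (E x - x) \<in> S" unfolding S by (rule nv_diff_le[OF order_refl])
    qed
    fix x y assume x: "x \<in> S" and y: "y \<in> S"
    have "x - y \<in> S" using x y unfolding S by (intro nv_diff_le)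
    moreover have "E (x - y) = E x - E y"
      using E_diff conv_small[OF small] x y by blast
    ultimately have "nv (E x - E y - (x - y)) \<le> C * nv w * nv (x - y)" using le[of "x - y"] by simp
    moreover have "w - (E x - x) - (w - (E y - y)) = - (E x - E y - (x - y))"
      by (simp add: algebra_simps)
    ultimately show "dist (w - (E x - x)) (w - (E y - y)) \<le> C * nv w * dist x y"
      unfolding nv_diff by (metis nv_minus)
  qed
  then obtain x where "x \<in> S" "w - (E x - x) = x" by blast
  then have "E x = w" by (simp add: algebra_simps)
  then show ?thesis using nv_E_small[OF small[OF \<open>x \<in> S\<close>]] by (intro exI[of _ x]) simp
qed

section \<open>Dual torsion points and functionals on the period lattice\<close>

abbreviation adj :: "'c \<Rightarrow> 'c \<Rightarrow> 'c" where "adj a \<equiv> adjoint_act q (\<phi> a)"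

abbreviation L :: "'c set" where "L \<equiv> period_lattice q A \<phi>"

lemma mem_L_iff: "z \<in> L \<longleftrightarrow> conv z \<and> E z = 0"
  unfolding period_lattice_def drinfeld_exp_eq using conv_sums[of z] E_eqI[of z 0] by auto

lemma L_0 [simp]: "0 \<in> L"
  and L_add [simp]: "x \<in> L \<Longrightarrow> y \<in> L \<Longrightarrow> x + y \<in> L"
  and L_minus [simp]: "x \<in> L \<Longrightarrow> - x \<in> L"
  and L_diff [simp]: "x \<in> L \<Longrightarrow> y \<in> L \<Longrightarrow> x - y \<in> L"
  and L_A [simp]: "a \<in> A \<Longrightarrow> x \<in> L \<Longrightarrow> a * x \<in> L"
  using E_add E_minus E_diff E_A by (auto simp: mem_L_iff)

lemma nv_t_pow_ge_1: "1 \<le> nv t ^ n"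
  using nv_t by (simp add: one_le_power)

lemma conv_L_div:
  assumes "l \<in> L"
  shows "conv (l / t ^ n)"
proof (rule conv_le)
  show "conv l" using assms by (simp add: mem_L_iff)
  have "nv l / nv t ^ n \<le> nv l / 1"
    using nv_t_pow_ge_1[of n] by (intro frac_le) auto
  then show "nv (l / t ^ n) \<le> nv l" by (simp add: nv_divide nv_power)
qed

lemma Phi_E_div:
  assumes "l \<in> L" "k \<le> n"
  shows "Phi (t ^ k) (E (l / t ^ n)) = E (l / t ^ (n - k))"
proof -
  have "t ^ k * (l / t ^ n) = l / t ^ (n - k)"
    using assms(2) by (simp add: field_simps flip: power_add)
  then show ?thesis using E_A[OF conv_L_div[OF assms(1), of n], of "t ^ k"] by simp
qed

lemma nv_div_t_tendsto: "(\<lambda>n. r / nv t ^ n) \<longlonglongrightarrow> 0"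
  using nv_t by (rule LIMSEQ_divide_realpow_zero)

lemma eventually_nv_t_pow: "\<forall>\<^sub>F n in sequentially. r < nv t ^ n"
proof -
  obtain N where "r < nv t ^ N" using real_arch_pow[OF nv_t] by blast
  then have "r < nv t ^ n" if "n \<ge> N" for n
    using power_increasing[OF that, of "nv t"] nv_t by linarith
  then show ?thesis unfolding eventually_sequentially by blast
qed

lemma small_div_t:
  assumes "C * r < nv t ^ n" "nv l \<le> r"
  shows "C * nv (l / t ^ n) < 1"
proof -
  have "C * nv l \<le> C * r" using assms(2) C_ge_1 by (intro mult_left_mono) auto
  then have "C * nv l < nv t ^ n" using assms(1) by linarith
  then show ?thesis using nv_t_pow_ge_1[of n] by (simp add: nv_divide nv_power divide_less_eq)
qed

lemma E_div_tendsto_0: "(\<lambda>n. E (l / t ^ n)) \<longlonglongrightarrow> 0"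
proof -
  have "\<forall>\<^sub>F n in sequentially. C * nv l < nv t ^ n" by (rule eventually_nv_t_pow)
  then have "\<forall>\<^sub>F n in sequentially. nv l / nv t ^ n = nv (E (l / t ^ n))"
    by (rule eventually_mono) (simp add: nv_E_small small_div_t nv_divide nv_power)
  then have "(\<lambda>n. nv (E (l / t ^ n))) \<longlonglongrightarrow> 0"
    using nv_div_t_tendsto[of "nv l"] by (rule Lim_transform_eventually[rotated])
  then show ?thesis by (simp add: nv_tendsto_0_iff)
qed

text \<open>The error of the exponential is quadratic in l / t^n, so it still tends to 0 after
  multiplication by t^n.\<close>

lemma scaled_E_tendsto: "(\<lambda>n. t ^ n * E (l / t ^ n)) \<longlonglongrightarrow> l"
proof -
  have "\<forall>\<^sub>F n in sequentially. C * nv l < nv t ^ n" by (rule eventually_nv_t_pow)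
  then have "\<forall>\<^sub>F n in sequentially. nv (t ^ n * E (l / t ^ n) - l) \<le> C * nv l * nv l / nv t ^ n"
  proof (rule eventually_mono)
    fix n assume n: "C * nv l < nv t ^ n"
    have "t ^ n * E (l / t ^ n) - l = t ^ n * (E (l / t ^ n) - l / t ^ n)"
      by (simp add: algebra_simps)
    then have "nv (t ^ n * E (l / t ^ n) - l) = nv t ^ n * nv (E (l / t ^ n) - l / t ^ n)"
      by (simp add: nv_mult nv_power)
    also have "\<dots> \<le> nv t ^ n * (C * nv (l / t ^ n) * nv (l / t ^ n))"
      by (intro mult_left_mono nv_E_diff_le small_div_t[OF n]) auto
    also have "\<dots> = C * nv l * nv l / nv t ^ n" by (simp add: nv_divide nv_power)
    finally show "nv (t ^ n * E (l / t ^ n) - l) \<le> C * nv l * nv l / nv t ^ n" .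
  qed
  then have "(\<lambda>n. t ^ n * E (l / t ^ n) - l) \<longlonglongrightarrow> 0"
    by (intro nv_tendsto_0_iff[THEN iffD1] tendsto_sandwich[OF _ _ tendsto_const nv_div_t_tendsto]) auto
  from tendsto_add[OF this tendsto_const[of l]] show ?thesis by simp
qed

section \<open>Orbits under the adjoint\<close>

definition orb :: "'c \<Rightarrow> nat \<Rightarrow> 'c" where "orb c j = (adj t ^^ j) c"

lemma orb_0 [simp]: "orb c 0 = c" and orb_Suc: "orb c (Suc j) = adj t (orb c j)"
  by (simp_all add: orb_def)

lemma orb_of_0 [simp]: "orb 0 j = 0"
  by (induction j) (simp_all add: orb_Suc)

lemma orb_diff: "orb (c - d) j = orb c j - orb d j"
  by (induction j) (simp_all add: orb_Suc adjoint_diff)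

lemma orb_shift: "orb c (j + k) = orb (orb c j) k"
  by (induction k) (simp_all add: orb_Suc)

lemma orb_tendsto_0: "((\<lambda>c. orb c j) \<longlongrightarrow> 0) (nhds 0)"
proof (induction j)
  case (Suc j)
  then show ?case
    unfolding orb_Suc by (rule filterlim_compose[OF adjoint_tendsto_0[OF phi_finite[OF t_A]]])
qed (simp add: filterlim_ident)

text \<open>
  Outside the ball of radius \<open>C\<close> the map \<open>\<phi>\<^sub>t\<^sup>*\<close> multiplies absolute values by \<open>nv t > 1\<close>, so that
  \<open>KK\<close> is the set of all elements with a bounded orbit.
\<close>

definition KK :: "'c set" where "KK = {c. \<forall>j. nv (orb c j) \<le> C}"

lemma KK_D: "c \<in> KK \<Longrightarrow> nv (orb c j) \<le> C"
  by (simp add: KK_def)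

text \<open>The term t c dominates: for i > 0 one has |\<phi>_i c| \<le> C |c| < |c|^2 \<le>
  |c|^(q^i), so the q^i-th root is smaller than |c|.\<close>

lemma adj_expanding:
  assumes "C < nv c"
  shows "nv (adj t c) = nv t * nv c"
proof -
  have c: "c \<noteq> 0" "1 < nv c" using assms C_ge_1 by auto
  have "adj t c = frob_root q 0 (\<phi> t 0 * c) + (\<Sum>i\<in>{i. \<phi> t i \<noteq> 0} - {0}. frob_root q i (\<phi> t i * c))"
    unfolding adjoint_act_def by (rule sum.remove) (simp_all add: phi_finite phi_0)
  also have "frob_root q 0 (\<phi> t 0 * c) = t * c" by (rule frob_root_eqI) (simp add: phi_0)
  finally have eq: "adj t c = t * c + (\<Sum>i\<in>{i. \<phi> t i \<noteq> 0} - {0}. frob_root q i (\<phi> t i * c))" .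
  have "nv (\<Sum>i\<in>{i. \<phi> t i \<noteq> 0} - {0}. frob_root q i (\<phi> t i * c)) < nv t * nv c"
  proof (rule nv_sum_less)
    fix i assume i: "i \<in> {i. \<phi> t i \<noteq> 0} - {0}"
    have "nv (\<phi> t i * c) \<le> C * nv c" unfolding nv_mult by (intro mult_right_mono nv_phi_t_le) simp
    also have "\<dots> < nv c * nv c" using assms c by (intro mult_strict_right_mono) auto
    also have "\<dots> = nv c ^ 2" by (simp add: power2_eq_square)
    also have "\<dots> \<le> nv c ^ (q ^ i)"
    proof (rule power_increasing)
      have "q ^ 1 \<le> q ^ i" using i q_ge_2 by (intro power_increasing) auto
      then show "2 \<le> q ^ i" using q_ge_2 by simp
    qed (use c in simp)
    finally have "nv (frob_root q i (\<phi> t i * c)) < nv c" using c by (intro nv_frob_root_less) auto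
    also have "nv c < nv t * nv c" using c nv_t by simp
    finally show "nv (frob_root q i (\<phi> t i * c)) < nv t * nv c" .
  qed (use c nv_t in simp)
  then show ?thesis unfolding eq by (subst nv_add_eq) (simp_all add: nv_mult)
qed

text \<open>Once an orbit exceeds C it grows like |t|^k. Any bound can thus be replaced by the
  uniform one, which makes \<open>KK\<close> closed under limits.\<close>

lemma bounded_orbit_KK:
  assumes "\<And>j. nv (orb c j) \<le> B"
  shows "c \<in> KK"
  unfolding KK_def
proof (rule CollectI, rule allI, rule ccontr)
  fix j assume "\<not> nv (orb c j) \<le> C"
  then have j: "C < nv (orb c j)" by simp
  have *: "nv t ^ k * C < nv (orb c (j + k))" for k
  proof (induction k)
    case (Suc k)
    have "C \<le> nv t ^ k * C" using nv_t_pow_ge_1[of k] C_ge_1 by simp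
    then have "nv (orb c (j + Suc k)) = nv t * nv (orb c (j + k))"
      using Suc by (simp add: orb_Suc adj_expanding)
    then show ?case using Suc nv_t by (simp add: mult.assoc)
  qed (use j in simp)
  obtain k where "B < nv t ^ k" using real_arch_pow[OF nv_t] by blast
  also have "\<dots> \<le> nv t ^ k * C" using nv_t_pow_ge_1[of k] C_ge_1 by simp
  also note *[of k]
  finally show False using assms[of "j + k"] by simp
qed

lemma KK_diff: "c \<in> KK \<Longrightarrow> d \<in> KK \<Longrightarrow> c - d \<in> KK"
  by (simp add: KK_def orb_diff nv_diff_le)

text \<open>
  Iterating \<open>pair_identity\<close> along the orbit of \<open>c\<close> writes \<open>c \<phi>\<^bsub>t^n\<^esub>\<close> as \<open>(1 - \<tau>) h\<^sub>n\<close> plus an error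
  that vanishes in the limit.  Here \<open>H n c\<close> is \<open>h\<^sub>n\<close>, \<open>psum c l n\<close> is its value at \<open>exp\<^sub>\<phi>(l / t^n)\<close>, and
  the limit \<open>alpha c l\<close> is killed by \<open>1 - \<tau>\<close>, hence lies in \<open>Fq\<close>.
\<close>

definition psum :: "'c \<Rightarrow> 'c \<Rightarrow> nat \<Rightarrow> 'c" where
  "psum c l n = (\<Sum>j<n. pair (\<phi> t) (orb c j) (E (l / t ^ Suc j)))"

definition alpha :: "'c \<Rightarrow> 'c \<Rightarrow> 'c" where "alpha c l = lim (psum c l)"

lemma pair_orb_tendsto_0:
  assumes "c \<in> KK" "a \<in> A"
  shows "(\<lambda>n. pair (\<phi> a) (orb c n) (E (l / t ^ n))) \<longlonglongrightarrow> 0"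
  by (rule pair_tendsto_0[OF phi_finite[OF assms(2)] KK_D[OF assms(1)] E_div_tendsto_0])

lemma psum_lim:
  assumes "c \<in> KK"
  shows "psum c l \<longlonglongrightarrow> alpha c l"
proof -
  have "(\<lambda>n. pair (\<phi> t) (orb c n) (E (l / t ^ Suc n))) \<longlonglongrightarrow> 0"
    by (rule pair_tendsto_0[OF phi_finite[OF t_A] KK_D[OF assms] LIMSEQ_Suc[OF E_div_tendsto_0]])
  then have "(\<lambda>n. psum c l (Suc n) - psum c l n) \<longlonglongrightarrow> 0"
    by (simp add: psum_def)
  then show ?thesis
    unfolding alpha_def by (rule convergent_LIMSEQ_iff[THEN iffD1, OF convergent_nonarch])
qed

definition H :: "nat \<Rightarrow> 'c \<Rightarrow> 'c \<Rightarrow> 'c" where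
  "H n c y = (\<Sum>j<n. pair (\<phi> t) (orb c j) (Phi (t ^ (n - Suc j)) y))"

lemma H_E: "l \<in> L \<Longrightarrow> H n c (E (l / t ^ n)) = psum c l n"
  unfolding H_def psum_def by (intro sum.cong) (auto simp: Phi_E_div)

text \<open>The errors telescope: the remainder left by one orbit point is the coefficient divided
  in the next step.\<close>

lemma H_identity: "H n c y - H n c y ^ q = c * Phi (t ^ n) y - orb c n * y"
proof -
  define v where "v j = orb c j * Phi (t ^ (n - j)) y" for j
  have "H n c y - H n c y ^ q = (\<Sum>j<n. pair (\<phi> t) (orb c j) (Phi (t ^ (n - Suc j)) y)
      - pair (\<phi> t) (orb c j) (Phi (t ^ (n - Suc j)) y) ^ q)"
    unfolding H_def sum_subtractf by (simp only: frob_sum1)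
  also have "\<dots> = (\<Sum>j<n. v j - v (Suc j))"
  proof (rule sum.cong)
    fix j assume "j \<in> {..<n}"
    then have "t * t ^ (n - Suc j) = t ^ (n - j)"
      by (simp add: Suc_diff_Suc flip: power_Suc)
    then have "Phi t (Phi (t ^ (n - Suc j)) y) = Phi (t ^ (n - j)) y"
      using Phi_mult[of t "t ^ (n - Suc j)" y] by simp
    then show "pair (\<phi> t) (orb c j) (Phi (t ^ (n - Suc j)) y)
      - pair (\<phi> t) (orb c j) (Phi (t ^ (n - Suc j)) y) ^ q = v j - v (Suc j)"
      unfolding pair_identity by (simp add: v_def orb_Suc)
  qed simp
  also have "\<dots> = v 0 - v n" by (rule sum_lessThan_telescope')
  finally show ?thesis by (simp add: v_def)
qed

lemma polyfun_H: "polyfun (H n c)"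
  unfolding H_def by (intro polyfun_sum polyfun_compose[OF polyfun_pair polyfun_ev])

lemma H_at_0 [simp]: "H n c 0 = 0"
  by (simp add: H_def)

lemma psum_identity:
  assumes "l \<in> L"
  shows "psum c l n - psum c l n ^ q = - (orb c n * E (l / t ^ n))"
proof -
  have "Phi (t ^ n) (E (l / t ^ n)) = 0"
    using Phi_E_div[OF assms, of n n] assms by (simp add: mem_L_iff)
  then show ?thesis using H_identity[of n c "E (l / t ^ n)"] H_E[OF assms] by simp
qed

text \<open>In \<open>psum_identity\<close> the orbit is bounded and E(l / t^n) tends to 0, so the
  limit satisfies x = x^q.\<close>

lemma alpha_in_Fq:
  assumes "c \<in> KK" "l \<in> L"
  shows "alpha c l \<in> Fq"
proof -
  note lim = psum_lim[OF assms(1), of l]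
  have 1: "(\<lambda>n. psum c l n - psum c l n ^ q) \<longlonglongrightarrow> alpha c l - alpha c l ^ q"
    by (intro tendsto_diff lim tendsto_power_strong[OF lim tendsto_const])
  have "(\<lambda>n. nv (orb c n * E (l / t ^ n))) \<longlonglongrightarrow> 0"
  proof (rule tendsto_sandwich[OF _ _ tendsto_const])
    show "\<forall>\<^sub>F n in sequentially. nv (orb c n * E (l / t ^ n)) \<le> C * nv (E (l / t ^ n))"
      using KK_D[OF assms(1)] by (simp add: nv_mult mult_right_mono)
    have "(\<lambda>n. C * nv (E (l / t ^ n))) \<longlonglongrightarrow> C * 0"
      by (intro tendsto_mult tendsto_const) (simp add: nv_tendsto_0_iff E_div_tendsto_0)
    then show "(\<lambda>n. C * nv (E (l / t ^ n))) \<longlonglongrightarrow> 0" by simp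
  qed simp
  then have "(\<lambda>n. - (orb c n * E (l / t ^ n))) \<longlonglongrightarrow> - 0"
    by (intro tendsto_minus) (simp add: nv_tendsto_0_iff)
  then have "(\<lambda>n. psum c l n - psum c l n ^ q) \<longlonglongrightarrow> 0"
    by (simp add: psum_identity[OF assms(2)])
  from LIMSEQ_unique[OF 1 this] show ?thesis using frob_fixed_iff[of "alpha c l"] by simp
qed

lemma alpha_linear:
  assumes "c \<in> KK"
  shows "Fq_linear_on L (alpha c)"
  unfolding Fq_linear_on_def
proof (intro conjI ballI)
  fix x y assume *: "x \<in> L" "y \<in> L"
  have "E ((x + y) / t ^ n) = E (x / t ^ n) + E (y / t ^ n)" for n
    using E_add[OF conv_L_div conv_L_div] * by (simp add: add_divide_distrib)
  then have "psum c (x + y) = (\<lambda>n. psum c x n + psum c y n)"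
    by (simp add: psum_def pair_add_right sum.distrib fun_eq_iff del: power_Suc)
  then have "psum c (x + y) \<longlonglongrightarrow> alpha c x + alpha c y"
    using tendsto_add[OF psum_lim psum_lim, OF assms assms] by simp
  then show "alpha c (x + y) = alpha c x + alpha c y"
    using LIMSEQ_unique psum_lim[OF assms] by blast
next
  fix a x assume *: "a \<in> Fq" "x \<in> L"
  have "Phi a y = a * y" for y
    using * by (cases "a = 0") (simp_all add: phi_const ev_def skew_const_def)
  then have "E (a * x / t ^ n) = a * E (x / t ^ n)" for n
    using E_A[OF conv_L_div, of x a n] * by simp
  then have "psum c (a * x) = (\<lambda>n. a * psum c x n)"
    using * by (simp add: psum_def pair_smult_right sum_distrib_left fun_eq_iff del: power_Suc)
  then have "psum c (a * x) \<longlonglongrightarrow> a * alpha c x"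
    using tendsto_mult[OF tendsto_const psum_lim[OF assms]] by simp
  then show "alpha c (a * x) = a * alpha c x"
    using LIMSEQ_unique psum_lim[OF assms] by blast
qed

lemma alpha_diff:
  assumes "c \<in> KK" "d \<in> KK"
  shows "alpha (c - d) l = alpha c l - alpha d l"
proof -
  have "pair (\<phi> t) (x - y) z = pair (\<phi> t) x z - pair (\<phi> t) y z" for x y z
    using pair_add_left[of "\<phi> t" "x - y" y z] by simp
  then have "psum (c - d) l = (\<lambda>n. psum c l n - psum d l n)"
    by (simp add: psum_def orb_diff sum_subtractf fun_eq_iff)
  then have "psum (c - d) l \<longlonglongrightarrow> alpha c l - alpha d l"
    using tendsto_diff[OF psum_lim psum_lim, OF assms] by simp
  then show ?thesis using LIMSEQ_unique psum_lim[OF KK_diff[OF assms]] by blast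
qed

text \<open>Beyond some \<open>J\<close> all summands are below 1, uniformly for c in
  \<open>KK\<close>; the finitely many earlier ones are small for c near 0. An element of
  \<open>Fq\<close> of absolute value below 1 is 0.\<close>

lemma alpha_eventually_0:
  assumes "l \<in> L"
  shows "\<forall>\<^sub>F c in nhds 0. c \<in> KK \<longrightarrow> alpha c l = 0"
proof -
  have "0 \<le> C" using C_ge_1 by simp
  from pair_bounded[OF phi_finite[OF t_A] this] obtain M where M: "M \<ge> 1"
    "\<And>c y. nv c \<le> C \<Longrightarrow> M * nv y \<le> 1 \<Longrightarrow> nv (pair (\<phi> t) c y) \<le> M * nv y" by blast
  have "(\<lambda>j. M * nv (E (l / t ^ Suc j))) \<longlonglongrightarrow> M * 0"
    by (intro tendsto_mult tendsto_const LIMSEQ_Suc) (simp add: nv_tendsto_0_iff E_div_tendsto_0)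
  then have "\<forall>\<^sub>F j in sequentially. M * nv (E (l / t ^ Suc j)) < 1"
    by (rule order_tendstoD(2)) simp
  then obtain J where J: "\<And>j. j \<ge> J \<Longrightarrow> M * nv (E (l / t ^ Suc j)) < 1"
    unfolding eventually_sequentially by blast
  have "\<forall>\<^sub>F c in nhds 0. \<forall>j\<in>{..<J}. nv (pair (\<phi> t) (orb c j) (E (l / t ^ Suc j))) < 1"
    by (intro eventually_ball_finite ballI
        eventually_compose_filterlim[OF pair_eventually_small[OF phi_finite[OF t_A]] orb_tendsto_0]) auto
  then show ?thesis
  proof (rule eventually_mono, intro impI)
    fix c assume c: "\<forall>j\<in>{..<J}. nv (pair (\<phi> t) (orb c j) (E (l / t ^ Suc j))) < 1" and K: "c \<in> KK"
    have "nv (pair (\<phi> t) (orb c j) (E (l / t ^ Suc j))) < 1" for j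
    proof (cases "j < J")
      case False
      then have "M * nv (E (l / t ^ Suc j)) < 1" using J by simp
      then show ?thesis using M(2)[OF KK_D[OF K], of "E (l / t ^ Suc j)" j] by linarith
    qed (use c in simp)
    then have small: "nv (psum c l n) < 1" for n
      unfolding psum_def by (intro nv_sum_less) auto
    obtain n where "dist (psum c l n) (alpha c l) < 1"
      using psum_lim[OF K, of l] unfolding lim_sequentially by (meson order_refl zero_less_one)
    then have "nv (alpha c l - psum c l n) < 1" by (simp add: nv_diff nv_minus_commute)
    from nv_add_less[OF this small[of n]] have "nv (alpha c l) < 1" by simp
    then show "alpha c l = 0" using Fq_eq_0_if_nv_less alpha_in_Fq[OF K assms] by blast
  qed
qed

text \<open>Dividing c \<phi>_a \<phi>_b = c \<phi>_b \<phi>_a by 1 - \<tau> in two ways; uniqueness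
  equates the remainders and the quotients.\<close>

lemma adj_commute_cocycle:
  assumes "a \<in> A" "b \<in> A"
  shows "adj a (adj b c) = adj b (adj a c)"
    "pair (\<phi> a) c (Phi b y) + pair (\<phi> b) (adj a c) y = pair (\<phi> b) c (Phi a y) + pair (\<phi> a) (adj b c) y"
proof -
  define G where "G a b y = pair (\<phi> a) c (Phi b y) + pair (\<phi> b) (adj a c) y" for a b y
  have G: "G a b y - G a b y ^ q = c * Phi (a * b) y - adj b (adj a c) * y" if "a \<in> A" "b \<in> A" for a b y
  proof -
    have "G a b y - G a b y ^ q = (pair (\<phi> a) c (Phi b y) - pair (\<phi> a) c (Phi b y) ^ q)
        + (pair (\<phi> b) (adj a c) y - pair (\<phi> b) (adj a c) y ^ q)"
      by (simp add: G_def frob_add1)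
    then show ?thesis unfolding pair_identity by (simp add: Phi_mult that)
  qed
  have "polyfun (G a b)" for a b
    unfolding G_def by (intro polyfun_add polyfun_pair polyfun_compose[OF polyfun_pair polyfun_ev])
  then have p: "polyfun (\<lambda>y. G a b y - G b a y)" by (intro polyfun_diff)
  have z: "G a b 0 - G b a 0 = 0" by (simp add: G_def)
  have d: "G a b y - G b a y - (G a b y - G b a y) ^ q = (adj a (adj b c) - adj b (adj a c)) * y" for y
  proof -
    have "(G a b y - G b a y) ^ q = G a b y ^ q - G b a y ^ q"
      using frob_diff[of "G a b y" "G b a y" 1] by simp
    then have "G a b y - G b a y - (G a b y - G b a y) ^ q
        = (G a b y - G a b y ^ q) - (G b a y - G b a y ^ q)" by simp
    then show ?thesis by (simp add: G assms mult.commute[of b a] algebra_simps)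
  qed
  show "adj a (adj b c) = adj b (adj a c)"
    using frobenius_equation_trivial(1)[OF p z d] by simp
  show "pair (\<phi> a) c (Phi b y) + pair (\<phi> b) (adj a c) y = pair (\<phi> b) c (Phi a y) + pair (\<phi> a) (adj b c) y"
    using frobenius_equation_trivial(2)[OF p z d, of y] by (simp add: G_def)
qed

lemma orb_adj: "a \<in> A \<Longrightarrow> orb (adj a c) j = adj a (orb c j)"
  by (induction j) (simp_all add: orb_Suc adj_commute_cocycle(1))

lemma adj_KK:
  assumes "c \<in> KK" "a \<in> A"
  shows "adj a c \<in> KK"
proof -
  have "0 \<le> C" using C_ge_1 by simp
  from adjoint_bounded[OF phi_finite[OF assms(2)] this] obtain M where
    "\<And>c. nv c \<le> C \<Longrightarrow> nv (adj a c) \<le> M" by blast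
  then show ?thesis
    using KK_D[OF assms(1)] by (intro bounded_orbit_KK[of _ M]) (simp add: orb_adj assms(2))
qed

text \<open>By the cocycle rule the partial sums differ by a telescoping sum whose boundary terms
  are \<open>v n\<close>, tending to 0, and \<open>v 0\<close>, which vanishes because E l =
  0.\<close>

lemma alpha_adj:
  assumes c: "c \<in> KK" and a: "a \<in> A" and l: "l \<in> L"
  shows "alpha (adj a c) l = alpha c (a * l)"
proof -
  define v where "v j = pair (\<phi> a) (orb c j) (E (l / t ^ j))" for j
  have "psum (adj a c) l n - psum c (a * l) n = v n" for n
  proof -
    have "psum (adj a c) l n - psum c (a * l) n = (\<Sum>j<n. v (Suc j) - v j)"
      unfolding psum_def sum_subtractf[symmetric]
    proof (rule sum.cong)
      fix j
      have "E (a * l / t ^ Suc j) = Phi a (E (l / t ^ Suc j))"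
        using E_A[OF conv_L_div[OF l] a, of "Suc j"] by simp
      moreover have "Phi t (E (l / t ^ Suc j)) = E (l / t ^ j)"
        using Phi_E_div[OF l, of 1 "Suc j"] by simp
      ultimately show "pair (\<phi> t) (orb (adj a c) j) (E (l / t ^ Suc j))
          - pair (\<phi> t) (orb c j) (E (a * l / t ^ Suc j)) = v (Suc j) - v j"
        using adj_commute_cocycle(2)[OF a t_A, of "orb c j" "E (l / t ^ Suc j)"]
        by (simp add: v_def orb_adj a orb_Suc algebra_simps del: power_Suc)
    qed simp
    also have "\<dots> = v n - v 0" by (rule sum_lessThan_telescope)
    also have "v 0 = 0" using l by (simp add: v_def mem_L_iff)
    finally show ?thesis by simp
  qed
  then have "psum (adj a c) l = (\<lambda>n. v n + psum c (a * l) n)" by (auto simp: algebra_simps)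
  moreover have "v \<longlonglongrightarrow> 0" unfolding v_def by (rule pair_orb_tendsto_0[OF c a])
  ultimately have "psum (adj a c) l \<longlonglongrightarrow> 0 + alpha c (a * l)"
    using tendsto_add[of v 0 sequentially "psum c (a * l)" "alpha c (a * l)"] psum_lim[OF c] by simp
  then show ?thesis using LIMSEQ_unique[OF _ psum_lim[OF adj_KK[OF c a]]] by simp
qed

section \<open>Torsion points and the summation formula\<close>

definition W :: "nat \<Rightarrow> 'c set" where "W n = {w. Phi (t ^ n) w = 0}"

lemma W_roots: "W n = {w. poly (evpoly (\<phi> (t ^ n))) w = 0}"
  by (simp add: W_def)

lemma pderiv_torsion: "pderiv (evpoly (\<phi> (t ^ n))) = [:t ^ n:]"
  using pderiv_evpoly[OF phi_finite[of "t ^ n"]] by (simp add: phi_0)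

lemma torsion_poly_nonzero: "evpoly (\<phi> (t ^ n)) \<noteq> 0"
  using pderiv_torsion[of n] by auto

lemma card_W: "card (W n) = degree (evpoly (\<phi> (t ^ n)))"
  unfolding W_roots by (rule card_roots_separable[OF torsion_poly_nonzero]) (simp add: pderiv_torsion)

lemma degree_torsion_poly: "0 < degree (evpoly (\<phi> (t ^ n)))"
proof (rule ccontr)
  assume "\<not> 0 < degree (evpoly (\<phi> (t ^ n)))"
  then obtain c where "evpoly (\<phi> (t ^ n)) = [:c:]" by (auto elim: degree_eq_zeroE)
  then have "pderiv (evpoly (\<phi> (t ^ n))) = 0" by (simp add: pderiv_pCons)
  then show False by (simp add: pderiv_torsion)
qed

lemma finite_W: "finite (W n)"
  unfolding W_roots by (rule poly_roots_finite[OF torsion_poly_nonzero])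

lemma zero_in_W [simp]: "0 \<in> W n"
  by (simp add: W_def)

lemma W_subspace: "Fq_subspace (W n)"
  unfolding Fq_subspace_def W_def by (simp add: ev_add ev_smult)

text \<open>Lagrange interpolation of \<open>H n c\<close> at the roots of \<phi>_(t^n). The linear
  coefficient is read off from h - h^q = c p - (orb c n) X, as the derivative of h^q
  vanishes.\<close>

lemma torsion_sum: "c * t ^ n - orb c n = - (\<Sum>w\<in>W n - {0}. inverse w * H n c w)"
proof -
  define p where "p = evpoly (\<phi> (t ^ n))"
  obtain h where h: "\<And>y. H n c y = poly h y" using polyfun_H[of n c] by (auto simp: polyfun_def)
  have eq: "h - h ^ q = Polynomial.smult c p - [:0, orb c n:]"
    by (rule poly_eqI_alg_closed)
      (use H_identity[of n c] in \<open>simp add: h p_def mult.commute\<close>)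
  \<comment> \<open>For nonconstant h the degree q deg h of h^q exceeds deg h, so the equation
    bounds it by deg p.\<close>
  have deg: "degree h < degree p"
  proof (cases "degree h = 0")
    case False
    have "h \<noteq> 0" using False by auto
    then have dq: "degree (h ^ q) = q * degree h"
      by (simp add: degree_power_eq)
    have lt: "degree h < q * degree h"
      using False mult_le_mono1[OF q_ge_2, of "degree h"] by linarith
    have "h ^ q = h - (Polynomial.smult c p - [:0, orb c n:])"
      by (simp only: eq[symmetric] diff_diff_eq2 add_diff_cancel_left')
    also have "degree \<dots> \<le> max (degree h) (degree p)"
      using degree_torsion_poly[of n]
      by (intro degree_diff_le order_trans[OF degree_smult_le]) (simp_all add: p_def le_max_iff_disj)
    finally show ?thesis unfolding dq le_max_iff_disj using lt by linarith
  qed (use degree_torsion_poly in \<open>simp add: p_def\<close>)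
  have "coeff h 1 = coeff (pderiv (h - h ^ q)) 0"
    by (simp add: pderiv_diff pderiv_power of_nat_q coeff_pderiv)
  also have "\<dots> = c * t ^ n - orb c n"
    unfolding eq by (simp add: pderiv_diff pderiv_smult pderiv_torsion p_def pderiv_pCons)
  finally have "c * t ^ n - orb c n = coeff h 1" by simp
  also have "\<dots> = - (\<Sum>w\<in>W n - {0}. inverse w * poly h w)"
  proof (rule linear_coeff_lagrange[of _ p])
    show "W n = {x. poly p x = 0}" unfolding p_def by (rule W_roots)
    show "card (W n) = degree p" "0 < degree p"
      "pderiv p = [:t ^ n:]" "poly p 0 = 0"
      by (simp_all add: p_def card_W degree_torsion_poly pderiv_torsion)
    show "poly h 0 = 0" using h[of 0] by simp
  qed (use deg in auto)
  finally show ?thesis by (simp add: h)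
qed

definition Lball :: "real \<Rightarrow> 'c set" where "Lball r = {l \<in> L. nv l \<le> r}"

text \<open>For such n the points l / t^n lie where \<open>E\<close> is isometric and invertible,
  and E(t^n x) = \<phi>_(t^n)(E x) turns torsion points into periods.\<close>

lemma Lball_bij:
  assumes "C * r < nv t ^ n"
  shows "bij_betw (\<lambda>l. E (l / t ^ n)) (Lball r) {w \<in> W n. nv (t ^ n * w) \<le> r}"
proof -
  have small: "C * nv (l / t ^ n) < 1" if "nv l \<le> r" for l
    using small_div_t[OF assms that] .
  have nvE: "nv (E (l / t ^ n)) = nv l / nv t ^ n" if "nv l \<le> r" for l
    using nv_E_small[OF small[OF that]] by (simp add: nv_divide nv_power)
  show "bij_betw (\<lambda>l. E (l / t ^ n)) (Lball r) {w \<in> W n. nv (t ^ n * w) \<le> r}"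
    unfolding bij_betw_def
  proof (intro conjI inj_onI subset_antisym subsetI)
    fix l l' assume *: "l \<in> Lball r" "l' \<in> Lball r" "E (l / t ^ n) = E (l' / t ^ n)"
    then have "E ((l - l') / t ^ n) = 0"
      using E_diff[OF conv_L_div conv_L_div, of l l' n n] by (simp add: Lball_def diff_divide_distrib)
    moreover have "nv (l - l') \<le> r" using * by (simp add: Lball_def nv_diff_le)
    ultimately show "l = l'" using nvE[of "l - l'"] by simp
  next
    fix w assume "w \<in> (\<lambda>l. E (l / t ^ n)) ` Lball r"
    then obtain l where l: "w = E (l / t ^ n)" "l \<in> L" "nv l \<le> r" by (auto simp: Lball_def)
    then show "w \<in> {w \<in> W n. nv (t ^ n * w) \<le> r}"
      using nvE[of l] Phi_E_div[of l n n] by (simp add: W_def nv_mult nv_power mem_L_iff)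
  next
    fix w assume w: "w \<in> {w \<in> W n. nv (t ^ n * w) \<le> r}"
    then have "C * nv w < 1" using small[of "t ^ n * w"] by simp
    then obtain x where x: "nv x = nv w" "E x = w" using E_surj_small by blast
    then have "conv x" using \<open>C * nv w < 1\<close> by (intro conv_small) simp
    then have "t ^ n * x \<in> L"
      using E_A[of x "t ^ n"] w x by (simp add: mem_L_iff W_def)
    then have "t ^ n * x \<in> Lball r" using w x by (simp add: Lball_def nv_mult)
    then show "w \<in> (\<lambda>l. E (l / t ^ n)) ` Lball r"
      using x by (intro image_eqI[of _ _ "t ^ n * x"]) auto
  qed
qed

text \<open>Discreteness of the period lattice, deduced from the finiteness of torsion.\<close>

lemma finite_Lball: "finite (Lball r)"
proof -
  obtain n where "C * r < nv t ^ n" using real_arch_pow[OF nv_t] by blast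
  from bij_betw_finite[OF Lball_bij[OF this]] show ?thesis using finite_W[of n] by simp
qed

text \<open>On torsion points h - h^q = - (orb c n) w. If |h| > 1, then h^q dominates and |h| <
  |h|^q \<le> C |w|.\<close>

lemma nv_H_le:
  assumes "c \<in> KK" "w \<in> W n"
  shows "nv (H n c w) \<le> max 1 (C * nv w)"
proof (cases "nv (H n c w) \<le> 1")
  case False
  define h where "h = H n c w"
  have h1: "1 < nv h" using False by (simp add: h_def)
  have "nv h ^ 1 < nv h ^ q" using h1 q_ge_2 by (intro power_strict_increasing) auto
  then have "nv (h - h ^ q) = nv h ^ q"
    using nv_add_eq[of h "- (h ^ q)"] by (simp add: nv_power add.commute)
  moreover have "h - h ^ q = - (orb c n * w)"
    using H_identity[of n c w] assms(2) by (simp add: h_def W_def)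
  ultimately have "nv h ^ q = nv (orb c n) * nv w" by (simp add: nv_mult)
  then have "nv h < C * nv w"
    using \<open>nv h ^ 1 < nv h ^ q\<close> mult_right_mono[OF KK_D[OF assms(1), of n], of "nv w"] by simp
  then show ?thesis by (simp add: h_def)
qed simp

text \<open>Divide \<open>torsion_sum\<close> by t^n. The torsion points near 0 come from periods by
  \<open>Lball_bij\<close>; each far one contributes at most the larger of 1/r and C / |t|^n, which
  is 1/r for large n, by \<open>nv_H_le\<close>. Then let n tend to infinity.\<close>

lemma partial_sum_estimate:
  assumes c: "c \<in> KK" and r: "0 < r"
  shows "nv (c + (\<Sum>l\<in>Lball r - {0}. inverse l * alpha c l)) \<le> 1 / r"
proof -
  define T where "T n = c - orb c n / t ^ n
      + (\<Sum>l\<in>Lball r - {0}. inverse (t ^ n * E (l / t ^ n)) * psum c l n)" for n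
  have bound: "nv (T n) \<le> 1 / r" if n: "C * r < nv t ^ n" for n
  proof -
    define near where "near = {w \<in> W n. nv (t ^ n * w) \<le> r}"
    define f where "f w = inverse (t ^ n * w) * H n c w" for w
    have bij: "bij_betw (\<lambda>l. E (l / t ^ n)) (Lball r - {0}) (near - {0})"
    proof -
      have inj: "inj_on (\<lambda>l. E (l / t ^ n)) (Lball r)" and im: "(\<lambda>l. E (l / t ^ n)) ` Lball r = near"
        using Lball_bij[OF n] unfolding near_def bij_betw_def by auto
      have "(\<lambda>l. E (l / t ^ n)) ` (Lball r - {0}) = near - (\<lambda>l. E (l / t ^ n)) ` {0}"
        unfolding im[symmetric] by (rule inj_on_image_set_diff[OF inj]) (use r in \<open>auto simp: Lball_def\<close>)
      then show ?thesis
        unfolding bij_betw_def using inj_on_subset[OF inj, of "Lball r - {0}"] by simp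
    qed
    have "c - orb c n / t ^ n = (c * t ^ n - orb c n) / t ^ n" by (simp add: field_simps)
    also have "\<dots> = - (\<Sum>w\<in>W n - {0}. f w)"
      by (simp add: torsion_sum f_def sum_divide_distrib field_simps)
    also have "(\<Sum>w\<in>W n - {0}. f w) = (\<Sum>w\<in>near - {0}. f w) + (\<Sum>w\<in>W n - near. f w)"
    proof -
      have eq: "W n - {0} = (near - {0}) \<union> (W n - near)" using r by (auto simp: near_def)
      show ?thesis
        unfolding eq by (rule sum.union_disjoint) (use finite_W[of n] in \<open>auto simp: near_def\<close>)
    qed
    also have "(\<Sum>w\<in>near - {0}. f w) = (\<Sum>l\<in>Lball r - {0}. inverse (t ^ n * E (l / t ^ n)) * psum c l n)"
      unfolding sum.reindex_bij_betw[OF bij, symmetric]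
      by (rule sum.cong) (auto simp: f_def H_E Lball_def)
    finally have "T n = - (\<Sum>w\<in>W n - near. f w)" by (simp add: T_def)
    moreover have "nv (\<Sum>w\<in>W n - near. f w) \<le> 1 / r"
    proof (rule nv_sum_le)
      fix w assume w: "w \<in> W n - near"
      then have wr: "r < nv t ^ n * nv w" by (auto simp: near_def nv_mult nv_power)
      have w0: "w \<noteq> 0" using wr r by auto
      have "nv (f w) = nv (H n c w) / (nv t ^ n * nv w)"
        by (simp add: f_def nv_mult nv_power nv_inverse divide_inverse mult.commute)
      also have "\<dots> \<le> max 1 (C * nv w) / (nv t ^ n * nv w)"
        using nv_H_le[OF c] w by (intro divide_right_mono) auto
      also have "\<dots> \<le> 1 / r"
      proof (cases "C * nv w \<le> 1")
        case True
        then show ?thesis using wr r by (simp add: frac_le)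
      next
        case False
        have "C * nv w / (nv t ^ n * nv w) = C / nv t ^ n" using w0 by simp
        also have "\<dots> \<le> 1 / r" using n r nv_t_pow_ge_1[of n] by (simp add: field_simps)
        finally show ?thesis using False by simp
      qed
      finally show "nv (f w) \<le> 1 / r" .
    qed (use r in simp)
    ultimately show ?thesis by simp
  qed
  have "(\<lambda>n. orb c n / t ^ n) \<longlonglongrightarrow> 0"
  proof (rule nv_tendsto_0_iff[THEN iffD1], rule tendsto_sandwich[OF _ _ tendsto_const nv_div_t_tendsto[of C]])
    show "\<forall>\<^sub>F n in sequentially. nv (orb c n / t ^ n) \<le> C / nv t ^ n"
      using KK_D[OF c] by (simp add: nv_divide nv_power divide_right_mono)
  qed simp
  moreover have "(\<lambda>n. inverse (t ^ n * E (l / t ^ n)) * psum c l n) \<longlonglongrightarrow> inverse l * alpha c l"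
    if "l \<in> Lball r - {0}" for l
    using that by (intro tendsto_mult psum_lim[OF c] tendsto_inverse_nonarch scaled_E_tendsto) simp
  ultimately have lim: "T \<longlonglongrightarrow> c - 0 + (\<Sum>l\<in>Lball r - {0}. inverse l * alpha c l)"
    unfolding T_def by (intro tendsto_add tendsto_diff tendsto_const tendsto_sum)
  have "\<forall>\<^sub>F n in sequentially. nv (T n) \<le> 1 / r"
    by (rule eventually_mono[OF eventually_nv_t_pow bound])
  from tendsto_nv_le[OF lim this] show ?thesis by simp
qed

section \<open>The sum S and its inverse\<close>

definition S :: "('c \<Rightarrow> 'c) \<Rightarrow> 'c" where
  "S a = - (\<Sum>\<^sub>\<infinity>l\<in>L - {0}. inverse l * a l)"

lemma inverse_null_family: "null_family (L - {0}) inverse"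
  unfolding null_family_def
proof (intro allI impI)
  fix e :: real assume e: "e > 0"
  have "{l \<in> L - {0}. e \<le> nv (inverse l)} \<subseteq> Lball (1 / e)"
  proof
    fix l assume "l \<in> {l \<in> L - {0}. e \<le> nv (inverse l)}"
    then have "l \<in> L" "0 < nv l" "e \<le> inverse (nv l)" by (simp_all add: nv_inverse)
    then show "l \<in> Lball (1 / e)" using e by (simp add: Lball_def field_simps)
  qed
  then show "finite {l \<in> L - {0}. e \<le> nv (inverse l)}" using finite_Lball finite_subset by blast
qed

lemma S_null_family:
  assumes "a ` L \<subseteq> Fq"
  shows "null_family (L - {0}) (\<lambda>l. inverse l * a l)"
proof (rule null_family_le[OF inverse_null_family])
  fix l assume "l \<in> L - {0}"
  then have "nv (a l) \<le> 1" using assms by (intro nv_Fq_le) auto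
  then show "nv (inverse l * a l) \<le> nv (inverse l)" by (simp add: nv_mult mult_left_le)
qed

lemma nv_inverse_term_le:
  assumes "a ` L \<subseteq> Fq" "l \<in> L - {0} - (Lball r - {0})" "0 < r"
  shows "nv (inverse l * a l) \<le> 1 / r"
proof -
  have l: "l \<in> L" "r < nv l" using assms(2) by (auto simp: Lball_def)
  have "nv (a l) \<le> 1" using assms(1) l by (intro nv_Fq_le) auto
  then have "nv (a l) / nv l \<le> 1 / r" using l assms(3) by (intro frac_le) auto
  then show ?thesis by (simp add: nv_mult nv_inverse divide_inverse mult.commute)
qed

lemma S_estimate:
  assumes "a ` L \<subseteq> Fq" "0 < r"
  shows "nv (S a + (\<Sum>l\<in>Lball r - {0}. inverse l * a l)) \<le> 1 / r"
proof -
  have "nv (infsum (\<lambda>l. inverse l * a l) (L - {0}) - (\<Sum>l\<in>Lball r - {0}. inverse l * a l)) \<le> 1 / r"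
    using assms finite_Lball
    by (intro nv_infsum_diff_le S_null_family nv_inverse_term_le) (auto simp: Lball_def)
  then show ?thesis unfolding S_def by (subst nv_minus[symmetric]) simp
qed

lemma alpha_range: "c \<in> KK \<Longrightarrow> alpha c ` L \<subseteq> Fq"
  using alpha_in_Fq by blast

lemma nv_zero_if_le_all:
  assumes "\<And>r. 0 < r \<Longrightarrow> nv (x :: 'c) \<le> 1 / r"
  shows "x = 0"
proof (rule ccontr)
  assume "x \<noteq> 0"
  then show False using assms[of "2 / nv x"] by simp
qed

text \<open>Both sides are approximated within 1/r by the same finite sum over
  \<open>Lball r\<close>.\<close>

lemma S_alpha:
  assumes "c \<in> KK"
  shows "S (alpha c) = c"
proof -
  have "nv (c - S (alpha c)) \<le> 1 / r" if "0 < r" for r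
    using nv_diff_le[OF partial_sum_estimate[OF assms that] S_estimate[OF alpha_range[OF assms] that]]
    by simp
  from nv_zero_if_le_all[OF this] show ?thesis by simp
qed

lemma S_close:
  assumes "a ` L \<subseteq> Fq" "b ` L \<subseteq> Fq" "0 < r" "\<And>l. l \<in> Lball r \<Longrightarrow> a l = b l"
  shows "nv (S a - S b) \<le> 1 / r"
proof -
  have "(\<Sum>l\<in>Lball r - {0}. inverse l * a l) = (\<Sum>l\<in>Lball r - {0}. inverse l * b l)"
    using assms(4) by (intro sum.cong) auto
  then show ?thesis
    using nv_diff_le[OF S_estimate[OF assms(1,3)] S_estimate[OF assms(2,3)]] by simp
qed

text \<open>
  Transport \<open>a\<close> to the torsion points \<open>W n\<close> of \<open>\<phi>\<close>, interpolate it there by an additive polynomial \<open>g\<close>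
  and read \<open>c\<close> off the identity \<open>g - g^q = c \<phi>\<^bsub>t^n\<^esub>\<close>; this \<open>c\<close> is a torsion point of \<open>\<phi>\<^sup>*\<close>.
\<close>

lemma torsion_interpolation:
  assumes a: "Fq_linear_on L a" "a ` L \<subseteq> Fq"
  shows "\<exists>c\<in>KK. \<forall>l\<in>Lball r. alpha c l = a l"
proof -
  obtain n where n: "C * r < nv t ^ n" using real_arch_pow[OF nv_t] by blast
  show ?thesis
  proof (cases "0 \<le> r")
    case r: True
    \<comment> \<open>For r \<ge> 0 the ball is an \<open>Fq\<close>-subspace, which
      \<open>f\<close> embeds \<open>Fq\<close>-linearly into \<open>W n\<close>.\<close>
    define f where "f l = E (l / t ^ n)" for l
    define W' where "W' = f ` Lball r"
    define b where "b w = a (inv_into (Lball r) f w)" for w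
    have inj: "inj_on f (Lball r)" and W': "W' \<subseteq> W n"
      using Lball_bij[OF n] unfolding f_def[symmetric] W'_def bij_betw_def by auto
    have bf: "b (f l) = a l" if "l \<in> Lball r" for l
      using that inj by (simp add: b_def)
    have ball: "0 \<in> Lball r" "x \<in> Lball r \<Longrightarrow> y \<in> Lball r \<Longrightarrow> x + y \<in> Lball r"
      "k \<in> Fq \<Longrightarrow> x \<in> Lball r \<Longrightarrow> k * x \<in> Lball r" for x y k
    proof -
      assume k: "k \<in> Fq" "x \<in> Lball r"
      have "nv k * nv x \<le> 1 * nv x" using nv_Fq_le[OF k(1)] by (intro mult_right_mono) auto
      then show "k * x \<in> Lball r" using k by (simp add: Lball_def nv_mult)
    qed (use r in \<open>simp_all add: Lball_def nv_add_le\<close>)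
    have f_add: "f (x + y) = f x + f y" if "x \<in> Lball r" "y \<in> Lball r" for x y
      using E_add[OF conv_L_div conv_L_div, of x y n n] that
      by (simp add: f_def Lball_def add_divide_distrib)
    have f_mult: "f (k * x) = k * f x" if "k \<in> Fq" "x \<in> Lball r" for k x
    proof -
      have "Phi k y = k * y" for y
        using that by (cases "k = 0") (simp_all add: phi_const ev_def skew_const_def)
      then show ?thesis
        using E_A[OF conv_L_div, of x k n] that by (simp add: f_def Lball_def)
    qed
    have subW': "Fq_subspace W'"
      unfolding Fq_subspace_def W'_def
    proof (intro conjI ballI)
      show "0 \<in> f ` Lball r" by (rule image_eqI[of _ _ 0]) (simp_all add: f_def ball)
    next
      fix x y assume "x \<in> f ` Lball r" "y \<in> f ` Lball r"
      then show "x + y \<in> f ` Lball r" using ball(2) by (auto simp flip: f_add)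
    next
      fix k x assume "k \<in> Fq" "x \<in> f ` Lball r"
      then show "k * x \<in> f ` Lball r" using ball(3) by (auto simp flip: f_mult)
    qed
    have linb: "Fq_linear_on W' b"
    proof -
      have "a (x + y) = a x + a y" "k \<in> Fq \<Longrightarrow> a (k * x) = k * a x"
        if "x \<in> Lball r" "y \<in> Lball r" for x y k
        using a(1) that by (auto simp: Fq_linear_on_def Lball_def)
      then show ?thesis
        unfolding Fq_linear_on_def W'_def
        by (auto simp: bf ball simp flip: f_add f_mult)
    qed
    have imb: "b ` W' \<subseteq> Fq"
      using a(2) by (auto simp: W'_def bf Lball_def)
    from exists_interpolant[OF finite_W W_subspace W' subW' linb imb]
    obtain g where "q * degree g \<le> card (W n) \<and> poly g 0 = 0 \<and>
      poly g ` W n \<subseteq> Fq \<and> (\<forall>w\<in>W'. poly g w = b w)" ..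
    then have g: "q * degree g \<le> card (W n)" "poly g 0 = 0"
      "poly g ` W n \<subseteq> Fq" "\<And>w. w \<in> W' \<Longrightarrow> poly g w = b w" by simp_all
    have "\<exists>k. \<forall>y. poly g y - poly g y ^ q = k * poly (evpoly (\<phi> (t ^ n))) y"
    proof (rule frobenius_defect_multiple)
      show "W n \<noteq> {}" using zero_in_W by blast
      show "poly (evpoly (\<phi> (t ^ n))) w = 0" if "w \<in> W n" for w
        using that by (simp add: W_def)
    qed (rule card_W[symmetric] finite_W g)+
    then obtain k where k: "\<And>y. poly g y - poly g y ^ q = k * Phi (t ^ n) y" by auto
    \<comment> \<open>\<open>H n k\<close> and g solve the same equation up to the remainder (orb k
      n) y, so uniqueness gives both orb k n = 0 and H n k = g.\<close>
    have D: "H n k y - poly g y - (H n k y - poly g y) ^ q = (- orb k n) * y" for y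
    proof -
      have "(H n k y - poly g y) ^ q = H n k y ^ q - poly g y ^ q"
        using frob_diff[of "H n k y" "poly g y" 1] by simp
      then have "H n k y - poly g y - (H n k y - poly g y) ^ q
          = (H n k y - H n k y ^ q) - (poly g y - poly g y ^ q)" by simp
      then show ?thesis by (simp add: H_identity k)
    qed
    have pf: "polyfun (\<lambda>y. H n k y - poly g y)"
      by (intro polyfun_diff polyfun_H) (auto simp: polyfun_def)
    have "- orb k n = 0" and Hg: "H n k y - poly g y = 0" for y
      using frobenius_equation_trivial[OF pf _ D] g(2) by simp_all
    then have tors: "orb k j = 0" if "n \<le> j" for j
      using orb_shift[of k n "j - n"] that by simp
    have "k \<in> KK"
    proof (rule bounded_orbit_KK)
      fix j
      show "nv (orb k j) \<le> (\<Sum>i<n. nv (orb k i))"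
      proof (cases "n \<le> j")
        case False
        then show ?thesis by (intro member_le_sum) auto
      qed (simp add: tors sum_nonneg)
    qed
    moreover have "alpha k l = a l" if l: "l \<in> Lball r" for l
    proof -
      have lL: "l \<in> L" using l by (simp add: Lball_def)
      \<comment> \<open>The orbit of k is zero from n on, so the sequence defining
        \<open>alpha k l\<close> is stationary.\<close>
      have "psum k l m = psum k l n" if "n \<le> m" for m
        unfolding psum_def by (rule sum.mono_neutral_right) (use that in \<open>auto simp: tors\<close>)
      then have "\<forall>\<^sub>F m in sequentially. psum k l m = psum k l n"
        unfolding eventually_sequentially by blast
      then have "psum k l \<longlonglongrightarrow> psum k l n" by (rule tendsto_eventually)
      then have "alpha k l = psum k l n" by (rule LIMSEQ_unique[OF psum_lim[OF \<open>k \<in> KK\<close>]])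
      also have "\<dots> = H n k (f l)" using H_E[OF lL] by (simp add: f_def)
      also have "\<dots> = poly g (f l)" using Hg[of "f l"] by simp
      also have "\<dots> = a l" using g(4)[of "f l"] l bf by (simp add: W'_def)
      finally show ?thesis .
    qed
    ultimately show ?thesis by blast
  next
    case False
    have "\<not> nv l \<le> r" for l :: 'c using False nv_nonneg[of l] by linarith
    then have "Lball r = {}" by (simp add: Lball_def)
    moreover have "0 \<in> KK" using C_ge_1 by (simp add: KK_def)
    ultimately show ?thesis by blast
  qed
qed

text \<open>Choose c n in \<open>KK\<close> whose functional agrees with a on
  \<open>Lball n\<close>. Then c n = S (alpha (c n)) tends to S a, \<open>KK\<close> is closed, and
  by \<open>alpha_eventually_0\<close> the values alpha (c n) l eventually equal alpha (S a)
  l.\<close>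

lemma S_KK_alpha:
  assumes a: "Fq_linear_on L a" "a ` L \<subseteq> Fq"
  shows "S a \<in> KK" "l \<in> L \<Longrightarrow> alpha (S a) l = a l"
proof -
  have "\<exists>c. \<forall>n. c n \<in> KK \<and> (\<forall>l\<in>Lball (real n). alpha (c n) l = a l)"
    by (rule choice) (use torsion_interpolation[OF a] in blast)
  then obtain c where c: "\<And>n. c n \<in> KK" "\<And>n l. l \<in> Lball (real n) \<Longrightarrow> alpha (c n) l = a l"
    by blast
  have "nv (c n - S a) \<le> 1 / n" if "0 < n" for n
    using S_close[OF alpha_range[OF c(1)] a(2), of "real n" n] c that by (simp add: S_alpha)
  then have "\<forall>\<^sub>F n in sequentially. nv (c n - S a) \<le> 1 / n"
    by (auto simp: eventually_sequentially intro!: exI[of _ 1])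
  then have lim: "(\<lambda>n. c n - S a) \<longlonglongrightarrow> 0"
    by (intro nv_tendsto_0_iff[THEN iffD1] tendsto_sandwich[OF _ _ tendsto_const lim_1_over_n]) auto
  show SK: "S a \<in> KK"
    unfolding KK_def
  proof (rule CollectI, rule allI)
    fix j
    have "(\<lambda>n. orb (c n - S a) j) \<longlonglongrightarrow> 0"
      by (rule filterlim_compose[OF orb_tendsto_0 lim])
    from tendsto_diff[OF tendsto_const[of "orb (S a) j"] tendsto_minus[OF this]]
    have "(\<lambda>n. orb (c n) j) \<longlonglongrightarrow> orb (S a) j" by (simp add: orb_diff)
    then show "nv (orb (S a) j) \<le> C"
      by (rule tendsto_nv_le) (use KK_D[OF c(1)] in auto)
  qed
  assume l: "l \<in> L"
  have "\<forall>\<^sub>F n in sequentially. c n - S a \<in> KK \<longrightarrow> alpha (c n - S a) l = 0"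
    by (rule eventually_compose_filterlim[OF alpha_eventually_0[OF l] lim])
  moreover have "\<forall>\<^sub>F n in sequentially. nv l \<le> real n"
  proof -
    obtain N :: nat where "nv l \<le> real N" using real_arch_simple by blast
    then show ?thesis by (intro eventually_sequentiallyI[of N]) linarith
  qed
  ultimately have "\<forall>\<^sub>F n in sequentially. alpha (S a) l = a l"
  proof eventually_elim
    case (elim n)
    then have "alpha (c n) l = alpha (S a) l"
      using alpha_diff[OF c(1) SK] KK_diff[OF c(1) SK] by simp
    then show ?case using c(2)[of l n] l elim by (simp add: Lball_def)
  qed
  then show "alpha (S a) l = a l" by simp
qed

text \<open>\<open>alpha\<close> turns \<phi>_x^* into precomposition with x, and \<open>S\<close>
  inverts \<open>alpha\<close>.\<close>

lemma S_adj:
  assumes a: "Fq_linear_on L a" "a ` L \<subseteq> Fq" and x: "x \<in> A"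
  shows "adj x (S a) = S (\<lambda>l. a (x * l))"
proof -
  have "S (\<lambda>l. a (x * l)) = S (alpha (adj x (S a)))"
    unfolding S_def[of "\<lambda>l. a (x * l)"] S_def[of "alpha (adj x (S a))"]
    by (intro arg_cong[of _ _ uminus] infsum_cong)
      (simp add: alpha_adj[OF S_KK_alpha(1)[OF a] x] S_KK_alpha(2)[OF a] x)
  also have "\<dots> = adj x (S a)"
    by (rule S_alpha[OF adj_KK[OF S_KK_alpha(1)[OF a] x]])
  finally show ?thesis by simp
qed

section \<open>Coordinates and completed tensor products\<close>

abbreviation R :: "'c ring" where "R \<equiv> coord_ring Fq K Oinf"

lemma R_simps [simp]:
  "carrier R = A" "\<zero>\<^bsub>R\<^esub> = 0" "\<one>\<^bsub>R\<^esub> = 1" "x \<oplus>\<^bsub>R\<^esub> y = x + y" "x \<otimes>\<^bsub>R\<^esub> y = x * y"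
  by (simp_all add: coord_ring_def ring_of_type_algebra_def)

lemma cring_R: "cring R"
proof (rule cringI)
  show "abelian_group R"
    by (rule abelian_groupI) (auto simp: add_ac intro!: bexI[of _ "- _"])
  show "comm_monoid R"
    by (rule comm_monoidI) (auto simp: mult_ac)
qed (simp add: distrib_right)

text \<open>Linearity over \<open>Fq\<close> only, which is what coordinates in an
  \<open>Fq\<close>-basis satisfy.\<close>

definition Fq_functional :: "('c, 'm) module \<Rightarrow> ('m \<Rightarrow> 'c) \<Rightarrow> bool" where
  "Fq_functional M g \<longleftrightarrow>
     (\<forall>x\<in>carrier M. \<forall>y\<in>carrier M. g (x \<oplus>\<^bsub>M\<^esub> y) = g x + g y) \<and>
     (\<forall>c\<in>Fq. \<forall>x\<in>carrier M. g (c \<odot>\<^bsub>M\<^esub> x) = c * g x)"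

definition Fq_hom :: "('c, 'm) module \<Rightarrow> ('c, 'n) module \<Rightarrow> ('m \<Rightarrow> 'n) \<Rightarrow> bool" where
  "Fq_hom M N f \<longleftrightarrow> f ` carrier M \<subseteq> carrier N \<and>
     (\<forall>x\<in>carrier M. \<forall>y\<in>carrier M. f (x \<oplus>\<^bsub>M\<^esub> y) = f x \<oplus>\<^bsub>N\<^esub> f y) \<and>
     (\<forall>c\<in>Fq. \<forall>x\<in>carrier M. f (c \<odot>\<^bsub>M\<^esub> x) = c \<odot>\<^bsub>N\<^esub> f x)"

lemma Fq_functional_compose: "Fq_hom M N f \<Longrightarrow> Fq_functional N g \<Longrightarrow> Fq_functional M (\<lambda>x. g (f x))"
  unfolding Fq_hom_def Fq_functional_def by (simp add: image_subset_iff)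

lemma Fq_hom_compose: "Fq_hom M N f \<Longrightarrow> Fq_hom N P g \<Longrightarrow> Fq_hom M P (\<lambda>x. g (f x))"
  unfolding Fq_hom_def by (auto simp: image_subset_iff)

lemma Fq_hom_mod_hom: "f \<in> mod_hom R M N \<Longrightarrow> Fq_hom M N f"
  unfolding Fq_hom_def mod_hom_def by (auto simp: PiE_iff)

end

section \<open>Coordinates in a module with a basis\<close>

locale based_module = drinfeld Fq K Oinf \<phi> + module "coord_ring Fq K Oinf" M
  for Fq K Oinf :: "'c::complete_alg_closed_nonarch_field set" and \<phi> and M :: "('c, 'm) module" +
  fixes B :: "'m set"
  assumes basis: "is_basis Fq M B"
begin

abbreviation co :: "'m \<Rightarrow> 'm \<Rightarrow> 'c" where "co \<equiv> coord Fq M B"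

lemma B_carrier: "b \<in> B \<Longrightarrow> b \<in> carrier M"
  using basis by (auto simp: is_basis_def)

lemma co_is_coord: "m \<in> carrier M \<Longrightarrow> is_coord Fq M B m (co m)"
  unfolding coord_def by (rule theI'[of "is_coord Fq M B m"]) (use basis in \<open>simp add: is_basis_def\<close>)

lemma co_eqI: "m \<in> carrier M \<Longrightarrow> is_coord Fq M B m \<alpha> \<Longrightarrow> co m = \<alpha>"
  using basis co_is_coord unfolding is_basis_def by blast

lemma co_Fq [simp]: "m \<in> carrier M \<Longrightarrow> co m b \<in> Fq"
  and co_outside: "m \<in> carrier M \<Longrightarrow> b \<notin> B \<Longrightarrow> co m b = 0"
  and co_finite: "m \<in> carrier M \<Longrightarrow> finite {b. co m b \<noteq> 0}"
  using co_is_coord[of m] by (auto simp: is_coord_def)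

lemma smult_zero [simp]: "x \<in> carrier M \<Longrightarrow> 0 \<odot>\<^bsub>M\<^esub> x = \<zero>\<^bsub>M\<^esub>"
  using smult_l_null[of x] by simp

lemma finsum_support:
  assumes "finite T" "T \<subseteq> B" "{b. \<alpha> b \<noteq> 0} \<subseteq> T" "range \<alpha> \<subseteq> Fq"
  shows "finsum M (\<lambda>b. \<alpha> b \<odot>\<^bsub>M\<^esub> b) {b. \<alpha> b \<noteq> 0} = finsum M (\<lambda>b. \<alpha> b \<odot>\<^bsub>M\<^esub> b) T"
  by (rule M.add.finprod_mono_neutral_cong_left)
    (use assms B_carrier in \<open>auto simp: subset_iff image_subset_iff\<close>)

lemma co_finsum:
  assumes "finite T" "T \<subseteq> B" "{b. \<alpha> b \<noteq> 0} \<subseteq> T" "range \<alpha> \<subseteq> Fq"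
  shows "co (finsum M (\<lambda>b. \<alpha> b \<odot>\<^bsub>M\<^esub> b) T) = \<alpha>"
proof (rule co_eqI)
  show "finsum M (\<lambda>b. \<alpha> b \<odot>\<^bsub>M\<^esub> b) T \<in> carrier M"
    by (rule M.finsum_closed) (use assms B_carrier in \<open>auto simp: image_subset_iff subset_iff\<close>)
  show "is_coord Fq M B (finsum M (\<lambda>b. \<alpha> b \<odot>\<^bsub>M\<^esub> b) T) \<alpha>"
    unfolding is_coord_def using finsum_support[OF assms] assms finite_subset[OF assms(3)] by auto
qed

lemma co_expand:
  assumes "m \<in> carrier M" "finite T" "T \<subseteq> B" "{b. co m b \<noteq> 0} \<subseteq> T"
  shows "finsum M (\<lambda>b. co m b \<odot>\<^bsub>M\<^esub> b) T = m"
  using finsum_support[of T "co m"] assms co_is_coord[OF assms(1)] by (simp add: is_coord_def)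

lemma co_inject:
  assumes "m \<in> carrier M" "m' \<in> carrier M" "\<And>b. co m b = co m' b"
  shows "m = m'"
proof -
  have eq: "co m = co m'" using assms(3) by blast
  have "{b. co m b \<noteq> 0} \<subseteq> B" using co_outside[OF assms(1)] by auto
  then show ?thesis
    using co_expand[OF assms(1) co_finite[OF assms(1)]] co_expand[OF assms(2) co_finite[OF assms(1)]]
    unfolding eq by simp
qed

lemma functional_finsum:
  assumes g: "Fq_functional M g" and T: "finite T" "T \<subseteq> B" and \<alpha>: "range \<alpha> \<subseteq> Fq"
  shows "g (finsum M (\<lambda>b. \<alpha> b \<odot>\<^bsub>M\<^esub> b) T) = (\<Sum>b\<in>T. \<alpha> b * g b)"
  using T
proof (induction T rule: finite_induct)
  case empty
  have "g (\<zero>\<^bsub>M\<^esub> \<oplus>\<^bsub>M\<^esub> \<zero>\<^bsub>M\<^esub>) = g \<zero>\<^bsub>M\<^esub> + g \<zero>\<^bsub>M\<^esub>"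
    using g M.zero_closed unfolding Fq_functional_def by blast
  then have "g \<zero>\<^bsub>M\<^esub> + g \<zero>\<^bsub>M\<^esub> = g \<zero>\<^bsub>M\<^esub> + 0" by simp
  then have "g \<zero>\<^bsub>M\<^esub> = 0" by (simp only: add_left_cancel)
  then show ?case by simp
next
  case (insert b T)
  have b: "b \<in> carrier M" "\<alpha> b \<in> Fq" using insert B_carrier \<alpha> by auto
  have fs: "(\<lambda>b. \<alpha> b \<odot>\<^bsub>M\<^esub> b) \<in> T \<rightarrow> carrier M" using insert B_carrier \<alpha> by (auto simp: image_subset_iff)
  then have "finsum M (\<lambda>b. \<alpha> b \<odot>\<^bsub>M\<^esub> b) (insert b T)
      = \<alpha> b \<odot>\<^bsub>M\<^esub> b \<oplus>\<^bsub>M\<^esub> finsum M (\<lambda>b. \<alpha> b \<odot>\<^bsub>M\<^esub> b) T"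
    using insert b by (intro M.finsum_insert) auto
  moreover have "finsum M (\<lambda>b. \<alpha> b \<odot>\<^bsub>M\<^esub> b) T \<in> carrier M" by (rule M.finsum_closed[OF fs])
  ultimately show ?case using g b insert by (simp add: Fq_functional_def)
qed

lemma functional_expand:
  assumes "Fq_functional M g" "m \<in> carrier M"
  shows "g m = (\<Sum>b | co m b \<noteq> 0. co m b * g b)"
proof -
  have "{b. co m b \<noteq> 0} \<subseteq> B" using co_outside[OF assms(2)] by auto
  then show ?thesis
    using functional_finsum[OF assms(1) co_finite[OF assms(2)], of "co m"]
      co_expand[OF assms(2) co_finite[OF assms(2)]] assms(2) by (auto simp: image_subset_iff)
qed

lemma co_add:
  assumes "x \<in> carrier M" "y \<in> carrier M"
  shows "co (x \<oplus>\<^bsub>M\<^esub> y) b = co x b + co y b"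
proof -
  define T where "T = {b. co x b \<noteq> 0} \<union> {b. co y b \<noteq> 0}"
  have T: "finite T" "T \<subseteq> B"
    using co_finite assms co_outside by (auto simp: T_def)
  have cl: "(\<lambda>b. co z b \<odot>\<^bsub>M\<^esub> b) \<in> T \<rightarrow> carrier M" if "z \<in> carrier M" for z
    using that T B_carrier by auto
  have "x \<oplus>\<^bsub>M\<^esub> y = finsum M (\<lambda>b. co x b \<odot>\<^bsub>M\<^esub> b) T \<oplus>\<^bsub>M\<^esub> finsum M (\<lambda>b. co y b \<odot>\<^bsub>M\<^esub> b) T"
    using co_expand[OF assms(1) T] co_expand[OF assms(2) T] by (auto simp: T_def)
  also have "\<dots> = finsum M (\<lambda>b. co x b \<odot>\<^bsub>M\<^esub> b \<oplus>\<^bsub>M\<^esub> co y b \<odot>\<^bsub>M\<^esub> b) T"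
    by (rule M.finsum_addf[OF cl cl, OF assms, symmetric])
  also have "\<dots> = finsum M (\<lambda>b. (co x b + co y b) \<odot>\<^bsub>M\<^esub> b) T"
  proof (rule M.finsum_cong'[OF refl])
    fix b assume "b \<in> T"
    then show "co x b \<odot>\<^bsub>M\<^esub> b \<oplus>\<^bsub>M\<^esub> co y b \<odot>\<^bsub>M\<^esub> b = (co x b + co y b) \<odot>\<^bsub>M\<^esub> b"
      using smult_l_distr[of "co x b" "co y b" b] assms T B_carrier by auto
  qed (use assms T B_carrier in auto)
  also have "co \<dots> = (\<lambda>b. co x b + co y b)"
    by (rule co_finsum) (use T assms in \<open>auto simp: T_def\<close>)
  finally show ?thesis by simp
qed

lemma co_smult:
  assumes "c \<in> Fq" "x \<in> carrier M"
  shows "co (c \<odot>\<^bsub>M\<^esub> x) b = c * co x b"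
proof -
  define T where "T = {b. co x b \<noteq> 0}"
  have T: "finite T" "T \<subseteq> B"
    using co_finite assms co_outside by (auto simp: T_def)
  have cl: "(\<lambda>b. co x b \<odot>\<^bsub>M\<^esub> b) \<in> T \<rightarrow> carrier M"
    using assms T B_carrier by auto
  have "c \<odot>\<^bsub>M\<^esub> x = c \<odot>\<^bsub>M\<^esub> finsum M (\<lambda>b. co x b \<odot>\<^bsub>M\<^esub> b) T"
    using co_expand[OF assms(2) T] by (auto simp: T_def)
  also have "\<dots> = finsum M (\<lambda>b. c \<odot>\<^bsub>M\<^esub> (co x b \<odot>\<^bsub>M\<^esub> b)) T"
    by (rule finsum_smult_ldistr) (use assms T cl in auto)
  also have "\<dots> = finsum M (\<lambda>b. (c * co x b) \<odot>\<^bsub>M\<^esub> b) T"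
  proof (rule M.finsum_cong'[OF refl])
    fix b assume "b \<in> T"
    then show "c \<odot>\<^bsub>M\<^esub> (co x b \<odot>\<^bsub>M\<^esub> b) = (c * co x b) \<odot>\<^bsub>M\<^esub> b"
      using smult_assoc1[of c "co x b" b] assms T B_carrier by auto
  qed (use assms T B_carrier in auto)
  also have "co \<dots> = (\<lambda>b. c * co x b)"
    by (rule co_finsum) (use T assms in \<open>auto simp: T_def\<close>)
  finally show ?thesis by simp
qed

lemma co_functional: "Fq_functional M (\<lambda>m. co m b)"
  unfolding Fq_functional_def by (simp add: co_add co_smult)

lemma co_basis:
  assumes "b \<in> B"
  shows "co b b' = (if b' = b then 1 else 0)"
proof -
  have "finsum M (\<lambda>b'. (if b' = b then 1 else 0) \<odot>\<^bsub>M\<^esub> b') {b} = b"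
    using M.finsum_insert[of "{}" b "\<lambda>b'. (if b' = b then 1 else 0) \<odot>\<^bsub>M\<^esub> b'"] assms B_carrier smult_one[of b]
    by auto
  moreover have "co (finsum M (\<lambda>b'. (if b' = b then 1 else 0) \<odot>\<^bsub>M\<^esub> b') {b}) = (\<lambda>b'. if b' = b then 1 else 0)"
    by (rule co_finsum) (use assms in auto)
  ultimately show ?thesis by simp
qed

lemma smult_Fq_hom: "a \<in> A \<Longrightarrow> Fq_hom M M (\<lambda>m. a \<odot>\<^bsub>M\<^esub> m)"
  unfolding Fq_hom_def
proof (intro conjI ballI)
  fix c x assume "a \<in> A" "c \<in> Fq" "x \<in> carrier M"
  then show "a \<odot>\<^bsub>M\<^esub> (c \<odot>\<^bsub>M\<^esub> x) = c \<odot>\<^bsub>M\<^esub> (a \<odot>\<^bsub>M\<^esub> x)"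
    using smult_assoc1[of a c x] smult_assoc1[of c a x] by (simp add: mult.commute)
qed (auto simp: smult_r_distr)

section \<open>Convergent sums of tensors\<close>

lemma ctens_iff: "c \<in> ctens B \<longleftrightarrow> (\<forall>b. b \<notin> B \<longrightarrow> c b = 0) \<and> null_family B c"
  for c :: "'m \<Rightarrow> 'c"
  unfolding ctens_def using null_family_iff_cofinite[of B c] by auto

text \<open>The value of the sum of the tensors c i \<otimes> m i, computed in each coordinate; it
  makes the definite description in \<open>ctens_sum\<close> explicit.\<close>

definition tsum :: "'i set \<Rightarrow> ('i \<Rightarrow> 'c) \<Rightarrow> ('i \<Rightarrow> 'm) \<Rightarrow> 'm \<Rightarrow> 'c" where
  "tsum I c m = (\<lambda>b. \<Sum>\<^sub>\<infinity>i\<in>I. c i * co (m i) b)"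

lemma nv_co_le: "x \<in> carrier M \<Longrightarrow> nv (c * co x b) \<le> nv c"
  using nv_Fq_le[OF co_Fq] by (simp add: nv_mult mult_left_le)

lemma tsum_null_family:
  "null_family I c \<Longrightarrow> m ` I \<subseteq> carrier M \<Longrightarrow> null_family I (\<lambda>i. c i * co (m i) b)"
  by (erule null_family_le) (auto intro: nv_co_le)

text \<open>Only finitely many c i are large, and each m i has finitely many nonzero coordinates;
  the remaining coordinates of the sum are at most e/2.\<close>

lemma tsum_ctens:
  assumes "null_family I c" "m ` I \<subseteq> carrier M"
  shows "tsum I c m \<in> ctens B"
  unfolding ctens_iff
proof (intro conjI allI impI)
  fix b assume "b \<notin> B"
  then have "infsum (\<lambda>i. c i * co (m i) b) I = infsum (\<lambda>i. 0) I"
    using assms(2) by (intro infsum_cong) (auto simp: co_outside)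
  then show "tsum I c m b = 0" by (simp add: tsum_def)
next
  show "null_family B (tsum I c m)"
    unfolding null_family_def
  proof (intro allI impI)
    fix e :: real assume e: "e > 0"
    define F where "F = {i\<in>I. nv (c i) \<ge> e / 2}"
    have F: "finite F" unfolding F_def by (rule null_familyD[OF assms(1)]) (use e in simp)
    have "nv (tsum I c m b) < e" if "b \<notin> (\<Union>i\<in>F. {b. co (m i) b \<noteq> 0})" for b
    proof -
      have "nv (tsum I c m b) \<le> e / 2"
        unfolding tsum_def
      proof (rule nv_infsum_le)
        fix i assume i: "i \<in> I"
        show "nv (c i * co (m i) b) \<le> e / 2"
        proof (cases "i \<in> F")
          case True
          then show ?thesis using that e by auto
        next
          case False
          then have "nv (c i) \<le> e / 2" using i by (simp add: F_def)
          then show ?thesis using nv_co_le[of "m i" "c i" b] assms(2) i by (auto intro: order_trans)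
        qed
      qed (use e in simp)
      then show ?thesis using e by simp
    qed
    then have "{b\<in>B. e \<le> nv (tsum I c m b)} \<subseteq> (\<Union>i\<in>F. {b. co (m i) b \<noteq> 0})"
      by (auto simp: not_less[symmetric])
    moreover have "finite (\<Union>i\<in>F. {b. co (m i) b \<noteq> 0})"
      using F assms(2) by (auto simp: F_def intro!: co_finite)
    ultimately show "finite {b\<in>B. e \<le> nv (tsum I c m b)}" by (rule finite_subset)
  qed
qed

lemma tsum_has_sum:
  assumes "null_family I c" "m ` I \<subseteq> carrier M"
  shows "ctens_has_sum B I (\<lambda>i. pure_tensor Fq M B (c i) (m i)) (tsum I c m)"
  unfolding ctens_has_sum_def
proof (intro conjI tsum_ctens[OF assms])
  show "uniform_limit B (\<lambda>F b. \<Sum>i\<in>F. pure_tensor Fq M B (c i) (m i) b) (tsum I c m) (finite_subsets_at_top I)"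
    unfolding uniform_limit_iff
  proof (intro allI impI)
    fix e :: real assume e: "e > 0"
    define F where "F = {i\<in>I. nv (c i) \<ge> e / 2}"
    have F: "finite F" "F \<subseteq> I" unfolding F_def using null_familyD[OF assms(1), of "e / 2"] e by auto
    show "\<forall>\<^sub>F F in finite_subsets_at_top I. \<forall>b\<in>B.
        dist (\<Sum>i\<in>F. pure_tensor Fq M B (c i) (m i) b) (tsum I c m b) < e"
      unfolding eventually_finite_subsets_at_top
    proof (intro exI[of _ F] conjI allI impI ballI F)
      fix G b assume G: "finite G \<and> F \<subseteq> G \<and> G \<subseteq> I"
      have "nv (infsum (\<lambda>i. c i * co (m i) b) I - (\<Sum>i\<in>G. c i * co (m i) b)) \<le> e / 2"
      proof (rule nv_infsum_diff_le)
        show "null_family I (\<lambda>i. c i * co (m i) b)" by (rule tsum_null_family[OF assms])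
        fix i assume i: "i \<in> I - G"
        then have "nv (c i) \<le> e / 2" using G by (auto simp: F_def)
        then show "nv (c i * co (m i) b) \<le> e / 2"
          using nv_co_le[of "m i" "c i" b] assms(2) i by (auto intro: order_trans)
      qed (use G e in auto)
      then show "dist (\<Sum>i\<in>G. pure_tensor Fq M B (c i) (m i) b) (tsum I c m b) < e"
        using e by (simp add: nv_diff tsum_def pure_tensor_def nv_minus_commute)
    qed
  qed
qed

lemma ctens_sum_eqI:
  fixes x :: "'i \<Rightarrow> 'm \<Rightarrow> 'c"
  assumes "ctens_has_sum B I x s"
  shows "ctens_sum B I x = s"
  unfolding ctens_sum_def
proof (rule the_equality)
  show "ctens_has_sum B I x s" by (rule assms)
  fix s' assume s': "ctens_has_sum B I x s'"
  show "s' = s"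
  proof
    fix b
    show "s' b = s b"
    proof (cases "b \<in> B")
      case True
      have "((\<lambda>F. \<Sum>i\<in>F. x i b) \<longlongrightarrow> s' b) (finite_subsets_at_top I)"
        "((\<lambda>F. \<Sum>i\<in>F. x i b) \<longlongrightarrow> s b) (finite_subsets_at_top I)"
        using tendsto_uniform_limitI[OF _ True] assms s' by (auto simp: ctens_has_sum_def)
      then show ?thesis by (rule tendsto_unique[OF finite_subsets_at_top_neq_bot])
    next
      case False
      then show ?thesis using assms s' by (simp add: ctens_has_sum_def ctens_iff)
    qed
  qed
qed

lemma one_tensor_eq_tsum:
  assumes "null_family I c" "f ` I \<subseteq> carrier M"
  shows "one_tensor Fq I M B f c = tsum I c f"
  unfolding one_tensor_def by (rule ctens_sum_eqI[OF tsum_has_sum[OF assms]])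

lemma ctens_eq_tsum:
  assumes "c \<in> ctens B"
  shows "tsum B c (\<lambda>b. b) = c"
proof
  fix b
  show "tsum B c (\<lambda>b. b) b = c b"
  proof (cases "b \<in> B")
    case True
    have "infsum (\<lambda>i. c i * co i b) B = infsum (\<lambda>i. c i * co i b) {b}"
      by (rule infsum_cong_neutral) (use True in \<open>auto simp: co_basis\<close>)
    then show ?thesis by (simp add: tsum_def co_basis True)
  next
    case False
    then show ?thesis
      using assms tsum_ctens[of B c "\<lambda>b. b"] B_carrier by (auto simp: ctens_iff)
  qed
qed

lemma tsum_add:
  assumes "null_family I c" "null_family I d" "m ` I \<subseteq> carrier M"
  shows "tsum I (\<lambda>i. c i + d i) m b = tsum I c m b + tsum I d m b"
  unfolding tsum_def distrib_right
  by (intro infsum_add null_family_summable tsum_null_family assms)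

lemma tsum_add_right:
  assumes "null_family I c" "m ` I \<subseteq> carrier M" "m' ` I \<subseteq> carrier M"
  shows "tsum I c (\<lambda>i. m i \<oplus>\<^bsub>M\<^esub> m' i) b = tsum I c m b + tsum I c m' b"
proof -
  have "tsum I c (\<lambda>i. m i \<oplus>\<^bsub>M\<^esub> m' i) b = infsum (\<lambda>i. c i * co (m i) b + c i * co (m' i) b) I"
    unfolding tsum_def using assms(2,3)
    by (intro infsum_cong) (auto simp: co_add image_subset_iff distrib_left)
  also have "\<dots> = tsum I c m b + tsum I c m' b"
    unfolding tsum_def by (intro infsum_add null_family_summable tsum_null_family assms)
  finally show ?thesis .
qed

lemma tsum_cong: "(\<And>i. i \<in> I \<Longrightarrow> c i = d i) \<Longrightarrow> (\<And>i. i \<in> I \<Longrightarrow> m i = m' i) \<Longrightarrow> tsum I c m = tsum I d m'"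
  unfolding tsum_def by (intro ext infsum_cong) simp

lemma adj_null_family:
  assumes "a \<in> A" "null_family I c"
  shows "null_family I (\<lambda>i. adj a (c i))"
  unfolding null_family_def
proof (intro allI impI)
  fix e :: real assume "e > 0"
  then have "\<forall>\<^sub>F c in nhds 0. dist (adj a c) 0 < e"
    using adjoint_tendsto_0[OF phi_finite[OF assms(1)]] by (simp add: tendsto_iff)
  then obtain d where d: "d > 0" "\<And>c. nv c < d \<Longrightarrow> nv (adj a c) < e"
    unfolding eventually_nhds_metric by (auto simp: nv_def)
  have "{i\<in>I. e \<le> nv (adj a (c i))} \<subseteq> {i\<in>I. d \<le> nv (c i)}"
    using d(2) by (auto simp: not_less[symmetric])
  then show "finite {i\<in>I. e \<le> nv (adj a (c i))}"
    using null_familyD[OF assms(2) d(1)] by (rule finite_subset)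
qed

text \<open>\<phi>_a^* is additive, continuous and \<open>Fq\<close>-linear, and the coordinates of
  m i lie in \<open>Fq\<close>.\<close>

lemma adj_tsum:
  assumes "a \<in> A" "null_family I c" "m ` I \<subseteq> carrier M"
  shows "adj a (tsum I c m b) = tsum I (\<lambda>i. adj a (c i)) m b"
proof -
  have "((\<lambda>i. adj a (c i * co (m i) b)) has_sum adj a (tsum I c m b)) I"
    unfolding tsum_def
    by (rule infsum_additive_nonarch[OF tsum_null_family[OF assms(2,3)] adjoint_add adjoint_0
          isCont_adjoint[OF phi_finite[OF assms(1)]]])
  moreover have "adj a (c i * co (m i) b) = adj a (c i) * co (m i) b" if "i \<in> I" for i
    using adjoint_smult[of "co (m i) b" "\<phi> a" "c i"] assms(3) that by (simp add: mult.commute image_subset_iff)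
  ultimately have "((\<lambda>i. adj a (c i) * co (m i) b) has_sum adj a (tsum I c m b)) I"
    by (simp cong: has_sum_cong)
  then show ?thesis unfolding tsum_def by (rule infsumI[symmetric])
qed

lemma nv_tsum_le:
  assumes "m ` I \<subseteq> carrier M" "\<And>i. i \<in> I \<Longrightarrow> nv (c i) \<le> r" "0 \<le> r"
  shows "nv (tsum I c m b) \<le> r"
  unfolding tsum_def
proof (rule nv_infsum_le)
  fix i assume "i \<in> I"
  then show "nv (c i * co (m i) b) \<le> r"
    using order_trans[OF nv_co_le assms(2)] assms(1) by (simp add: image_subset_iff)
qed (rule assms)

end

section \<open>Functoriality of completed tensor products\<close>

context drinfeld
begin

abbreviation based_mod :: "('c, 'm) module \<Rightarrow> 'm set \<Rightarrow> bool" where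
  "based_mod M B \<equiv> based_module Fq K Oinf \<phi> M B"

text \<open>Evaluates 1 \<otimes> f on any null family, not just on the expansion in the basis;
  functoriality rests on this. A double sum is interchanged, then \<open>functional_expand\<close>
  reassembles f (m i) from the coordinates of m i.\<close>

lemma one_tensor_tsum:
  assumes M: "based_mod M B" and N: "based_mod N B'" and f: "Fq_hom M N f"
    and c: "null_family I c" and m: "m ` I \<subseteq> carrier M"
  shows "one_tensor Fq B N B' f (based_module.tsum Fq M B I c m)
    = based_module.tsum Fq N B' I c (\<lambda>i. f (m i))"
proof -
  interpret M: based_module Fq K Oinf \<phi> M B by (rule M)
  interpret N: based_module Fq K Oinf \<phi> N B' by (rule N)
  have fc: "f x \<in> carrier N" if "x \<in> carrier M" for x using f that by (auto simp: Fq_hom_def)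
  have T: "M.tsum I c m \<in> ctens B" by (rule M.tsum_ctens[OF c m])
  then have nf: "null_family B (M.tsum I c m)" by (simp add: M.ctens_iff)
  have "one_tensor Fq B N B' f (M.tsum I c m) = N.tsum B (M.tsum I c m) f"
    by (rule N.one_tensor_eq_tsum[OF nf]) (use fc M.B_carrier in auto)
  also have "\<dots> = N.tsum I c (\<lambda>i. f (m i))"
  proof
    fix b'
    define u where "u b i = c i * M.co (m i) b * N.co (f b) b'" for b i
    \<comment> \<open>An entry of size at least e forces i into the finite set \<open>F\<close> and
      b into the finite support of m i.\<close>
    have null: "null_family (B \<times> I) (\<lambda>(b, i). u b i)"
      unfolding null_family_def
    proof (intro allI impI)
      fix e :: real assume e: "e > 0"
      define F where "F = {i\<in>I. nv (c i) \<ge> e}"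
      have F: "finite F" unfolding F_def by (rule null_familyD[OF c e])
      have "(b, i) \<in> (\<Union>i\<in>F. {b. M.co (m i) b \<noteq> 0} \<times> {i})"
        if "b \<in> B" "i \<in> I" "e \<le> nv (u b i)" for b i
      proof -
        have mi: "m i \<in> carrier M" using m that by auto
        have "nv (u b i) \<le> nv (c i * M.co (m i) b)"
          unfolding u_def by (rule N.nv_co_le[OF fc[OF M.B_carrier[OF that(1)]]])
        also have "\<dots> \<le> nv (c i)" by (rule M.nv_co_le[OF mi])
        finally have "i \<in> F" using that by (simp add: F_def)
        moreover have "M.co (m i) b \<noteq> 0" using that e by (auto simp: u_def)
        ultimately show ?thesis by blast
      qed
      then have "{x \<in> B \<times> I. e \<le> nv (case x of (b, i) \<Rightarrow> u b i)}
          \<subseteq> (\<Union>i\<in>F. {b. M.co (m i) b \<noteq> 0} \<times> {i})" by auto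
      moreover have "finite (\<Union>i\<in>F. {b. M.co (m i) b \<noteq> 0} \<times> {i})"
        using F m by (auto simp: F_def intro!: M.co_finite)
      ultimately show "finite {x \<in> B \<times> I. e \<le> nv (case x of (b, i) \<Rightarrow> u b i)}"
        by (rule finite_subset)
    qed
    have "N.tsum B (M.tsum I c m) f b' = infsum (\<lambda>b. infsum (u b) I) B"
      unfolding N.tsum_def M.tsum_def u_def
      by (intro infsum_cong infsum_cmult_left[symmetric] null_family_summable M.tsum_null_family[OF c m])
    also have "\<dots> = infsum (\<lambda>i. infsum (\<lambda>b. u b i) B) I"
      by (rule infsum_swap_nonarch[OF null])
    also have "\<dots> = infsum (\<lambda>i. c i * N.co (f (m i)) b') I"
    proof (rule infsum_cong)
      fix i assume "i \<in> I"
      then have mi: "m i \<in> carrier M" using m by auto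
      have "infsum (\<lambda>b. u b i) B = infsum (\<lambda>b. u b i) {b. M.co (m i) b \<noteq> 0}"
        by (rule infsum_cong_neutral) (use M.co_outside[OF mi] in \<open>auto simp: u_def\<close>)
      also have "\<dots> = (\<Sum>b | M.co (m i) b \<noteq> 0. u b i)"
        using M.co_finite[OF mi] by simp
      also have "\<dots> = c i * (\<Sum>b | M.co (m i) b \<noteq> 0. M.co (m i) b * N.co (f b) b')"
        by (simp add: u_def sum_distrib_left mult.assoc)
      also have "(\<Sum>b | M.co (m i) b \<noteq> 0. M.co (m i) b * N.co (f b) b') = N.co (f (m i)) b'"
        by (rule M.functional_expand[OF Fq_functional_compose[OF f N.co_functional] mi, symmetric])
      finally show "infsum (\<lambda>b. u b i) B = c i * N.co (f (m i)) b'" .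
    qed
    finally show "N.tsum B (M.tsum I c m) f b' = N.tsum I c (\<lambda>i. f (m i)) b'"
      by (simp add: N.tsum_def)
  qed
  finally show ?thesis .
qed

lemma one_tensor_ctens:
  assumes M: "based_mod M B" and N: "based_mod N B'" and f: "Fq_hom M N f" and c: "c \<in> ctens B"
  shows "one_tensor Fq B N B' f c = based_module.tsum Fq N B' B c f"
    "one_tensor Fq B N B' f c \<in> ctens B'"
proof -
  interpret M: based_module Fq K Oinf \<phi> M B by (rule M)
  interpret N: based_module Fq K Oinf \<phi> N B' by (rule N)
  have fB: "f ` B \<subseteq> carrier N" using f M.B_carrier by (auto simp: Fq_hom_def)
  have nc: "null_family B c" using c by (simp add: M.ctens_iff)
  show "one_tensor Fq B N B' f c = N.tsum B c f" by (rule N.one_tensor_eq_tsum[OF nc fB])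
  then show "one_tensor Fq B N B' f c \<in> ctens B'" using N.tsum_ctens[OF nc fB] by simp
qed

lemma one_tensor_compose:
  assumes M: "based_mod M B" and N: "based_mod N B'" and P: "based_mod P B''"
    and f: "Fq_hom M N f" and g: "Fq_hom N P g" and c: "c \<in> ctens B"
  shows "one_tensor Fq B' P B'' g (one_tensor Fq B N B' f c) = one_tensor Fq B P B'' (\<lambda>x. g (f x)) c"
proof -
  interpret M: based_module Fq K Oinf \<phi> M B by (rule M)
  have fB: "f ` B \<subseteq> carrier N" using f M.B_carrier by (auto simp: Fq_hom_def)
  have nc: "null_family B c" using c by (simp add: M.ctens_iff)
  show ?thesis
    unfolding one_tensor_ctens(1)[OF M N f c] one_tensor_tsum[OF N P g nc fB]
      one_tensor_ctens(1)[OF M P Fq_hom_compose[OF f g] c] ..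
qed

text \<open>Only values on the basis enter, so \<open>restrict\<close> and \<open>compose\<close>
  can be removed from morphisms.\<close>

lemma one_tensor_cong:
  "(\<And>b. b \<in> B \<Longrightarrow> f b = g b) \<Longrightarrow> one_tensor Fq B N B' f c = one_tensor Fq B N B' g c"
  unfolding one_tensor_def ctens_sum_def ctens_has_sum_def
proof -
  assume fg: "\<And>b. b \<in> B \<Longrightarrow> f b = g b"
  have "uniform_limit B' (\<lambda>F b'. \<Sum>b\<in>F. pure_tensor Fq N B' (c b) (f b) b') s (finite_subsets_at_top B)
      \<longleftrightarrow> uniform_limit B' (\<lambda>F b'. \<Sum>b\<in>F. pure_tensor Fq N B' (c b) (g b) b') s (finite_subsets_at_top B)" for s
    by (intro uniform_limit_cong eventually_finite_subsets_at_top_weakI)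
      (auto intro!: sum.cong simp: fg subset_iff)
  then show "(THE s. s \<in> ctens B' \<and> uniform_limit B' (\<lambda>F b'. \<Sum>b\<in>F. pure_tensor Fq N B' (c b) (f b) b') s
      (finite_subsets_at_top B)) = (THE s. s \<in> ctens B' \<and>
      uniform_limit B' (\<lambda>F b'. \<Sum>b\<in>F. pure_tensor Fq N B' (c b) (g b) b') s (finite_subsets_at_top B))"
    by simp
qed

lemma adj_one_tensor:
  assumes M: "based_mod M B" and N: "based_mod N B'" and f: "Fq_hom M N f" and c: "c \<in> ctens B"
    and a: "a \<in> A"
  shows "(\<lambda>b. adj a (one_tensor Fq B N B' f c b)) = one_tensor Fq B N B' f (\<lambda>b. adj a (c b))"
    "(\<lambda>b. adj a (c b)) \<in> ctens B"
proof -
  interpret M: based_module Fq K Oinf \<phi> M B by (rule M)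
  interpret N: based_module Fq K Oinf \<phi> N B' by (rule N)
  have fB: "f ` B \<subseteq> carrier N" using f M.B_carrier by (auto simp: Fq_hom_def)
  have nc: "null_family B c" using c by (simp add: M.ctens_iff)
  show *: "(\<lambda>b. adj a (c b)) \<in> ctens B"
    using c M.adj_null_family[OF a nc] by (simp add: M.ctens_iff)
  show "(\<lambda>b. adj a (one_tensor Fq B N B' f c b)) = one_tensor Fq B N B' f (\<lambda>b. adj a (c b))"
    unfolding one_tensor_ctens(1)[OF M N f c] one_tensor_ctens(1)[OF M N f *]
    by (rule ext, rule N.adj_tsum[OF a nc fB])
qed

lemma Sf_iff:
  "\<zeta> \<in> Sf Fq A \<phi> M B \<longleftrightarrow> \<zeta> \<in> ctens B \<and>
     (\<forall>a\<in>A. (\<lambda>b. adj a (\<zeta> b)) = one_tensor Fq B M B (\<lambda>m. a \<odot>\<^bsub>M\<^esub> m) \<zeta>)"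
  by (simp add: Sf_def)

text \<open>1 \<otimes> f commutes with \<phi>_a^* \<otimes> 1 because f is
  \<open>Fq\<close>-linear, and with 1 \<otimes> a because f is compatible with the
  A-action.\<close>

lemma Sf_one_tensor:
  assumes M: "based_mod M B" and N: "based_mod N B'" and f: "Fq_hom M N f"
    and fa: "\<And>a m. a \<in> A \<Longrightarrow> m \<in> carrier M \<Longrightarrow> f (a \<odot>\<^bsub>M\<^esub> m) = a \<odot>\<^bsub>N\<^esub> f m"
    and \<zeta>: "\<zeta> \<in> Sf Fq A \<phi> M B"
  shows "one_tensor Fq B N B' f \<zeta> \<in> Sf Fq A \<phi> N B'"
proof -
  interpret M: based_module Fq K Oinf \<phi> M B by (rule M)
  interpret N: based_module Fq K Oinf \<phi> N B' by (rule N)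
  have c: "\<zeta> \<in> ctens B" using \<zeta> by (simp add: Sf_iff)
  have "(\<lambda>b. adj a (one_tensor Fq B N B' f \<zeta> b))
      = one_tensor Fq B' N B' (\<lambda>m. a \<odot>\<^bsub>N\<^esub> m) (one_tensor Fq B N B' f \<zeta>)" if a: "a \<in> A" for a
  proof -
    have "(\<lambda>b. adj a (one_tensor Fq B N B' f \<zeta> b)) = one_tensor Fq B N B' f (\<lambda>b. adj a (\<zeta> b))"
      by (rule adj_one_tensor(1)[OF M N f c a])
    also have "(\<lambda>b. adj a (\<zeta> b)) = one_tensor Fq B M B (\<lambda>m. a \<odot>\<^bsub>M\<^esub> m) \<zeta>"
      using \<zeta> a by (simp add: Sf_iff)
    also have "one_tensor Fq B N B' f \<dots> = one_tensor Fq B N B' (\<lambda>m. f (a \<odot>\<^bsub>M\<^esub> m)) \<zeta>"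
      by (rule one_tensor_compose[OF M M N M.smult_Fq_hom[OF a] f c])
    also have "\<dots> = one_tensor Fq B N B' (\<lambda>m. a \<odot>\<^bsub>N\<^esub> f m) \<zeta>"
      by (rule one_tensor_cong) (simp add: fa a M.B_carrier)
    also have "\<dots> = one_tensor Fq B' N B' (\<lambda>m. a \<odot>\<^bsub>N\<^esub> m) (one_tensor Fq B N B' f \<zeta>)"
      by (rule one_tensor_compose[OF M N N f N.smult_Fq_hom[OF a] c, symmetric])
    finally show ?thesis .
  qed
  then show ?thesis using one_tensor_ctens(2)[OF M N f c] by (simp add: Sf_iff)
qed

lemma one_tensor_add:
  assumes M: "based_mod M B" and N: "based_mod N B'" and f: "Fq_hom M N f"
    and c: "c \<in> ctens B" and d: "d \<in> ctens B"
  shows "(\<lambda>b. c b + d b) \<in> ctens B"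
    "one_tensor Fq B N B' f (\<lambda>b. c b + d b) = (\<lambda>b. one_tensor Fq B N B' f c b + one_tensor Fq B N B' f d b)"
proof -
  interpret M: based_module Fq K Oinf \<phi> M B by (rule M)
  interpret N: based_module Fq K Oinf \<phi> N B' by (rule N)
  have fB: "f ` B \<subseteq> carrier N" using f M.B_carrier by (auto simp: Fq_hom_def)
  have n: "null_family B c" "null_family B d" using c d by (simp_all add: M.ctens_iff)
  show *: "(\<lambda>b. c b + d b) \<in> ctens B"
    using c d by (simp add: ctens_def tendsto_add_zero)
  show "one_tensor Fq B N B' f (\<lambda>b. c b + d b) = (\<lambda>b. one_tensor Fq B N B' f c b + one_tensor Fq B N B' f d b)"
    unfolding one_tensor_ctens(1)[OF M N f *] one_tensor_ctens(1)[OF M N f c] one_tensor_ctens(1)[OF M N f d]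
    by (rule ext, rule N.tsum_add[OF n fB])
qed

end

section \<open>The module of dual Anderson eigenvectors\<close>

context based_module
begin

lemma based_self: "based_mod M B"
  by (rule based_module_axioms)

lemma Sf_ctens: "\<zeta> \<in> Sf Fq A \<phi> M B \<Longrightarrow> \<zeta> \<in> ctens B"
  by (simp add: Sf_iff)

abbreviation act :: "'c \<Rightarrow> ('m \<Rightarrow> 'c) \<Rightarrow> 'm \<Rightarrow> 'c" where
  "act a \<equiv> one_tensor Fq B M B (\<lambda>m. a \<odot>\<^bsub>M\<^esub> m)"

lemma act_eq_adj: "\<zeta> \<in> Sf Fq A \<phi> M B \<Longrightarrow> a \<in> A \<Longrightarrow> act a \<zeta> = (\<lambda>b. adj a (\<zeta> b))"
  by (simp add: Sf_iff)

lemma Sf_add: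
  assumes "x \<in> Sf Fq A \<phi> M B" "y \<in> Sf Fq A \<phi> M B"
  shows "(\<lambda>b. x b + y b) \<in> Sf Fq A \<phi> M B"
  unfolding Sf_iff
proof (intro conjI ballI)
  note c = assms[THEN Sf_ctens]
  show "(\<lambda>b. x b + y b) \<in> ctens B"
    using c by (simp add: ctens_def tendsto_add_zero)
  fix a assume a: "a \<in> A"
  show "(\<lambda>b. adj a (x b + y b)) = act a (\<lambda>b. x b + y b)"
    unfolding one_tensor_add(2)[OF based_self based_self smult_Fq_hom[OF a] c]
    by (simp add: act_eq_adj assms a adjoint_add)
qed

text \<open>Since -1 lies in \<open>Fq\<close>, negation is the action of the scalar -1.\<close>

lemma Sf_minus:
  assumes "x \<in> Sf Fq A \<phi> M B"
  shows "(\<lambda>b. - x b) \<in> Sf Fq A \<phi> M B"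
proof -
  have "(\<lambda>b. - x b) = act (- 1) x"
    unfolding act_eq_adj[OF assms A_simps(3)[OF A_simps(1)]]
  proof
    fix b
    have "\<phi> (- 1) = skew_const (- 1)" by (rule phi_const) simp
    moreover have "{i. skew_const (- 1 :: 'c) i \<noteq> 0} = {0}" by (auto simp: skew_const_def)
    ultimately show "- x b = adj (- 1) (x b)"
      by (simp add: adjoint_act_def skew_const_def frob_root_eqI)
  qed
  also have "\<dots> \<in> Sf Fq A \<phi> M B"
  proof (rule Sf_one_tensor[OF based_self based_self smult_Fq_hom _ assms])
    fix a m assume "a \<in> A" "m \<in> carrier M"
    then show "(- 1) \<odot>\<^bsub>M\<^esub> (a \<odot>\<^bsub>M\<^esub> m) = a \<odot>\<^bsub>M\<^esub> ((- 1) \<odot>\<^bsub>M\<^esub> m)"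
      using smult_assoc1[of a "- 1" m] smult_assoc1[of "- 1" a m] by simp
  qed simp
  finally show ?thesis .
qed

lemma Sf_zero: "(\<lambda>b. 0) \<in> Sf Fq A \<phi> M B"
proof -
  have z: "(\<lambda>b. 0 :: 'c) \<in> ctens B" by (simp add: ctens_def)
  show ?thesis
    unfolding Sf_iff
    using z one_tensor_ctens(1)[OF based_self based_self smult_Fq_hom z]
    by (simp add: tsum_def)
qed

lemma Sf_act:
  assumes "x \<in> Sf Fq A \<phi> M B" "a \<in> A"
  shows "act a x \<in> Sf Fq A \<phi> M B"
proof (rule Sf_one_tensor[OF based_self based_self smult_Fq_hom[OF assms(2)] _ assms(1)])
  fix b m assume "b \<in> A" "m \<in> carrier M"
  then show "a \<odot>\<^bsub>M\<^esub> (b \<odot>\<^bsub>M\<^esub> m) = b \<odot>\<^bsub>M\<^esub> (a \<odot>\<^bsub>M\<^esub> m)"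
    using smult_assoc1[of a b m] smult_assoc1[of b a m] assms by (simp add: mult.commute)
qed

lemma Sf_module_simps [simp]:
  "carrier (Sf_module Fq A \<phi> M B) = Sf Fq A \<phi> M B"
  "x \<oplus>\<^bsub>Sf_module Fq A \<phi> M B\<^esub> y = (\<lambda>b. x b + y b)"
  "\<zero>\<^bsub>Sf_module Fq A \<phi> M B\<^esub> = (\<lambda>b. 0)"
  "a \<odot>\<^bsub>Sf_module Fq A \<phi> M B\<^esub> x = act a x"
  by (simp_all add: Sf_module_def mk_module_def)

lemma module_Sf: "module R (Sf_module Fq A \<phi> M B)"
proof (rule moduleI[OF cring_R])
  show "abelian_group (Sf_module Fq A \<phi> M B)"
    by (rule abelian_groupI)
      (auto simp: add_ac Sf_add Sf_zero intro!: bexI[of _ "\<lambda>b. - _ b"] Sf_minus)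
next
  fix a x assume "a \<in> carrier R" "x \<in> carrier (Sf_module Fq A \<phi> M B)"
  then show "a \<odot>\<^bsub>Sf_module Fq A \<phi> M B\<^esub> x \<in> carrier (Sf_module Fq A \<phi> M B)"
    by (simp add: Sf_act)
next
  fix a b x assume *: "a \<in> carrier R" "b \<in> carrier R" "x \<in> carrier (Sf_module Fq A \<phi> M B)"
  then have x: "x \<in> ctens B" "null_family B x" using Sf_ctens by (auto simp: ctens_iff)
  have sm: "(\<lambda>m. a \<odot>\<^bsub>M\<^esub> m) ` B \<subseteq> carrier M" if "a \<in> A" for a using that B_carrier by auto
  have "act (a + b) x = tsum B x (\<lambda>m. (a + b) \<odot>\<^bsub>M\<^esub> m)"
    using * one_tensor_ctens(1)[OF based_self based_self smult_Fq_hom x(1)] by simp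
  also have "\<dots> = tsum B x (\<lambda>m. a \<odot>\<^bsub>M\<^esub> m \<oplus>\<^bsub>M\<^esub> b \<odot>\<^bsub>M\<^esub> m)"
    by (rule tsum_cong) (use * smult_l_distr[of a b] B_carrier in auto)
  also have "\<dots> = (\<lambda>c. tsum B x (\<lambda>m. a \<odot>\<^bsub>M\<^esub> m) c + tsum B x (\<lambda>m. b \<odot>\<^bsub>M\<^esub> m) c)"
    using * by (intro ext tsum_add_right x sm) auto
  also have "\<dots> = (\<lambda>c. act a x c + act b x c)"
    using * one_tensor_ctens(1)[OF based_self based_self smult_Fq_hom x(1)] by simp
  finally show "(a \<oplus>\<^bsub>R\<^esub> b) \<odot>\<^bsub>Sf_module Fq A \<phi> M B\<^esub> x =
      a \<odot>\<^bsub>Sf_module Fq A \<phi> M B\<^esub> x \<oplus>\<^bsub>Sf_module Fq A \<phi> M B\<^esub> b \<odot>\<^bsub>Sf_module Fq A \<phi> M B\<^esub> x"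
    by simp
  have "act a (act b x) = one_tensor Fq B M B (\<lambda>m. a \<odot>\<^bsub>M\<^esub> (b \<odot>\<^bsub>M\<^esub> m)) x"
    using * by (intro one_tensor_compose[OF based_self based_self based_self _ _ x(1)] smult_Fq_hom) auto
  also have "\<dots> = act (a * b) x"
    by (rule one_tensor_cong) (use * smult_assoc1[of a b] B_carrier in auto)
  finally show "(a \<otimes>\<^bsub>R\<^esub> b) \<odot>\<^bsub>Sf_module Fq A \<phi> M B\<^esub> x =
      a \<odot>\<^bsub>Sf_module Fq A \<phi> M B\<^esub> (b \<odot>\<^bsub>Sf_module Fq A \<phi> M B\<^esub> x)"
    by simp
next
  fix a x y assume *: "a \<in> carrier R" "x \<in> carrier (Sf_module Fq A \<phi> M B)" "y \<in> carrier (Sf_module Fq A \<phi> M B)"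
  then show "a \<odot>\<^bsub>Sf_module Fq A \<phi> M B\<^esub> (x \<oplus>\<^bsub>Sf_module Fq A \<phi> M B\<^esub> y) =
      a \<odot>\<^bsub>Sf_module Fq A \<phi> M B\<^esub> x \<oplus>\<^bsub>Sf_module Fq A \<phi> M B\<^esub> a \<odot>\<^bsub>Sf_module Fq A \<phi> M B\<^esub> y"
    using one_tensor_add(2)[OF based_self based_self smult_Fq_hom Sf_ctens Sf_ctens, of a x y] by simp
next
  fix x assume "x \<in> carrier (Sf_module Fq A \<phi> M B)"
  then have x: "x \<in> ctens B" using Sf_ctens by auto
  have "act 1 x = tsum B x (\<lambda>m. 1 \<odot>\<^bsub>M\<^esub> m)"
    by (rule one_tensor_ctens(1)[OF based_self based_self smult_Fq_hom x]) simp
  also have "\<dots> = tsum B x (\<lambda>m. m)"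
    by (rule tsum_cong) (use smult_one B_carrier in auto)
  also have "\<dots> = x" by (rule ctens_eq_tsum[OF x])
  finally show "\<one>\<^bsub>R\<^esub> \<odot>\<^bsub>Sf_module Fq A \<phi> M B\<^esub> x = x" by simp
qed

text \<open>
  As \<open>1 \<otimes> t\<close> does not increase the sup norm, the coefficients of a dual Anderson eigenvector have
  bounded orbits under \<open>\<phi>\<^sub>t\<^sup>*\<close>.
\<close>

lemma Sf_KK:
  assumes "x \<in> Sf Fq A \<phi> M B"
  shows "x b \<in> KK"
proof -
  have fin: "finite {b\<in>B. nv (x b) \<ge> 1}"
    using null_familyD[of B x 1] Sf_ctens[OF assms] by (simp add: ctens_iff)
  \<comment> \<open>A bound for all coefficients: the finitely many that reach 1 are bounded by
    their sum, the others by 1.\<close>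
  define r where "r = 1 + (\<Sum>b | b \<in> B \<and> 1 \<le> nv (x b). nv (x b))"
  have r0: "0 \<le> r" by (auto simp: r_def intro!: add_nonneg_nonneg sum_nonneg)
  have r: "nv (x b) \<le> r" for b
  proof (cases "b \<in> B \<and> 1 \<le> nv (x b)")
    case True
    then have "nv (x b) \<le> (\<Sum>b | b \<in> B \<and> 1 \<le> nv (x b). nv (x b))"
      using fin by (intro member_le_sum) auto
    then show ?thesis by (simp add: r_def)
  next
    case False
    then have "nv (x b) \<le> 1" using Sf_ctens[OF assms] by (cases "b \<in> B") (auto simp: ctens_iff)
    moreover have "1 \<le> r" by (auto simp: r_def intro!: sum_nonneg)
    ultimately show ?thesis by linarith
  qed
  have "(\<lambda>b. orb (x b) j) \<in> Sf Fq A \<phi> M B \<and> (\<forall>b. nv (orb (x b) j) \<le> r)" for j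
  proof (induction j)
    case (Suc j)
    define y where "y b = orb (x b) j" for b
    have y: "y \<in> Sf Fq A \<phi> M B" "\<And>b. nv (y b) \<le> r" using Suc by (simp_all add: y_def[abs_def])
    have eq: "(\<lambda>b. orb (x b) (Suc j)) = act t y"
      using act_eq_adj[OF y(1) t_A] by (simp add: orb_Suc y_def)
    have "act t y = tsum B y (\<lambda>m. t \<odot>\<^bsub>M\<^esub> m)"
      by (rule one_tensor_ctens(1)[OF based_self based_self smult_Fq_hom[OF t_A] Sf_ctens[OF y(1)]])
    moreover have "nv (tsum B y (\<lambda>m. t \<odot>\<^bsub>M\<^esub> m) b) \<le> r" for b
      by (rule nv_tsum_le) (use y B_carrier r0 in auto)
    ultimately have "nv (act t y b) \<le> r" for b by simp
    then have "nv (orb (x b) (Suc j)) \<le> r" for b using fun_cong[OF eq, of b] by simp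
    then show ?case using Sf_act[OF y(1) t_A] eq by simp
  qed (use assms r in simp)
  then show ?thesis by (intro bounded_orbit_KK[of _ r]) blast
qed

end

section \<open>The universal dual Anderson eigenvector\<close>

lemma lattice_module_simps [simp]:
  "carrier (lattice_module L) = L" "\<zero>\<^bsub>lattice_module L\<^esub> = 0"
  "x \<oplus>\<^bsub>lattice_module L\<^esub> y = x + y" "a \<odot>\<^bsub>lattice_module L\<^esub> x = a * x"
  by (simp_all add: lattice_module_def mk_module_def)

lemma Hom_module_simps [simp]:
  "carrier (Hom_module R M N) = mod_hom R M N"
  "f \<oplus>\<^bsub>Hom_module R M N\<^esub> g = (\<lambda>x\<in>carrier M. f x \<oplus>\<^bsub>N\<^esub> g x)"
  "a \<odot>\<^bsub>Hom_module R M N\<^esub> f = (\<lambda>x\<in>carrier M. a \<odot>\<^bsub>N\<^esub> f x)"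
  by (simp_all add: Hom_module_def mk_module_def)

context drinfeld
begin

lemma module_lattice: "module R (lattice_module L)"
proof (rule moduleI[OF cring_R])
  show "abelian_group (lattice_module L)"
    by (rule abelian_groupI) (auto simp: add_ac intro!: bexI[of _ "- _"])
qed (simp_all add: distrib_left distrib_right mult.assoc)

end

locale drinfeld_lattice = drinfeld Fq K Oinf \<phi>
  for Fq K Oinf :: "'c::complete_alg_closed_nonarch_field set" and \<phi> +
  fixes B\<Lambda> :: "'c set"
  assumes lattice_basis: "is_basis Fq (lattice_module (period_lattice (card Fq) (regular_away Fq K Oinf) \<phi>)) B\<Lambda>"
begin

abbreviation \<Lambda> where "\<Lambda> \<equiv> lattice_module L"

abbreviation \<zeta> where "\<zeta> \<equiv> zeta Fq L B\<Lambda>"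

end

sublocale drinfeld_lattice \<subseteq> Lam: based_module Fq K Oinf \<phi> "lattice_module (period_lattice (card Fq) (regular_away Fq K Oinf) \<phi>)" B\<Lambda>
  by (intro based_module.intro based_module_axioms.intro drinfeld_axioms module_lattice lattice_basis)

context drinfeld_lattice
begin

lemma based_lattice: "based_mod \<Lambda> B\<Lambda>"
  by (rule Lam.based_self)

lemma zeta_has_sum:
  "ctens_has_sum B\<Lambda> (L - {0}) (inverse_tensor Fq L B\<Lambda>) (Lam.tsum (L - {0}) inverse (\<lambda>l. l))"
proof -
  have "inverse_tensor Fq L B\<Lambda> = (\<lambda>l. pure_tensor Fq \<Lambda> B\<Lambda> (inverse l) l)"
    by (simp add: inverse_tensor_def fun_eq_iff)
  then show ?thesis using Lam.tsum_has_sum[OF inverse_null_family, of "\<lambda>l. l"] by auto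
qed

lemma uminus_inverse_null_family: "null_family (L - {0}) (\<lambda>l. - inverse l)"
  by (rule null_family_le[OF inverse_null_family]) simp

lemma S_eq: "S a = (\<Sum>\<^sub>\<infinity>l\<in>L - {0}. - inverse l * a l)"
  by (simp add: S_def infsum_uminus)

lemma zeta_eq: "\<zeta> = Lam.tsum (L - {0}) (\<lambda>l. - inverse l) (\<lambda>l. l)"
  unfolding zeta_def Lam.ctens_sum_eqI[OF zeta_has_sum] Lam.tsum_def by (simp add: infsum_uminus)

lemma zeta_ctens: "\<zeta> \<in> ctens B\<Lambda>"
  unfolding zeta_eq by (rule Lam.tsum_ctens[OF uminus_inverse_null_family]) auto

section \<open>The duality in coordinates\<close>

lemma one_tensor_zeta:
  assumes M: "based_mod M B" and f: "Fq_hom \<Lambda> M f"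
  shows "one_tensor Fq B\<Lambda> M B f \<zeta> = (\<lambda>b. S (\<lambda>l. coord Fq M B (f l) b))"
proof -
  interpret M: based_module Fq K Oinf \<phi> M B by (rule M)
  have "one_tensor Fq B\<Lambda> M B f \<zeta> = M.tsum (L - {0}) (\<lambda>l. - inverse l) (\<lambda>l. f l)"
    unfolding zeta_eq by (rule one_tensor_tsum[OF based_lattice M f uminus_inverse_null_family]) auto
  then show ?thesis by (simp add: M.tsum_def S_eq)
qed

lemma coord_linear:
  assumes M: "based_mod M B" and f: "Fq_hom \<Lambda> M f"
  shows "Fq_linear_on L (\<lambda>l. coord Fq M B (f l) b)" "(\<lambda>l. coord Fq M B (f l) b) ` L \<subseteq> Fq"
proof -
  interpret M: based_module Fq K Oinf \<phi> M B by (rule M)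
  show "Fq_linear_on L (\<lambda>l. coord Fq M B (f l) b)"
    using Fq_functional_compose[OF f M.co_functional, of b]
    by (simp add: Fq_functional_def Fq_linear_on_def)
  show "(\<lambda>l. coord Fq M B (f l) b) ` L \<subseteq> Fq"
    using f by (auto simp: Fq_hom_def)
qed

text \<open>The coordinates of \<zeta> are the values of \<open>S\<close> on the coordinate
  functionals of the lattice, so the eigenvector equation is \<open>S_adj\<close>.\<close>

lemma zeta_Sf: "\<zeta> \<in> Sf Fq A \<phi> \<Lambda> B\<Lambda>"
  unfolding Sf_iff
proof (intro conjI ballI zeta_ctens)
  fix a assume a: "a \<in> A"
  have id: "Fq_hom \<Lambda> \<Lambda> (\<lambda>l. l)" by (auto simp: Fq_hom_def)
  have \<zeta>: "\<zeta> b = S (\<lambda>l. Lam.co l b)" for b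
    by (simp add: zeta_eq Lam.tsum_def S_eq)
  have "one_tensor Fq B\<Lambda> \<Lambda> B\<Lambda> (\<lambda>m. a \<odot>\<^bsub>\<Lambda>\<^esub> m) \<zeta> = (\<lambda>b. S (\<lambda>l. Lam.co (a * l) b))"
    using one_tensor_zeta[OF based_lattice Lam.smult_Fq_hom[OF a]] by simp
  then show "(\<lambda>b. adj a (\<zeta> b)) = one_tensor Fq B\<Lambda> \<Lambda> B\<Lambda> (\<lambda>m. a \<odot>\<^bsub>\<Lambda>\<^esub> m) \<zeta>"
    using S_adj[OF coord_linear[OF based_lattice id] a] by (simp add: \<zeta>)
qed

lemma Sf_map_zeta: "Sf_map Fq A \<phi> \<Lambda> B\<Lambda> M B f \<zeta> = one_tensor Fq B\<Lambda> M B f \<zeta>"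
  by (simp add: Sf_map_def zeta_Sf)

text \<open>\<open>alpha\<close> recovers a functional from its sum.\<close>

lemma S_inject:
  assumes "Fq_linear_on L a" "a ` L \<subseteq> Fq" "Fq_linear_on L b" "b ` L \<subseteq> Fq" "S a = S b" "l \<in> L"
  shows "a l = b l"
  using S_KK_alpha(2)[OF assms(1,2,6)] S_KK_alpha(2)[OF assms(3,4,6)] assms(5) by simp

lemma one_tensor_zeta_inject:
  assumes M: "based_mod M B" and f: "Fq_hom \<Lambda> M f" and g: "Fq_hom \<Lambda> M g"
    and eq: "one_tensor Fq B\<Lambda> M B f \<zeta> = one_tensor Fq B\<Lambda> M B g \<zeta>" and l: "l \<in> L"
  shows "f l = g l"
proof -
  interpret M: based_module Fq K Oinf \<phi> M B by (rule M)
  show ?thesis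
  proof (rule M.co_inject)
    show "f l \<in> carrier M" "g l \<in> carrier M" using f g l by (auto simp: Fq_hom_def)
    fix b
    have "S (\<lambda>l. M.co (f l) b) = S (\<lambda>l. M.co (g l) b)"
      using fun_cong[OF eq, of b] by (simp add: one_tensor_zeta M f g)
    then show "M.co (f l) b = M.co (g l) b"
      by (rule S_inject[OF coord_linear[OF M f] coord_linear[OF M g] _ l])
  qed
qed

text \<open>The coordinates of the sought morphism are the functionals alpha (x b). Since x b tends
  to 0 and \<open>alpha\<close> vanishes near 0, only finitely many are nonzero at a given
  l.\<close>

lemma one_tensor_zeta_surj:
  assumes M: "based_mod M B" and x: "x \<in> Sf Fq A \<phi> M B"
  shows "\<exists>f\<in>mod_hom R \<Lambda> M. one_tensor Fq B\<Lambda> M B f \<zeta> = x"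
proof -
  interpret M: based_module Fq K Oinf \<phi> M B by (rule M)
  have KK: "x b \<in> KK" for b by (rule M.Sf_KK[OF x])
  have xB: "x b = 0" if "b \<notin> B" for b using M.Sf_ctens[OF x] that by (simp add: M.ctens_iff)
  have alpha0: "alpha 0 l = 0" for l
  proof -
    have "psum 0 l = (\<lambda>n. 0)" by (simp add: psum_def fun_eq_iff)
    then show ?thesis by (simp add: alpha_def)
  qed
  have fin: "finite {b. alpha (x b) l \<noteq> 0}" "{b. alpha (x b) l \<noteq> 0} \<subseteq> B" if l: "l \<in> L" for l
  proof -
    show sub: "{b. alpha (x b) l \<noteq> 0} \<subseteq> B"
    proof
      fix b assume "b \<in> {b. alpha (x b) l \<noteq> 0}"
      then show "b \<in> B" using xB[of b] alpha0 by (cases "b \<in> B") simp_all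
    qed
    obtain d where d: "d > 0" "\<And>c. nv c < d \<Longrightarrow> c \<in> KK \<Longrightarrow> alpha c l = 0"
      using alpha_eventually_0[OF l] unfolding eventually_nhds_metric by (auto simp: nv_def)
    have "{b. alpha (x b) l \<noteq> 0} \<subseteq> {b\<in>B. d \<le> nv (x b)}"
    proof
      fix b assume b: "b \<in> {b. alpha (x b) l \<noteq> 0}"
      then have "\<not> nv (x b) < d" using d(2)[OF _ KK] by blast
      then show "b \<in> {b\<in>B. d \<le> nv (x b)}" using b sub by auto
    qed
    moreover have "finite {b\<in>B. d \<le> nv (x b)}"
      by (rule null_familyD[OF _ d(1)]) (use M.Sf_ctens[OF x] in \<open>simp add: M.ctens_iff\<close>)
    ultimately show "finite {b. alpha (x b) l \<noteq> 0}" by (rule finite_subset)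
  qed
  have range: "range (\<lambda>b. alpha (x b) l) \<subseteq> Fq" if "l \<in> L" for l
    using alpha_in_Fq[OF KK that] by auto
  define f where "f = (\<lambda>l\<in>L. finsum M (\<lambda>b. alpha (x b) l \<odot>\<^bsub>M\<^esub> b) {b. alpha (x b) l \<noteq> 0})"
  have fc: "f l \<in> carrier M" if "l \<in> L" for l
    using that fin(2)[OF that] range[OF that] M.B_carrier
    by (auto simp: f_def image_subset_iff subset_iff intro!: M.M.finsum_closed)
  have co: "M.co (f l) b = alpha (x b) l" if "l \<in> L" for l b
    using M.co_finsum[OF fin[OF that] order_refl range[OF that]] that by (simp add: f_def)
  have lin: "alpha (x b) (l + l') = alpha (x b) l + alpha (x b) l'"
    "c \<in> Fq \<Longrightarrow> alpha (x b) (c * l) = c * alpha (x b) l" if "l \<in> L" "l' \<in> L" for l l' c b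
    using alpha_linear[OF KK, of b] that by (auto simp: Fq_linear_on_def)
  have f_add: "f (l + l') = f l \<oplus>\<^bsub>M\<^esub> f l'" if "l \<in> L" "l' \<in> L" for l l'
    by (rule M.co_inject) (use that in \<open>simp_all add: fc co lin M.co_add\<close>)
  have f_Fq: "f (c * l) = c \<odot>\<^bsub>M\<^esub> f l" if "c \<in> Fq" "l \<in> L" for c l
    by (rule M.co_inject) (use that in \<open>simp_all add: fc co lin M.co_smult\<close>)
  have f: "Fq_hom \<Lambda> M f"
    unfolding Fq_hom_def using fc f_add f_Fq by auto
  have fx: "one_tensor Fq B\<Lambda> M B f \<zeta> = x"
  proof
    fix b
    have "S (\<lambda>l. M.co (f l) b) = S (alpha (x b))"
      unfolding S_def by (intro arg_cong[of _ _ uminus] infsum_cong) (simp add: co)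
    then show "one_tensor Fq B\<Lambda> M B f \<zeta> b = x b"
      by (simp add: one_tensor_zeta[OF M f] S_alpha KK)
  qed
  \<comment> \<open>The maps taking l to f(a l) and to a f(l) send \<zeta> to the same element,
    \<phi>_a^*(x) = (1 \<otimes> a) x; injectivity for \<open>Fq\<close>-linear maps makes them
    equal.\<close>
  have f_A: "f (a * l) = a \<odot>\<^bsub>M\<^esub> f l" if a: "a \<in> A" and l: "l \<in> L" for a l
  proof (rule one_tensor_zeta_inject[OF M _ _ _ l])
    show 1: "Fq_hom \<Lambda> M (\<lambda>l. f (a * l))"
      using Fq_hom_compose[OF Lam.smult_Fq_hom[OF a] f] by simp
    show 2: "Fq_hom \<Lambda> M (\<lambda>l. a \<odot>\<^bsub>M\<^esub> f l)"
      by (rule Fq_hom_compose[OF f M.smult_Fq_hom[OF a]])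
    have "one_tensor Fq B\<Lambda> M B (\<lambda>l. f (a * l)) \<zeta> = (\<lambda>b. S (\<lambda>l. M.co (f (a * l)) b))"
      by (rule one_tensor_zeta[OF M 1])
    also have "\<dots> = (\<lambda>b. adj a (S (\<lambda>l. M.co (f l) b)))"
      by (simp add: S_adj[OF coord_linear[OF M f] a])
    also have "\<dots> = (\<lambda>b. adj a (x b))"
      using fx[unfolded one_tensor_zeta[OF M f]] by (simp only: fun_eq_iff simp_thms)
    also have "\<dots> = M.act a x"
      using M.act_eq_adj[OF x a] by simp
    also have "\<dots> = one_tensor Fq B\<Lambda> M B (\<lambda>l. a \<odot>\<^bsub>M\<^esub> f l) \<zeta>"
      unfolding fx[symmetric] by (rule one_tensor_compose[OF based_lattice M M f M.smult_Fq_hom[OF a] zeta_ctens])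
    finally show "one_tensor Fq B\<Lambda> M B (\<lambda>l. f (a * l)) \<zeta> = one_tensor Fq B\<Lambda> M B (\<lambda>l. a \<odot>\<^bsub>M\<^esub> f l) \<zeta>" .
  qed
  have "f \<in> mod_hom R \<Lambda> M"
    unfolding mod_hom_def using fc f_add f_A by (auto simp: f_def)
  then show ?thesis using fx by blast
qed

section \<open>Functoriality and the universal property\<close>

lemma mod_hom_Sf_map:
  assumes M: "based_mod M B" and N: "based_mod N B'" and g: "g \<in> mod_hom R M N"
  shows "Sf_map Fq A \<phi> M B N B' g \<in> mod_hom R (Sf_module Fq A \<phi> M B) (Sf_module Fq A \<phi> N B')"
proof -
  interpret M: based_module Fq K Oinf \<phi> M B by (rule M)
  interpret N: based_module Fq K Oinf \<phi> N B' by (rule N)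
  have gh: "Fq_hom M N g" by (rule Fq_hom_mod_hom[OF g])
  have ga: "g (a \<odot>\<^bsub>M\<^esub> m) = a \<odot>\<^bsub>N\<^esub> g m" if "a \<in> A" "m \<in> carrier M" for a m
    using g that by (simp add: mod_hom_def)
  have cl: "one_tensor Fq B N B' g x \<in> Sf Fq A \<phi> N B'" if "x \<in> Sf Fq A \<phi> M B" for x
    by (rule Sf_one_tensor[OF M N gh ga that])
  have "one_tensor Fq B N B' g (M.act a x) = N.act a (one_tensor Fq B N B' g x)"
    if x: "x \<in> Sf Fq A \<phi> M B" and a: "a \<in> A" for a x
  proof -
    have "one_tensor Fq B N B' g (M.act a x) = one_tensor Fq B N B' (\<lambda>m. g (a \<odot>\<^bsub>M\<^esub> m)) x"
      by (rule one_tensor_compose[OF M M N M.smult_Fq_hom[OF a] gh M.Sf_ctens[OF x]])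
    also have "\<dots> = one_tensor Fq B N B' (\<lambda>m. a \<odot>\<^bsub>N\<^esub> g m) x"
      by (rule one_tensor_cong) (simp add: ga a M.B_carrier)
    also have "\<dots> = N.act a (one_tensor Fq B N B' g x)"
      by (rule one_tensor_compose[OF M N N gh N.smult_Fq_hom[OF a] M.Sf_ctens[OF x], symmetric])
    finally show ?thesis .
  qed
  then show ?thesis
    unfolding mod_hom_def Sf_map_def
    using cl one_tensor_add(2)[OF M N gh M.Sf_ctens M.Sf_ctens] by (auto simp: M.Sf_add M.Sf_act)
qed

lemma Sf_map_natural:
  assumes M: "based_mod M B" and N: "based_mod N B'"
    and g: "g \<in> mod_hom R M N" and f: "f \<in> mod_hom R \<Lambda> M"
  shows "Sf_map Fq A \<phi> \<Lambda> B\<Lambda> N B' (compose L g f) \<zeta> = Sf_map Fq A \<phi> M B N B' g (Sf_map Fq A \<phi> \<Lambda> B\<Lambda> M B f \<zeta>)"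
proof -
  have fh: "Fq_hom \<Lambda> M f" and gh: "Fq_hom M N g" using f g by (auto intro: Fq_hom_mod_hom)
  have "one_tensor Fq B\<Lambda> M B f \<zeta> \<in> Sf Fq A \<phi> M B"
    by (rule Sf_one_tensor[OF based_lattice M fh _ zeta_Sf]) (use f in \<open>simp add: mod_hom_def\<close>)
  moreover have "one_tensor Fq B\<Lambda> N B' (compose L g f) \<zeta> = one_tensor Fq B\<Lambda> N B' (\<lambda>l. g (f l)) \<zeta>"
    by (rule one_tensor_cong) (use Lam.B_carrier in \<open>auto simp: compose_def\<close>)
  ultimately show ?thesis
    using one_tensor_compose[OF based_lattice M N fh gh zeta_ctens]
    by (simp add: Sf_map_zeta) (simp add: Sf_map_def)
qed

lemma Hom_iso_Sf:
  assumes M: "based_mod M B"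
  shows "(\<lambda>f \<in> mod_hom R \<Lambda> M. Sf_map Fq A \<phi> \<Lambda> B\<Lambda> M B f \<zeta>)
    \<in> mod_iso R (Hom_module R \<Lambda> M) (Sf_module Fq A \<phi> M B)"
proof -
  interpret M: based_module Fq K Oinf \<phi> M B by (rule M)
  define \<Psi> where "\<Psi> = (\<lambda>f \<in> mod_hom R \<Lambda> M. one_tensor Fq B\<Lambda> M B f \<zeta>)"
  have fh: "Fq_hom \<Lambda> M f" if "f \<in> mod_hom R \<Lambda> M" for f by (rule Fq_hom_mod_hom[OF that])
  have fc: "f l \<in> carrier M" if "f \<in> mod_hom R \<Lambda> M" "l \<in> L" for f l
    using that by (auto simp: mod_hom_def)
  have fadd: "f (l + l') = f l \<oplus>\<^bsub>M\<^esub> f l'" if "f \<in> mod_hom R \<Lambda> M" "l \<in> L" "l' \<in> L" for f l l'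
    using that by (simp add: mod_hom_def)
  have fA: "f (a * l) = a \<odot>\<^bsub>M\<^esub> f l" if "f \<in> mod_hom R \<Lambda> M" "a \<in> A" "l \<in> L" for f a l
    using that by (simp add: mod_hom_def)
  have cl: "\<Psi> f \<in> Sf Fq A \<phi> M B" if "f \<in> mod_hom R \<Lambda> M" for f
    using Sf_one_tensor[OF based_lattice M fh[OF that] _ zeta_Sf] that fA by (simp add: \<Psi>_def)
  have add_hom: "(\<lambda>l\<in>L. f l \<oplus>\<^bsub>M\<^esub> g l) \<in> mod_hom R \<Lambda> M"
    if "f \<in> mod_hom R \<Lambda> M" "g \<in> mod_hom R \<Lambda> M" for f g
  proof -
    have swap: "(u \<oplus>\<^bsub>M\<^esub> v) \<oplus>\<^bsub>M\<^esub> (w \<oplus>\<^bsub>M\<^esub> z) = (u \<oplus>\<^bsub>M\<^esub> w) \<oplus>\<^bsub>M\<^esub> (v \<oplus>\<^bsub>M\<^esub> z)"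
      if "u \<in> carrier M" "v \<in> carrier M" "w \<in> carrier M" "z \<in> carrier M" for u v w z
      using that by (simp add: M.M.a_ac)
    show ?thesis
      unfolding mod_hom_def
      using that by (auto simp: fc fadd fA M.smult_r_distr swap)
  qed
  have smult_hom: "(\<lambda>l\<in>L. a \<odot>\<^bsub>M\<^esub> f l) \<in> mod_hom R \<Lambda> M" if "f \<in> mod_hom R \<Lambda> M" "a \<in> A" for f a
  proof -
    have "a \<odot>\<^bsub>M\<^esub> (b \<odot>\<^bsub>M\<^esub> f l) = b \<odot>\<^bsub>M\<^esub> (a \<odot>\<^bsub>M\<^esub> f l)" if "b \<in> A" "l \<in> L" for b l
      using M.smult_assoc1[of a b "f l"] M.smult_assoc1[of b a "f l"] fc[OF \<open>f \<in> _\<close>] that \<open>a \<in> A\<close>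
      by (simp add: mult.commute)
    then show ?thesis
      unfolding mod_hom_def using that by (auto simp: fc fadd fA M.smult_r_distr)
  qed
  have \<Psi>_add: "\<Psi> (\<lambda>l\<in>L. f l \<oplus>\<^bsub>M\<^esub> g l) = (\<lambda>b. \<Psi> f b + \<Psi> g b)"
    if "f \<in> mod_hom R \<Lambda> M" "g \<in> mod_hom R \<Lambda> M" for f g
  proof
    fix b
    \<comment> \<open>Restriction to \<open>L\<close> unfolds to an \<open>if\<close> whose default
      branch lies outside the range of summation.\<close>
    have "S (\<lambda>l. M.co (if l \<in> L then f l \<oplus>\<^bsub>M\<^esub> g l else undefined) b)
        = M.tsum (L - {0}) (\<lambda>l. - inverse l) (\<lambda>l. f l \<oplus>\<^bsub>M\<^esub> g l) b"
      unfolding S_eq M.tsum_def by (rule infsum_cong) simp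
    also have "\<dots> = M.tsum (L - {0}) (\<lambda>l. - inverse l) f b + M.tsum (L - {0}) (\<lambda>l. - inverse l) g b"
      by (rule M.tsum_add_right[OF uminus_inverse_null_family]) (use that fc in auto)
    finally show "\<Psi> (\<lambda>l\<in>L. f l \<oplus>\<^bsub>M\<^esub> g l) b = \<Psi> f b + \<Psi> g b"
      using one_tensor_zeta[OF M fh] that add_hom[OF that]
      by (simp add: \<Psi>_def S_eq M.tsum_def restrict_def)
  qed
  have \<Psi>_smult: "\<Psi> (\<lambda>l\<in>L. a \<odot>\<^bsub>M\<^esub> f l) = M.act a (\<Psi> f)" if "f \<in> mod_hom R \<Lambda> M" "a \<in> A" for f a
  proof -
    have "one_tensor Fq B\<Lambda> M B (\<lambda>l\<in>L. a \<odot>\<^bsub>M\<^esub> f l) \<zeta> = one_tensor Fq B\<Lambda> M B (\<lambda>l. a \<odot>\<^bsub>M\<^esub> f l) \<zeta>"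
      by (rule one_tensor_cong) (use Lam.B_carrier in auto)
    also have "\<dots> = M.act a (one_tensor Fq B\<Lambda> M B f \<zeta>)"
      by (rule one_tensor_compose[OF based_lattice M M fh[OF that(1)] M.smult_Fq_hom[OF that(2)] zeta_ctens, symmetric])
    finally show ?thesis using that smult_hom by (simp add: \<Psi>_def)
  qed
  have "inj_on \<Psi> (mod_hom R \<Lambda> M)"
  proof (rule inj_onI)
    fix f g assume *: "f \<in> mod_hom R \<Lambda> M" "g \<in> mod_hom R \<Lambda> M" "\<Psi> f = \<Psi> g"
    then have "f l = g l" if "l \<in> L" for l
      using one_tensor_zeta_inject[OF M fh fh, of f g l] that by (simp add: \<Psi>_def)
    \<comment> \<open>Homomorphisms are extensional, so agreement on \<open>L\<close> is
      equality.\<close>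
    moreover have "f \<in> extensional L" "g \<in> extensional L" using * by (auto simp: mod_hom_def PiE_def)
    ultimately show "f = g" by (intro extensionalityI) auto
  qed
  moreover have "\<Psi> ` mod_hom R \<Lambda> M = Sf Fq A \<phi> M B"
    using cl one_tensor_zeta_surj[OF M] by (force simp: \<Psi>_def image_iff)
  ultimately have "\<Psi> \<in> mod_iso R (Hom_module R \<Lambda> M) (Sf_module Fq A \<phi> M B)"
    unfolding mod_iso_def mod_hom_def[of R "Hom_module R \<Lambda> M"] bij_betw_def
    using cl \<Psi>_add \<Psi>_smult by (auto simp: \<Psi>_def[abs_def])
  then show ?thesis by (simp add: \<Psi>_def Sf_map_zeta)
qed

lemma Sf_map_id: "Sf_map Fq A \<phi> \<Lambda> B\<Lambda> \<Lambda> B\<Lambda> (\<lambda>x\<in>L. x) \<zeta> = \<zeta>"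
proof -
  have id: "Fq_hom \<Lambda> \<Lambda> (\<lambda>l. l)" by (auto simp: Fq_hom_def)
  have "one_tensor Fq B\<Lambda> \<Lambda> B\<Lambda> (\<lambda>x\<in>L. x) \<zeta> = one_tensor Fq B\<Lambda> \<Lambda> B\<Lambda> (\<lambda>x. x) \<zeta>"
    by (rule one_tensor_cong) (use Lam.B_carrier in auto)
  also have "\<dots> = \<zeta>"
    using one_tensor_zeta[OF based_lattice id] by (simp add: zeta_eq Lam.tsum_def S_eq)
  finally show ?thesis by (simp add: Sf_map_zeta)
qed

end

theorem theorem6:
  fixes Fq K Oinf :: "'c::complete_alg_closed_nonarch_field set"
    and \<phi> :: "'c \<Rightarrow> nat \<Rightarrow> 'c"
    and M :: "('c, 'm) module" and N :: "('c, 'n) module"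
    and B\<Lambda> :: "'c set" and BM :: "'m set" and BN :: "'n set"
  defines "A \<equiv> regular_away Fq K Oinf"
    and "R \<equiv> coord_ring Fq K Oinf"
    and "L \<equiv> period_lattice (card Fq) (regular_away Fq K Oinf) \<phi>"
    and "\<Lambda> \<equiv> lattice_module (period_lattice (card Fq) (regular_away Fq K Oinf) \<phi>)"
    and "\<zeta> \<equiv> zeta Fq (period_lattice (card Fq) (regular_away Fq K Oinf) \<phi>) B\<Lambda>"
  assumes "curve_at_infinity Fq K Oinf"
    and "drinfeld_module Fq A \<phi>"
    and "is_basis Fq \<Lambda> B\<Lambda>"
    and "module R M" and "is_basis Fq M BM"
    and "module R N" and "is_basis Fq N BN"
  shows
    \<comment> \<open>\<open>\<Lambda>\<^sub>\<phi>\<close> and \<open>Sf(M)\<close> are modules, and \<open>Sf\<close> acts on morphisms\<close>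
    "module R \<Lambda> \<and>
     module R (Sf_module Fq A \<phi> M BM) \<and>
     (\<forall>g \<in> mod_hom R M N.
        Sf_map Fq A \<phi> M BM N BN g
          \<in> mod_hom R (Sf_module Fq A \<phi> M BM) (Sf_module Fq A \<phi> N BN)) \<and>
     \<comment> \<open>the series defining \<open>\<zeta>\<^sub>\<phi>\<close> converges, and \<open>\<zeta>\<^sub>\<phi>\<close> lies in \<open>Sf(\<Lambda>\<^sub>\<phi>)\<close>\<close>
     (\<exists>s. ctens_has_sum B\<Lambda> (L - {0}) (inverse_tensor Fq L B\<Lambda>) s) \<and>
     \<zeta> \<in> Sf Fq A \<phi> \<Lambda> B\<Lambda> \<and>
     \<comment> \<open>\<open>f \<mapsto> Sf(f)(\<zeta>\<^sub>\<phi>)\<close> is an isomorphism from \<open>Hom(\<Lambda>\<^sub>\<phi>, M)\<close> to \<open>Sf(M)\<close>, natural in \<open>M\<close>\<close>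
     (\<lambda>f \<in> mod_hom R \<Lambda> M. Sf_map Fq A \<phi> \<Lambda> B\<Lambda> M BM f \<zeta>)
       \<in> mod_iso R (Hom_module R \<Lambda> M) (Sf_module Fq A \<phi> M BM) \<and>
     (\<forall>g \<in> mod_hom R M N. \<forall>f \<in> mod_hom R \<Lambda> M.
        Sf_map Fq A \<phi> \<Lambda> B\<Lambda> N BN (compose L g f) \<zeta> =
        Sf_map Fq A \<phi> M BM N BN g (Sf_map Fq A \<phi> \<Lambda> B\<Lambda> M BM f \<zeta>)) \<and>
     \<comment> \<open>the identity of \<open>\<Lambda>\<^sub>\<phi>\<close> corresponds to \<open>\<zeta>\<^sub>\<phi>\<close>\<close>
     Sf_map Fq A \<phi> \<Lambda> B\<Lambda> \<Lambda> B\<Lambda> (\<lambda>x\<in>L. x) \<zeta> = \<zeta>"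
proof -
  have "drinfeld Fq K Oinf \<phi>"
    using assms(6,7) unfolding A_def by (intro drinfeld.intro drinfeld_axioms.intro)
  moreover have "drinfeld_lattice_axioms Fq K Oinf \<phi> B\<Lambda>"
    using assms(8) unfolding \<Lambda>_def by (rule drinfeld_lattice_axioms.intro)
  ultimately interpret D: drinfeld_lattice Fq K Oinf \<phi> B\<Lambda>
    by (rule drinfeld_lattice.intro)
  have M: "D.based_mod M BM" and N: "D.based_mod N BN"
    using assms(9-12) D.drinfeld_axioms unfolding R_def
    by (simp_all add: based_module_def based_module_axioms_def)
  interpret M: based_module Fq K Oinf \<phi> M BM by (rule M)
  show ?thesis
    unfolding A_def R_def L_def \<Lambda>_def \<zeta>_def
    using D.module_lattice M.module_Sf D.mod_hom_Sf_map[OF M N] D.zeta_has_sum D.zeta_Sf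
      D.Hom_iso_Sf[OF M] D.Sf_map_natural[OF M N] D.Sf_map_id
    by blast
qed

end
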